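(* Let $\epsilon\in\mathbb{R}\setminus\{0\}$, let $f^0\in\mathcal{M}^+(\mathbb{R}^6)$ and let $T>0$. Then there exists at most one weak solution $f$ in $\mathcal{D}'([0,T[\times\mathbb{R}^6)$ of the Vlasov-Poisson system $$\partial_t f+\xi\cdot\nabla_x f+\nabla_x\Psi\cdot\nabla_\xi f=0,\qquad \Delta\Psi=\epsilon\rho,\qquad \rho(t,x)=\int_{\mathbb{R}^3} f(t,x,\xi)\,d\xi,\qquad f|_{t=0}=f^0,$$ such that $$\sup_{t\in[0,T[}\|\rho(t,\cdot)\|_{L^\infty(\mathbb{R}^3)}<+\infty .$$
   Context: Points of $\mathbb{R}^6=\mathbb{R}^3\times\mathbb{R}^3$ are written $(x,\xi)$ (position, velocity). $\mathcal{M}(\mathbb{R}^6)$ (resp. $\mathcal{M}^+(\mathbb{R}^6)$) is the set of bounded (resp. bounded and positive) measures on $\mathbb{R}^6$. For a time-dependent measure $f(t)\in\mathcal{M}^+(\mathbb{R}^6)$, $\rho(t)=\int f(t,\cdot,\xi)\,d\xi$ denotes its marginal in $x$ (the push-forward of $f(t)$ under $(x,\xi)\mapsto x$); the condition $\rho(t,\cdot)\in L^\infty(\mathbb{R}^3)$ means that this marginal has an $L^\infty$ density with respect to Lebesgue measure. A weak solution in $\mathcal{D}'([0,T[\times\mathbb{R}^6)$ with initial datum $f^0$ is a family $f$ such that: (i) $f\in C([0,T[;\mathcal{M}^+(\mathbb{R}^6)\text{-}w* )$, i.e. $t\mapsto f(t)$ is continuous for the weak-* topology of measures; (ii) for all $\varphi\in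 C_c^\infty([0,T[\times\mathbb{R}^6)$, $$\int_0^T\!\!\int_{\mathbb{R}^6}\big(\partial_t\varphi+\xi\cdot\nabla_x\varphi+\nabla_x\Psi\cdot\nabla_\xi\varphi\big)\,df(t)\,dt=-\int_{\mathbb{R}^6}\varphi(0,x,\xi)\,df^0(x,\xi);$$ (iii) the equation $\Delta\Psi=\epsilon\rho$ is understood as $$\Psi(t,x)=-\epsilon\int_{\mathbb{R}^3}\frac{\rho(t,y)}{4\pi|x-y|}\,dy .$$ The case $\epsilon>0$ is the electrostatic case, and $\epsilon<0$ the gravitational case. When $\rho$ is bounded, $\nabla_x\Psi$ is continuous, so the product $f\nabla_x\Psi$ is well defined. *)

theory Defs
  imports "HOL-Probability.Essential_Supremum"
begin

type_synonym R3 = "real ^ 3"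

definition bounded_positive_measures :: "'a::topological_space measure set" where
  "bounded_positive_measures = {\<mu>. sets \<mu> = sets borel \<and> finite_measure \<mu>}"

definition C0_functions :: "('a::real_normed_vector \<Rightarrow> real) set" where
  "C0_functions = {g. continuous_on UNIV g \<and> (g \<longlongrightarrow> 0) at_infinity}"

text \<open>The space of bounded measures is the dual of the space of continuous functions vanishing
  at infinity; its weak-* topology is the coarsest one making all the maps
  \<open>\<mu> \<mapsto> \<integral> g d\<mu>\<close> continuous. Here it is restricted to the positive measures.\<close>

definition weak_star_topology :: "'a::real_normed_vector measure topology" where
  "weak_star_topology =
     pullback_topology bounded_positive_measures (\<lambda>\<mu>. \<lambda>g\<in>C0_functions. LINT z|\<mu>. g z)
       (product_topology (\<lambda>_. euclideanreal) C0_functions)"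

lemma topspace_weak_star_topology:
  "topspace weak_star_topology = bounded_positive_measures"
  by (auto simp: weak_star_topology_def topspace_pullback_topology)

lemma continuous_map_weak_star_topology_iff:
  "continuous_map X weak_star_topology f \<longleftrightarrow>
     f ` topspace X \<subseteq> bounded_positive_measures \<and>
     (\<forall>g\<in>C0_functions. continuous_map X euclideanreal (\<lambda>x. LINT z|f x. g z))"
proof -
  let ?T = "product_topology (\<lambda>_. euclideanreal) C0_functions"
  let ?I = "\<lambda>\<mu>. \<lambda>g\<in>C0_functions. LINT z|\<mu>. g z"
  have "continuous_map X (pullback_topology bounded_positive_measures ?I ?T) f \<longleftrightarrow>
      f ` topspace X \<subseteq> bounded_positive_measures \<and> continuous_map X ?T (?I \<circ> f)"
    (is "?L \<longleftrightarrow> ?A \<and> ?B")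
  proof
    assume L: ?L
    have "?A"
      using L by (auto simp: continuous_map_def topspace_pullback_topology Pi_iff)
    moreover have "?B"
      by (rule continuous_map_compose[OF L])
         (use continuous_map_pullback[OF continuous_map_id] in \<open>auto simp: o_def\<close>)
    ultimately show "?A \<and> ?B" by blast
  next
    assume "?A \<and> ?B"
    then show ?L by (intro continuous_map_pullback') auto
  qed
  then show ?thesis
    by (simp add: weak_star_topology_def continuous_map_componentwise o_def image_subset_iff
        cong: ball_cong)
qed

definition grad :: "('a::real_inner \<Rightarrow> real) \<Rightarrow> 'a \<Rightarrow> 'a" where
  "grad f x = (THE D. GDERIV f x :> D)"

lemma grad_eqI: "GDERIV f x :> D \<Longrightarrow> grad f x = D"
proof -
  assume D: "GDERIV f x :> D"
  have "E = D" if "GDERIV f x :> E" for E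
  proof -
    have "(\<lambda>h. h \<bullet> E) = (\<lambda>h. h \<bullet> D)"
      using has_derivative_unique[OF that[unfolded gderiv_def] D[unfolded gderiv_def]] .
    then have "(E - D) \<bullet> E = (E - D) \<bullet> D" by (rule fun_cong)
    then have "(E - D) \<bullet> (E - D) = 0" by (simp add: inner_diff_right)
    then show ?thesis by simp
  qed
  with D show ?thesis unfolding grad_def by blast
qed

text \<open>\<open>Ck k f\<close> says that \<open>f\<close> is of class \<open>C\<^sup>k\<close> on the whole space.\<close>

fun Ck :: "nat \<Rightarrow> ('a::euclidean_space \<Rightarrow> real) \<Rightarrow> bool" where
  "Ck 0 f \<longleftrightarrow> continuous_on UNIV f"
| "Ck (Suc k) f \<longleftrightarrow>
     (\<forall>z. f differentiable (at z)) \<and> (\<forall>v. Ck k (\<lambda>z. frechet_derivative f (at z) v))"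

definition smooth :: "('a::euclidean_space \<Rightarrow> real) \<Rightarrow> bool" where
  "smooth f \<longleftrightarrow> (\<forall>k. Ck k f)"

text \<open>The test functions \<open>C\<^sub>c\<^sup>\<infinity>([0,T[ \<times> \<real>\<^sup>6)\<close>: smoothness up to the boundary \<open>t = 0\<close> means being the
  restriction to \<open>t \<ge> 0\<close> of a smooth function on the whole space. We represent a test function by
  such an extension; its values at negative times are irrelevant, so only its support in
  \<open>t \<ge> 0\<close> is required to be compact. It may meet \<open>t = 0\<close> but stays away from \<open>t = T\<close>.\<close>

definition test_functions :: "real \<Rightarrow> (real \<times> R3 \<times> R3 \<Rightarrow> real) set" where
  "test_functions T =
     {\<phi>. smooth \<phi> \<and>
         compact (closure {z \<in> {0..} \<times> UNIV. \<phi> z \<noteq> 0}) \<and>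
         closure {z \<in> {0..} \<times> UNIV. \<phi> z \<noteq> 0} \<subseteq> {0..<T} \<times> UNIV}"

definition spatial_marginal :: "(R3 \<times> R3) measure \<Rightarrow> R3 measure" where
  "spatial_marginal \<mu> = distr \<mu> borel fst"

text \<open>The potential is integrated against the marginal itself, which is \<open>\<rho>(y) dy\<close> when the
  marginal has a density \<open>\<rho>\<close>. The value \<open>0\<close> that division by zero gives the kernel at \<open>y = x\<close>
  is then immaterial.\<close>

definition potential :: "real \<Rightarrow> (R3 \<times> R3) measure \<Rightarrow> R3 \<Rightarrow> real" where
  "potential \<epsilon> \<mu> x = - \<epsilon> * (LINT y|spatial_marginal \<mu>. 1 / (4 * pi * norm (x - y)))"

text \<open>The integrals below are genuine (the integrands are integrable) for families satisfying
  \<open>bounded_density\<close>, the only ones for which weak solutions are considered.\<close>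

definition vlasov_poisson_weak_solution ::
    "real \<Rightarrow> real \<Rightarrow> (R3 \<times> R3) measure \<Rightarrow> (real \<Rightarrow> (R3 \<times> R3) measure) \<Rightarrow> bool" where
  "vlasov_poisson_weak_solution \<epsilon> T f0 f \<longleftrightarrow>
     continuous_map (top_of_set {0..<T}) weak_star_topology f \<and>
     (\<forall>\<phi>\<in>test_functions T.
        (LINT t:{0..<T}|lborel. (LINT (x, \<xi>)|f t.
             deriv (\<lambda>s. \<phi> (s, x, \<xi>)) t
             + \<xi> \<bullet> grad (\<lambda>y. \<phi> (t, y, \<xi>)) x
             + grad (potential \<epsilon> (f t)) x \<bullet> grad (\<lambda>\<eta>. \<phi> (t, x, \<eta>)) \<xi>))
        = - (LINT (x, \<xi>)|f0. \<phi> (0, x, \<xi>)))"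

text \<open>\<open>L\<^sup>\<infinity>\<close> norm, with values in \<open>[0,\<infinity>]\<close>, of the Lebesgue density of a measure; a measure without
  density gets norm \<open>\<infinity>\<close>.\<close>

definition Linfty_norm_density :: "'a::euclidean_space measure \<Rightarrow> ennreal" where
  "Linfty_norm_density \<mu> =
     (if absolutely_continuous lborel \<mu> then esssup lborel (RN_deriv lborel \<mu>) else \<infinity>)"

definition bounded_density :: "real \<Rightarrow> (real \<Rightarrow> (R3 \<times> R3) measure) \<Rightarrow> bool" where
  "bounded_density T f \<longleftrightarrow>
     (SUP t\<in>{0..<T}. Linfty_norm_density (spatial_marginal (f t))) < \<infinity>"

end

theory Submission
  imports Defs "HOL-Probability.Probability"
begin

text \<open>
  The proof is a duality argument that needs neither characteristics nor optimal transport. For a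
  test function \<open>\<phi>\<close> on the phase space let \<open>gap t \<phi> = \<integral> \<phi> d(f t) - \<integral> \<phi> d(g t)\<close>, and suppose that
  \<open>\<bar>gap a \<phi>\<bar> \<le> \<alpha>\<close> for all compactly supported \<open>C\<^sup>1\<close> functions with \<open>\<bar>\<nabla>\<phi>\<bar> \<le> 1\<close>. On a short interval
  \<open>[a, b]\<close> the weak formulation is tested with \<open>\<phi>(x + (b - s) \<xi>, \<xi> + (b - s) F(x))\<close>, where \<open>F\<close> is
  the force of \<open>f a\<close> computed with the kernel softened at scale \<open>d\<close>. As the densities are bounded,
  the softening costs \<open>O(d)\<close> while \<open>F\<close> is Lipschitz with constant \<open>L = O(1 + ln (1/d))\<close>, so
  composing with this map enlarges gradients by a factor \<open>1 + O((b - a) L)\<close> only. The remaining term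
  \<open>\<integral> \<nabla>\<^sub>\<xi>\<phi> \<bullet> (E\<^sub>g - E\<^sub>f) dg\<close> equals, by Fubini, \<open>gap s v\<close> with \<open>v = K * (\<nabla>\<^sub>\<xi>\<phi> g)\<close>, which again has a
  gradient \<open>O(L)\<close>. Hence \<open>\<alpha>\<close> obeys a discrete Gronwall inequality with rate \<open>O(L)\<close> and source
  \<open>O(d)\<close>. After time \<open>\<tau>\<close> the gap is \<open>O(d exp (\<tau> L)) = O(d\<^bsup>1 - C \<tau>\<^esup>)\<close>, which tends to 0
  with \<open>d\<close> when \<open>\<tau>\<close> is small, and short intervals can be chained. Velocity moments are not assumed:
  cutoffs at radius \<open>R\<close> leave tails whose time integrals vanish as \<open>R \<rightarrow> \<infinity>\<close>.
\<close>

text \<open>The kernel \<open>x / norm x ^ 3\<close> is locally integrable, but its derivative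
  misses local integrability by a logarithm; a bounded density therefore makes the force
  log-Lipschitz only, and some softening is unavoidable in a linear estimate. Weak-* continuity is
  tested against functions vanishing at infinity and gives no control of the mass near infinity that
  is uniform in time. Hence tails are always integrated in time, where dominated convergence
  applies, and forces at two times are compared only after their sources have been cut off. Freezing
  the force also produces an error in which its derivative multiplies the velocity. Test functions
  therefore carry a velocity radius, which grows by at most the bound \<open>Cb\<close> of the force
  times the elapsed time when going backwards. The order of the limits is forced: first the step
  length tends to 0 with \<open>R\<close> and \<open>d\<close> fixed, then \<open>R\<close> tends to
  infinity, then \<open>d\<close> tends to 0, since the error constants of each limit blow up in the
  later ones.\<close>

section \<open>Coulomb kernel estimates\<close>

text \<open>Polar coordinates for radial functions. Half-lines generate the Borel sets, and on
  \<open>{..a}\<close> both measures give the volume \<open>4/3 * pi * a^3\<close> of a ball, the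
  right one by integrating \<open>4 * pi * r^2\<close>.\<close>

lemma distr_norm_lborel_R3:
  "distr lborel borel (norm :: R3 \<Rightarrow> real) = density lborel (\<lambda>r. ennreal (4 * pi * r\<^sup>2) * indicator {0..} r)"
    (is "?L = ?R")
proof (rule measure_eqI_generator_eq[of "range atMost" UNIV ?L ?R "\<lambda>n. {..real n}"])
  show "Int_stable (range (atMost :: real \<Rightarrow> real set))"
    by (auto simp: Int_stable_def)
  show "range (atMost :: real \<Rightarrow> real set) \<subseteq> Pow UNIV" by auto
  show "sets ?L = sigma_sets UNIV (range atMost)" "sets ?R = sigma_sets UNIV (range atMost)"
    by (simp_all add: borel_eq_atMost)
  show "range (\<lambda>n. {..real n}) \<subseteq> range atMost" by auto
  show "(\<Union>n. {..real n}) = UNIV" by (auto intro: real_arch_simple)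
  have L: "emeasure ?L {..a} = (if a \<ge> 0 then ennreal (4/3 * pi * a^3) else 0)" for a
  proof -
    have *: "norm -` {..a} = cball (0::R3) a" by auto
    show ?thesis
      by (subst emeasure_distr) (auto simp: * emeasure_cball unit_ball_vol_3)
  qed
  show "emeasure ?L {..real i} \<noteq> \<infinity>" for i by (simp add: L)
  show "emeasure ?L X = emeasure ?R X" if "X \<in> range atMost" for X
  proof -
    from that obtain a where X: "X = {..a}" by auto
    have R: "emeasure ?R {..a} = (\<integral>\<^sup>+r. ennreal (4 * pi * r\<^sup>2) * indicator {0..a} r \<partial>lborel)"
      by (subst emeasure_density) (auto intro!: nn_integral_cong simp: indicator_def)
    show ?thesis
    proof (cases "a \<ge> 0")
      case True
      have "(\<integral>\<^sup>+r. ennreal (4 * pi * r\<^sup>2) * indicator {0..a} r \<partial>lborel) = 4/3*pi*a^3 - 4/3*pi*0^3"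
        using True by (intro nn_integral_FTC_Icc) (auto intro!: derivative_eq_intros simp: algebra_simps)
      with True show ?thesis unfolding X L R by simp
    qed (simp add: X L R)
  qed
qed

lemma nn_integral_radial_R3:
  assumes [measurable]: "g \<in> borel_measurable borel"
  shows "(\<integral>\<^sup>+x. g (norm (x::R3)) \<partial>lborel) = (\<integral>\<^sup>+r. ennreal (4 * pi * r\<^sup>2) * indicator {0..} r * g r \<partial>lborel)"
proof -
  have "(\<integral>\<^sup>+x. g (norm (x::R3)) \<partial>lborel) = (\<integral>\<^sup>+r. g r \<partial>distr lborel borel (norm :: R3 \<Rightarrow> real))"
    by (simp add: nn_integral_distr)
  also have "\<dots> = (\<integral>\<^sup>+r. ennreal (4 * pi * r\<^sup>2) * indicator {0..} r * g r \<partial>lborel)"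
    unfolding distr_norm_lborel_R3 by (subst nn_integral_density) auto
  finally show ?thesis .
qed

lemma nn_integral_inverse_square_ball:
  "(\<integral>\<^sup>+x. ennreal (indicator {..<1} (norm (x::R3)) / (norm x)\<^sup>2) \<partial>lborel) \<le> ennreal (4 * pi)"
proof -
  have "(\<integral>\<^sup>+x. ennreal (indicator {..<1} (norm (x::R3)) / (norm x)\<^sup>2) \<partial>lborel)
    = (\<integral>\<^sup>+r. ennreal (4 * pi * r\<^sup>2) * indicator {0..} r * ennreal (indicator {..<1} r / r\<^sup>2) \<partial>lborel)"
    by (rule nn_integral_radial_R3) simp
  also have "\<dots> \<le> (\<integral>\<^sup>+r. ennreal (4 * pi) * indicator {0..1::real} r \<partial>lborel)"
    by (intro nn_integral_mono) (auto simp: indicator_def ennreal_mult[symmetric])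
  also have "\<dots> = ennreal (4 * pi)"
    by (simp add: nn_integral_cmult)
  finally show ?thesis .
qed

lemma nn_integral_inverse_square_tail:
  assumes d: "d > 0"
  shows "(\<integral>\<^sup>+r. ennreal (1 / r\<^sup>2) * indicator {d..} r \<partial>lborel) = ennreal (1 / d)"
proof -
  have "(\<integral>\<^sup>+r. ennreal (1 / r\<^sup>2) * indicator {d..} r \<partial>lborel) = ennreal (0 - (- 1 / d))"
  proof (rule nn_integral_FTC_atLeast[where F = "\<lambda>r. - 1 / r"])
    show "DERIV (\<lambda>r. - 1 / r) x :> 1 / x\<^sup>2" if "d \<le> x" for x
      using that d by (auto intro!: derivative_eq_intros simp: power2_eq_square)
    show "((\<lambda>r::real. - 1 / r) \<longlongrightarrow> 0) at_top"
      by (rule tendsto_divide_0[OF tendsto_const]) (simp add: filterlim_at_top_imp_at_infinity filterlim_ident)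
  qed auto
  then show ?thesis by simp
qed

text \<open>Split at \<open>r = d\<close>. Inside, the first entry of the minimum cancels against
  the surface factor and gives \<open>4 * pi * d\<close>; outside, the second one leaves
  \<open>12 * pi * d^2 / r^2\<close>, which integrates to \<open>12 * pi * d\<close>.\<close>

lemma nn_integral_kernel_error:
  assumes d: "d > 0"
  shows "(\<integral>\<^sup>+x. ennreal (min 1 (3 * d\<^sup>2 / (norm (x::R3))\<^sup>2) / (norm x)\<^sup>2) \<partial>lborel) \<le> ennreal (16 * pi * d)"
proof -
  have "(\<integral>\<^sup>+x. ennreal (min 1 (3 * d\<^sup>2 / (norm (x::R3))\<^sup>2) / (norm x)\<^sup>2) \<partial>lborel)
    = (\<integral>\<^sup>+r. ennreal (4 * pi * r\<^sup>2) * indicator {0..} r * ennreal (min 1 (3 * d\<^sup>2 / r\<^sup>2) / r\<^sup>2) \<partial>lborel)"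
    by (rule nn_integral_radial_R3) simp
  also have "\<dots> \<le> (\<integral>\<^sup>+r. ennreal (4 * pi) * indicator {0..d} r
      + ennreal (12 * pi * d\<^sup>2) * (ennreal (1 / r\<^sup>2) * indicator {d..} r) \<partial>lborel)"
  proof (intro nn_integral_mono)
    fix r :: real
    have "4 * pi * r\<^sup>2 * (min 1 (3 * d\<^sup>2 / r\<^sup>2) / r\<^sup>2) \<le> 4 * pi"
      by (cases "r = 0") (auto simp: min_def)
    moreover have "4 * pi * r\<^sup>2 * (min 1 (3 * d\<^sup>2 / r\<^sup>2) / r\<^sup>2) \<le> 12 * pi * d\<^sup>2 * (1 / r\<^sup>2)"
      by (cases "r = 0") (auto simp: min_def field_simps)
    ultimately show "ennreal (4 * pi * r\<^sup>2) * indicator {0..} r * ennreal (min 1 (3 * d\<^sup>2 / r\<^sup>2) / r\<^sup>2)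
      \<le> ennreal (4 * pi) * indicator {0..d} r + ennreal (12 * pi * d\<^sup>2) * (ennreal (1 / r\<^sup>2) * indicator {d..} r)"
      using d by (auto simp: indicator_def ennreal_mult[symmetric] ennreal_plus[symmetric] simp del: ennreal_plus
          intro!: ennreal_leI)
  qed
  also have "\<dots> = ennreal (4 * pi) * ennreal d + ennreal (12 * pi * d\<^sup>2) * ennreal (1 / d)"
    using d by (subst nn_integral_add) (simp_all add: nn_integral_cmult nn_integral_inverse_square_tail)
  also have "\<dots> = ennreal (16 * pi * d)"
    using d by (simp add: ennreal_mult[symmetric] ennreal_plus[symmetric] power2_eq_square del: ennreal_plus)
  finally show ?thesis .
qed

text \<open>This is where the logarithm arises. With the surface factor the radial integrand is at
  most \<open>4 * pi / d\<close> up to \<open>r = d\<close> and at most \<open>4 * pi / r\<close>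
  from there to 1.\<close>

lemma nn_integral_inverse_cube_ball:
  assumes d: "0 < d" "d \<le> 1"
  shows "(\<integral>\<^sup>+x. ennreal (indicator {..<1} (norm (x::R3)) / sqrt ((norm x)\<^sup>2 + d\<^sup>2) ^ 3) \<partial>lborel)
    \<le> ennreal (4 * pi * (1 + ln (1 / d)))"
proof -
  have "(\<integral>\<^sup>+x. ennreal (indicator {..<1} (norm (x::R3)) / sqrt ((norm x)\<^sup>2 + d\<^sup>2) ^ 3) \<partial>lborel)
    = (\<integral>\<^sup>+r. ennreal (4 * pi * r\<^sup>2) * indicator {0..} r * ennreal (indicator {..<1} r / sqrt (r\<^sup>2 + d\<^sup>2) ^ 3) \<partial>lborel)"
    by (rule nn_integral_radial_R3) simp
  also have "\<dots> \<le> (\<integral>\<^sup>+r. ennreal (4 * pi / d) * indicator {0..d} r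
      + ennreal (4 * pi) * (ennreal (1 / r) * indicator {d..1} r) \<partial>lborel)"
  proof (intro nn_integral_mono)
    fix r :: real
    let ?q = "sqrt (r\<^sup>2 + d\<^sup>2)"
    have q: "?q > 0" "?q \<ge> d" "?q \<ge> \<bar>r\<bar>" "?q\<^sup>2 \<ge> r\<^sup>2"
      using d by (auto simp: sum_power2_gt_zero_iff real_le_rsqrt)
    have eq: "r\<^sup>2 / ?q ^ 3 \<le> 1 / ?q"
      using q by (auto simp: pos_divide_le_eq power2_eq_square power3_eq_cube)
    have "r\<^sup>2 / ?q ^ 3 \<le> 1 / d"
      using eq q(2) d by (meson divide_left_mono less_le_trans order_trans mult_pos_pos zero_le_one)
    then have 1: "4 * pi * r\<^sup>2 * (1 / ?q ^ 3) \<le> 4 * pi / d"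
      using mult_left_mono[of "r\<^sup>2 / ?q ^ 3" "1 / d" "4 * pi"] by simp
    \<comment> \<open>At \<open>r = d\<close> both indicators on the right are 1 and their
      contributions add up to \<open>8 * pi / d\<close>.\<close>
    have 3: "4 * pi / d \<le> 8 * pi / d" using d by (intro divide_right_mono) auto
    have "r\<^sup>2 / ?q ^ 3 \<le> 1 / r" if "r > 0"
      using order_trans[OF eq] q that by (simp add: frac_le)
    then have 2: "4 * pi * r\<^sup>2 * (1 / ?q ^ 3) \<le> 4 * pi * (1 / r)" if "r > 0"
      using mult_left_mono[of "r\<^sup>2 / ?q ^ 3" "1 / r" "4 * pi"] that by simp
    show "ennreal (4 * pi * r\<^sup>2) * indicator {0..} r * ennreal (indicator {..<1} r / ?q ^ 3)
      \<le> ennreal (4 * pi / d) * indicator {0..d} r + ennreal (4 * pi) * (ennreal (1 / r) * indicator {d..1} r)"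
      using d 1 order_trans[OF 1 3] 2 q by (auto simp: indicator_def ennreal_mult[symmetric] ennreal_plus[symmetric] simp del: ennreal_plus
          intro!: ennreal_leI add_increasing2)
  qed
  also have "\<dots> = ennreal (4 * pi / d) * ennreal d + ennreal (4 * pi) * ennreal (ln 1 - ln d)"
  proof -
    have "(\<integral>\<^sup>+r. ennreal (1 / r) * indicator {d..1} r \<partial>lborel) = ennreal (ln 1 - ln d)"
      using d by (intro nn_integral_FTC_Icc) (auto intro!: derivative_eq_intros)
    then show ?thesis
      using d by (subst nn_integral_add) (simp_all add: nn_integral_cmult)
  qed
  also have "\<dots> = ennreal (4 * pi * (1 + ln (1 / d)))"
    using d by (subst ennreal_mult[symmetric], simp, simp, subst ennreal_mult[symmetric], simp, simp, subst ennreal_plus[symmetric])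
      (auto simp: ln_div algebra_simps mult_nonneg_nonpos)
  finally show ?thesis .
qed


section \<open>The softened Coulomb kernel and its derivative\<close>

lemma borel_measurable_fst_snd [measurable]:
  "fst \<in> borel_measurable (borel :: ('a::second_countable_topology \<times> 'b::second_countable_topology) measure)"
  "snd \<in> borel_measurable (borel :: ('a::second_countable_topology \<times> 'b::second_countable_topology) measure)"
  by (auto intro!: borel_measurable_continuous_onI continuous_intros)

definition soft_norm :: "real \<Rightarrow> R3 \<Rightarrow> real" where
  "soft_norm d x = sqrt ((norm x)\<^sup>2 + d\<^sup>2)"

text \<open>For \<open>d > 0\<close> this is minus the gradient of \<open>1 / soft_norm d\<close>.
  For \<open>d = 0\<close> it is the Coulomb kernel itself, with value 0 at the origin.\<close>

definition coulomb :: "real \<Rightarrow> R3 \<Rightarrow> R3" where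
  "coulomb d x = (1 / soft_norm d x ^ 3) *\<^sub>R x"

definition coulomb_deriv :: "real \<Rightarrow> R3 \<Rightarrow> R3 \<Rightarrow> R3" where
  "coulomb_deriv d x v = (1 / soft_norm d x ^ 3) *\<^sub>R v - (3 * (x \<bullet> v) / soft_norm d x ^ 5) *\<^sub>R x"

lemma soft_norm_ge_norm: "norm x \<le> soft_norm d x"
  by (simp add: soft_norm_def real_le_rsqrt)

lemma soft_norm_ge: "d \<ge> 0 \<Longrightarrow> d \<le> soft_norm d x"
  by (simp add: soft_norm_def real_le_rsqrt)

lemma soft_norm_pos: "d > 0 \<Longrightarrow> soft_norm d x > 0"
  using soft_norm_ge[of d x] by simp

lemma soft_norm_0 [simp]: "soft_norm 0 x = norm x"
  by (simp add: soft_norm_def)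

lemma borel_measurable_soft_norm [measurable]: "soft_norm d \<in> borel_measurable borel"
  unfolding soft_norm_def[abs_def] by measurable

lemma borel_measurable_coulomb [measurable]: "coulomb d \<in> borel_measurable borel"
  unfolding coulomb_def[abs_def] by measurable

lemma norm_coulomb: "norm (coulomb d x) = norm x / soft_norm d x ^ 3"
  by (simp add: coulomb_def soft_norm_def)

lemma norm_coulomb_le: "norm (coulomb d x) \<le> 1 / (norm x)\<^sup>2"
proof (cases "x = 0")
  case False
  then have "norm x / soft_norm d x ^ 3 \<le> norm x / norm x ^ 3"
    using soft_norm_ge_norm[of x d] by (intro divide_left_mono power_mono mult_pos_pos zero_less_power) (auto intro: less_le_trans[of _ "norm x"])
  also have "\<dots> = 1 / (norm x)\<^sup>2"
    using False by (simp add: power2_eq_square power3_eq_cube)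
  finally show ?thesis by (simp add: norm_coulomb)
qed (simp add: coulomb_def)

lemma norm_coulomb_le_const: 
  assumes "d > 0" shows "norm (coulomb d x) \<le> 1 / d\<^sup>2"
proof -
  note p = soft_norm_pos[OF assms, of x]
  have "norm x / soft_norm d x ^ 3 \<le> soft_norm d x / soft_norm d x ^ 3"
    using soft_norm_ge_norm[of x d] p by (intro divide_right_mono) auto
  also have "\<dots> = 1 / (soft_norm d x)\<^sup>2"
    using p by (simp add: power2_eq_square power3_eq_cube)
  also have "\<dots> \<le> 1 / d\<^sup>2"
    using soft_norm_ge[of d x] assms p by (intro divide_left_mono power_mono mult_pos_pos) auto
  finally show ?thesis by (simp add: norm_coulomb)
qed

text \<open>With \<open>y = r / q\<close> the difference has norm \<open>(1 - y^3) / r^2\<close>.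
  From \<open>0 < y \<le> 1\<close> follows \<open>1 - y^3 \<le> 3 * (1 - y^2)\<close>, and
  \<open>1 - y^2 = d^2 / q^2\<close>.\<close>

lemma norm_coulomb_diff_le: "norm (coulomb 0 x - coulomb d x) \<le> min 1 (3 * d\<^sup>2 / (norm x)\<^sup>2) / (norm x)\<^sup>2"
proof (cases "x = 0")
  case False
  define r where "r = norm x"
  define q where "q = soft_norm d x"
  have r: "r > 0" "q \<ge> r" "q\<^sup>2 = r\<^sup>2 + d\<^sup>2"
    using False soft_norm_ge_norm[of x d] by (auto simp: r_def q_def soft_norm_def)
  define y where "y = r / q"
  have y: "0 < y" "y \<le> 1" using r by (auto simp: y_def)
  have "norm (coulomb 0 x - coulomb d x) = norm ((1 / r^3 - 1 / q^3) *\<^sub>R x)"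
    by (simp add: coulomb_def r_def q_def scaleR_left_diff_distrib)
  also have "\<dots> = \<bar>1 / r^3 - 1 / q^3\<bar> * r"
    by (simp add: r_def)
  also have "\<bar>1 / r^3 - 1 / q^3\<bar> = (1 - y^3) / r^3"
  proof -
    have "1 / q ^ 3 \<le> 1 / r ^ 3" using r by (intro divide_left_mono power_mono mult_pos_pos) auto
    moreover have "(1 - y^3) / r^3 = 1 / r^3 - 1 / q^3"
      using r by (simp add: y_def power_divide diff_divide_distrib)
    ultimately show ?thesis by simp
  qed
  also have "(1 - y^3) / r^3 * r = (1 - y^3) / r\<^sup>2"
    using r by (simp add: power2_eq_square power3_eq_cube)
  also have "\<dots> \<le> min 1 (3 * d\<^sup>2 / r\<^sup>2) / r\<^sup>2"
  proof (intro divide_right_mono min.boundedI)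
    show "1 - y ^ 3 \<le> 1" using y by simp
    have "y * y \<le> 1" "y * y \<le> y" using y by (simp_all add: mult_le_one mult_left_le)
    then have "(1 - y) * (1 + y + y * y) \<le> (1 - y) * 3"
      using y \<open>y * y \<le> 1\<close> by (intro mult_left_mono) linarith+
    then have "1 - y ^ 3 \<le> 3 * (1 - y\<^sup>2)"
      using \<open>y * y \<le> y\<close> by (simp add: power2_eq_square power3_eq_cube algebra_simps)
    also have "1 - y\<^sup>2 = d\<^sup>2 / q\<^sup>2"
    proof -
      have "q\<^sup>2 \<noteq> 0" using r(1,2) by simp
      then have "1 - y\<^sup>2 = (q\<^sup>2 - r\<^sup>2) / q\<^sup>2" by (simp add: y_def power_divide diff_divide_distrib)
      then show ?thesis using r(3) by simp
    qed
    also have "d\<^sup>2 / q\<^sup>2 \<le> d\<^sup>2 / r\<^sup>2"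
      using r(1,2) by (intro divide_left_mono power_mono mult_pos_pos) auto
    finally show "1 - y ^ 3 \<le> 3 * d\<^sup>2 / r\<^sup>2" by simp
  qed simp
  finally show ?thesis by (simp add: r_def)
qed (simp add: coulomb_def)

lemma has_derivative_soft_norm:
  assumes "d > 0"
  shows "(soft_norm d has_derivative (\<lambda>v. (x \<bullet> v) / soft_norm d x)) (at x)"
proof -
  have "(norm x)\<^sup>2 + d\<^sup>2 > 0" using assms by (simp add: add_nonneg_pos)
  then show ?thesis
    unfolding soft_norm_def[abs_def] power2_norm_eq_inner
    by (auto intro!: derivative_eq_intros simp: inner_commute field_simps)
qed

lemma has_derivative_inverse_soft_norm:
  assumes "d > 0"
  shows "((\<lambda>x. 1 / soft_norm d x) has_derivative (\<lambda>v. - (coulomb d x \<bullet> v))) (at x)"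
  using soft_norm_pos[OF assms, of x]
  by (auto intro!: derivative_eq_intros has_derivative_soft_norm[OF assms]
      simp: coulomb_def power2_eq_square power3_eq_cube field_simps)

lemma has_derivative_coulomb:
  assumes "d > 0"
  shows "(coulomb d has_derivative coulomb_deriv d x) (at x)"
  using soft_norm_pos[OF assms, of x] unfolding coulomb_def[abs_def] coulomb_deriv_def[abs_def]
  by (auto intro!: derivative_eq_intros has_derivative_soft_norm[OF assms]
      simp: power_eq_if field_simps)

lemma continuous_on_soft_norm [continuous_intros]:
  "continuous_on S f \<Longrightarrow> continuous_on S (\<lambda>x. soft_norm d (f x))"
  unfolding soft_norm_def by (intro continuous_intros)

lemma continuous_on_coulomb [continuous_intros]:
  "d > 0 \<Longrightarrow> continuous_on S f \<Longrightarrow> continuous_on S (\<lambda>x. coulomb d (f x))"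
  unfolding coulomb_def using soft_norm_pos[of d] by (intro continuous_intros) (auto simp: less_imp_neq[symmetric])

lemma continuous_on_coulomb_deriv [continuous_intros]:
  "d > 0 \<Longrightarrow> continuous_on S f \<Longrightarrow> continuous_on S (\<lambda>x. coulomb_deriv d (f x) v)"
  unfolding coulomb_deriv_def using soft_norm_pos[of d] by (intro continuous_intros) (auto simp: less_imp_neq[symmetric])

lemma norm_coulomb_deriv_le:
  assumes "d > 0"
  shows "norm (coulomb_deriv d x v) \<le> 4 / soft_norm d x ^ 3 * norm v"
proof -
  define q where "q = soft_norm d x"
  have q: "q > 0" "norm x \<le> q" using soft_norm_pos[OF assms] soft_norm_ge_norm by (auto simp: q_def)
  have "norm (coulomb_deriv d x v) \<le> norm v / q^3 + 3 * \<bar>x \<bullet> v\<bar> / q^5 * norm x"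
    unfolding coulomb_deriv_def q_def[symmetric] using q
    by (intro order_trans[OF norm_triangle_ineq4]) (simp add: abs_mult)
  also have "3 * \<bar>x \<bullet> v\<bar> / q^5 * norm x \<le> 3 * (q * norm v) / q^5 * q"
    using q Cauchy_Schwarz_ineq2[of x v] 
    by (intro mult_mono divide_right_mono) (auto intro!: order_trans[OF Cauchy_Schwarz_ineq2] mult_right_mono)
  also have "\<dots> = 3 * norm v / q^3"
    using q by (simp add: power_eq_if)
  finally show ?thesis by (simp add: q_def add_divide_distrib[symmetric])
qed

lemma norm_coulomb_deriv_le_const:
  assumes "d > 0"
  shows "norm (coulomb_deriv d x v) \<le> 4 / d ^ 3 * norm v"
proof -
  have "4 / soft_norm d x ^ 3 \<le> 4 / d ^ 3"
    using soft_norm_ge[of d x] assms soft_norm_pos[OF assms, of x]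
    by (intro divide_left_mono power_mono mult_pos_pos) auto
  then show ?thesis
    using norm_coulomb_deriv_le[OF assms, of x v] mult_right_mono[OF _ norm_ge_zero] order_trans by blast
qed


section \<open>Fields of measures with bounded spatial marginal\<close>

definition field :: "real \<Rightarrow> (R3 \<times> R3) measure \<Rightarrow> R3 \<Rightarrow> R3" where
  "field d \<mu> x = (LINT z|\<mu>. coulomb d (x - fst z))"

text \<open>A Lipschitz constant of the softened field: the 4 of
  \<open>norm_coulomb_deriv_le\<close> times \<open>A * (4 * pi * (1 + ln (1 / d)))\<close> for
  sources within distance 1, and times the mass \<open>M\<close> for the others.\<close>

definition log_bound :: "real \<Rightarrow> real \<Rightarrow> real \<Rightarrow> real" where
  "log_bound A M d = A * (16 * pi * (1 + ln (1 / d))) + 4 * M"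

text \<open>The density bound is encoded as domination of integrals by \<open>A\<close> times
  Lebesgue measure. The estimates then never meet a Radon-Nikodym derivative, and enlarging
  \<open>A\<close> or \<open>M\<close> preserves the property, so two solutions can share their
  constants.\<close>

locale bounded_marginal = finite_measure \<mu> for \<mu> :: "(R3 \<times> R3) measure" +
  fixes A M :: real
  assumes sets_mu [measurable_cong, simp]: "sets \<mu> = sets borel"
    and A_nonneg: "0 \<le> A" and mass_le: "measure \<mu> UNIV \<le> M"
    and marginal_le: "h \<in> borel_measurable borel \<Longrightarrow> (\<integral>\<^sup>+z. h (fst z) \<partial>\<mu>) \<le> ennreal A * (\<integral>\<^sup>+y. h y \<partial>lborel)"
begin

lemma space_mu [simp]: "space \<mu> = UNIV"
  using sets_eq_imp_space_eq[OF sets_mu] by simp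

lemma M_nonneg: "0 \<le> M"
  using mass_le measure_nonneg[of \<mu> UNIV] by linarith

lemma nn_integral_marginal_le:
  assumes [measurable]: "g \<in> borel_measurable borel"
  shows "(\<integral>\<^sup>+z. g (norm (x - fst z)) \<partial>\<mu>) \<le> ennreal A * (\<integral>\<^sup>+y. g (norm (y::R3)) \<partial>lborel)"
proof -
  have "(\<integral>\<^sup>+z. g (norm (x - fst z)) \<partial>\<mu>) \<le> ennreal A * (\<integral>\<^sup>+y. g (norm (x - y)) \<partial>lborel)"
    by (rule marginal_le) measurable
  also have "(\<integral>\<^sup>+y. g (norm (x - y)) \<partial>lborel) = (\<integral>\<^sup>+y. g (norm (y - x)) \<partial>lborel)"
    by (simp add: norm_minus_commute)
  also have "\<dots> = (\<integral>\<^sup>+y. g (norm (y - x)) \<partial>distr lborel borel ((+) x))"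
    by (simp add: lborel_distr_plus)
  also have "\<dots> = (\<integral>\<^sup>+y. g (norm (y::R3)) \<partial>lborel)"
    by (subst nn_integral_distr) auto
  finally show ?thesis .
qed

text \<open>Outside the unit ball the integrand is at most \<open>b\<close> and the mass of \<open>\<mu>\<close> takes over.\<close>

lemma integral_marginal_le:
  assumes [measurable]: "g \<in> borel_measurable borel"
    and g: "\<And>r. r \<ge> 0 \<Longrightarrow> 0 \<le> g r" "\<And>r. r \<ge> 0 \<Longrightarrow> g r \<le> j r + b"
    and [measurable]: "j \<in> borel_measurable borel" and j: "\<And>r. r \<ge> 0 \<Longrightarrow> 0 \<le> j r"
    and J: "(\<integral>\<^sup>+y. ennreal (j (norm (y::R3))) \<partial>lborel) \<le> ennreal J" and "0 \<le> J" "0 \<le> b"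
  shows "integrable \<mu> (\<lambda>z. g (norm (x - fst z)))" "(LINT z|\<mu>. g (norm (x - fst z))) \<le> A * J + b * M"
proof -
  have "(\<integral>\<^sup>+z. ennreal (g (norm (x - fst z))) \<partial>\<mu>) \<le> (\<integral>\<^sup>+z. ennreal (j (norm (x - fst z))) + ennreal b \<partial>\<mu>)"
    using g j \<open>0 \<le> b\<close> by (intro nn_integral_mono) (simp add: ennreal_plus[symmetric] ennreal_leI del: ennreal_plus)
  also have "\<dots> = (\<integral>\<^sup>+z. ennreal (j (norm (x - fst z))) \<partial>\<mu>) + ennreal b * emeasure \<mu> UNIV"
    by (subst nn_integral_add) auto
  also have "\<dots> \<le> ennreal A * ennreal J + ennreal b * ennreal M"
    using mass_le M_nonneg by (intro add_mono mult_left_mono order_trans[OF nn_integral_marginal_le[of "\<lambda>r. ennreal (j r)"]] J)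
      (auto simp: emeasure_eq_measure ennreal_leI)
  also have "\<dots> = ennreal (A * J + b * M)"
    using A_nonneg M_nonneg \<open>0 \<le> J\<close> \<open>0 \<le> b\<close> by (simp add: ennreal_mult[symmetric] ennreal_plus[symmetric] del: ennreal_plus)
  finally have *: "(\<integral>\<^sup>+z. ennreal (g (norm (x - fst z))) \<partial>\<mu>) \<le> ennreal (A * J + b * M)" .
  then show int: "integrable \<mu> (\<lambda>z. g (norm (x - fst z)))"
    using g by (intro integrableI_nonneg) (auto simp: le_less_trans)
  show "(LINT z|\<mu>. g (norm (x - fst z))) \<le> A * J + b * M"
    using * nn_integral_eq_integral[OF int] g A_nonneg M_nonneg \<open>0 \<le> J\<close> \<open>0 \<le> b\<close>
    by (auto simp: ennreal_le_iff simp del: ennreal_plus)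
qed

lemma integrable_inverse_square: "integrable \<mu> (\<lambda>z. 1 / (norm (x - fst z))\<^sup>2)"
  and integral_inverse_square_le: "(LINT z|\<mu>. 1 / (norm (x - fst z))\<^sup>2) \<le> A * (4 * pi) + M"
proof -
  have b: "1 / r\<^sup>2 \<le> indicator {..<1} r / r\<^sup>2 + 1" if "r \<ge> 0" for r :: real
    using that by (auto simp: indicator_def one_le_power)
  show "integrable \<mu> (\<lambda>z. 1 / (norm (x - fst z))\<^sup>2)"
    by (rule integral_marginal_le(1)[OF _ _ b _ _ nn_integral_inverse_square_ball]) auto
  show "(LINT z|\<mu>. 1 / (norm (x - fst z))\<^sup>2) \<le> A * (4 * pi) + M"
    using integral_marginal_le(2)[OF _ _ b _ _ nn_integral_inverse_square_ball] by auto
qed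

lemma integrable_coulomb: "integrable \<mu> (\<lambda>z. coulomb d (x - fst z))"
  by (rule Bochner_Integration.integrable_bound[OF integrable_inverse_square[of x]])
    (auto intro: order_trans[OF norm_coulomb_le])

lemma integral_norm_coulomb_le: "(LINT z|\<mu>. norm (coulomb d (x - fst z))) \<le> A * (4 * pi) + M"
  using integral_mono[OF integrable_norm[OF integrable_coulomb] integrable_inverse_square norm_coulomb_le]
    integral_inverse_square_le by (rule order_trans)

lemma norm_field_le: "norm (field d \<mu> x) \<le> A * (4 * pi) + M"
  unfolding field_def using integral_norm_bound integral_norm_coulomb_le by (rule order_trans)

lemma field_measurable: "(\<lambda>z. field d \<mu> (fst z)) \<in> borel_measurable (borel :: (R3 \<times> R3) measure)"
  unfolding field_def by measurable

lemma norm_field_diff_le: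
  assumes "d > 0"
  shows "norm (field 0 \<mu> x - field d \<mu> x) \<le> 16 * pi * d * A"
proof -
  let ?g = "\<lambda>r. min 1 (3 * d\<^sup>2 / r\<^sup>2) / r\<^sup>2"
  have g: "integrable \<mu> (\<lambda>z. ?g (norm (x - fst z)))" "(LINT z|\<mu>. ?g (norm (x - fst z))) \<le> A * (16 * pi * d) + 0 * M"
    using assms by (auto intro: integral_marginal_le(1)[OF _ _ _ _ _ nn_integral_kernel_error[OF assms], where b = 0])
      (use assms integral_marginal_le(2)[OF _ _ _ _ _ nn_integral_kernel_error[OF assms], of ?g 0 x] in auto)
  have "norm (field 0 \<mu> x - field d \<mu> x) = norm (LINT z|\<mu>. coulomb 0 (x - fst z) - coulomb d (x - fst z))"
    unfolding field_def by (subst Bochner_Integration.integral_diff) (auto intro: integrable_coulomb)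
  also have "\<dots> \<le> (LINT z|\<mu>. ?g (norm (x - fst z)))"
    by (rule order_trans[OF integral_norm_bound integral_mono[OF _ g(1) norm_coulomb_diff_le]])
      (auto intro!: integrable_norm Bochner_Integration.integrable_diff integrable_coulomb)
  finally show ?thesis using g(2) by (simp add: mult_ac)
qed

lemma integrable_coulomb_deriv:
  assumes "d > 0" 
  shows "integrable \<mu> (\<lambda>z. 4 / soft_norm d (x - fst z) ^ 3)"
    "d \<le> 1 \<Longrightarrow> (LINT z|\<mu>. 4 / soft_norm d (x - fst z) ^ 3) \<le> log_bound A M d"
proof -
  let ?g = "\<lambda>r. 1 / sqrt (r\<^sup>2 + d\<^sup>2) ^ 3"
  let ?j = "\<lambda>r. indicator {..<1} r / sqrt (r\<^sup>2 + d\<^sup>2) ^ 3"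
  have s: "soft_norm d (x - fst z) = sqrt ((norm (x - fst z))\<^sup>2 + d\<^sup>2)" for z :: "R3 \<times> R3"
    by (simp add: soft_norm_def)
  show "integrable \<mu> (\<lambda>z. 4 / soft_norm d (x - fst z) ^ 3)"
  proof (rule integrable_const_bound[where B = "4 / d^3"])
    show "AE z in \<mu>. norm (4 / soft_norm d (x - fst z) ^ 3) \<le> 4 / d ^ 3"
      using soft_norm_ge[of d] soft_norm_pos[of d] assms
      by (intro AE_I2) (auto intro!: divide_left_mono power_mono mult_pos_pos simp: less_imp_le)
  qed simp
  assume "d \<le> 1"
  have b: "?g r \<le> ?j r + 1" if "r \<ge> 0" for r
  proof (cases "r < 1")
    case False
    then have "1 \<le> sqrt (r\<^sup>2 + d\<^sup>2)" using one_le_power[of r 2] by (simp add: add_increasing2)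
    then show ?thesis using False by (simp add: one_le_power)
  qed auto
  have "0 \<le> ln (1 / d)" using assms \<open>d \<le> 1\<close> by simp
  then have "(LINT z|\<mu>. ?g (norm (x - fst z))) \<le> A * (4 * pi * (1 + ln (1 / d))) + 1 * M"
    by (intro integral_marginal_le(2)[where j = ?j] b nn_integral_inverse_cube_ball assms \<open>d \<le> 1\<close>) auto
  moreover have "(LINT z|\<mu>. 4 / soft_norm d (x - fst z) ^ 3) = 4 * (LINT z|\<mu>. ?g (norm (x - fst z)))"
    unfolding s by (subst integral_mult_right_zero[symmetric]) (simp add: mult.commute)
  ultimately show "(LINT z|\<mu>. 4 / soft_norm d (x - fst z) ^ 3) \<le> log_bound A M d"
    by (simp add: log_bound_def)
qed

end

section \<open>Differentiation of the potential\<close>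

text \<open>Measurability of the directional derivative in \<open>z\<close> comes from the
  difference quotients with step \<open>1 / Suc n\<close>, of which it is the pointwise limit;
  \<open>W\<close> then dominates it.\<close>

lemma integrable_has_derivative:
  fixes \<kappa> :: "'z \<Rightarrow> 'a::euclidean_space \<Rightarrow> 'b::euclidean_space"
  assumes der: "\<And>z y. (\<kappa> z has_derivative \<kappa>' z y) (at y)"
    and W: "integrable M W" and bnd: "\<And>z y u. norm (\<kappa>' z y u) \<le> W z * norm u"
    and int: "\<And>y. integrable M (\<lambda>z. \<kappa> z y)"
  shows "integrable M (\<lambda>z. \<kappa>' z y u)"
proof (rule Bochner_Integration.integrable_bound)
  show "integrable M (\<lambda>z. W z * norm u)" using W by simp
  have lim: "(\<lambda>n. real (Suc n) *\<^sub>R (\<kappa> z (y + (1 / real (Suc n)) *\<^sub>R u) - \<kappa> z y)) \<longlonglongrightarrow> \<kappa>' z y u" for z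
  proof -
    have "((\<lambda>t. \<kappa> z (y + t *\<^sub>R u)) has_derivative (\<lambda>t. \<kappa>' z y (t *\<^sub>R u))) (at 0)"
      by (rule has_derivative_compose[of "\<lambda>t. y + t *\<^sub>R u", where g = "\<kappa> z"]) (auto intro!: derivative_eq_intros der)
    then have "((\<lambda>t. norm (\<kappa> z (y + t *\<^sub>R u) - \<kappa> z y - t *\<^sub>R \<kappa>' z y u) / norm t) \<longlongrightarrow> 0) (at 0)"
      using linear_scale[OF has_derivative_linear[OF der]] by (simp add: has_derivative_at)
    moreover have "\<forall>\<^sub>F t in at 0. norm (\<kappa> z (y + t *\<^sub>R u) - \<kappa> z y - t *\<^sub>R \<kappa>' z y u) / norm t
        = norm ((\<kappa> z (y + t *\<^sub>R u) - \<kappa> z y) /\<^sub>R t - \<kappa>' z y u)"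
    proof (rule eventually_at_filter[THEN iffD2, OF always_eventually], safe)
      fix t :: real assume "t \<noteq> 0"
      then have "(\<kappa> z (y + t *\<^sub>R u) - \<kappa> z y) /\<^sub>R t - \<kappa>' z y u = (\<kappa> z (y + t *\<^sub>R u) - \<kappa> z y - t *\<^sub>R \<kappa>' z y u) /\<^sub>R t"
        by (simp add: scaleR_diff_right)
      then show "norm (\<kappa> z (y + t *\<^sub>R u) - \<kappa> z y - t *\<^sub>R \<kappa>' z y u) / norm t
        = norm ((\<kappa> z (y + t *\<^sub>R u) - \<kappa> z y) /\<^sub>R t - \<kappa>' z y u)"
        by (simp add: divide_inverse mult.commute)
    qed
    ultimately have "((\<lambda>t. norm ((\<kappa> z (y + t *\<^sub>R u) - \<kappa> z y) /\<^sub>R t - \<kappa>' z y u)) \<longlongrightarrow> 0) (at 0)"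
      by (rule Lim_transform_eventually)
    then have "((\<lambda>t. (\<kappa> z (y + t *\<^sub>R u) - \<kappa> z y) /\<^sub>R t) \<longlongrightarrow> \<kappa>' z y u) (at 0)"
      by (rule LIM_zero_cancel[OF tendsto_norm_zero_cancel])
    moreover have "filterlim (\<lambda>n. 1 / real (Suc n)) (at 0) sequentially"
      by (auto simp: filterlim_at simp del: of_nat_Suc intro!: LIMSEQ_Suc[OF lim_1_over_n])
    ultimately show ?thesis
      using filterlim_compose by (fastforce simp: divide_inverse)
  qed
  then show "(\<lambda>z. \<kappa>' z y u) \<in> borel_measurable M"
    by (rule borel_measurable_LIMSEQ_metric[rotated]) (use int in measurable)
  show "AE z in M. norm (\<kappa>' z y u) \<le> norm (W z * norm u)"
    using bnd by (intro AE_I2) (simp add: order_trans[OF bnd abs_ge_self])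
qed

text \<open>Dominated convergence for the remainder quotients. The mean value inequality bounds the
  increment by \<open>W z * norm h\<close>, and the linear part satisfies the same bound, hence the
  majorant \<open>2 * W z\<close>.\<close>

lemma has_derivative_integral:
  fixes \<kappa> :: "'z \<Rightarrow> 'a::euclidean_space \<Rightarrow> 'b::euclidean_space"
  assumes der: "\<And>z y. (\<kappa> z has_derivative \<kappa>' z y) (at y)"
    and W: "integrable M W" and bnd: "\<And>z y u. norm (\<kappa>' z y u) \<le> W z * norm u"
    and int: "\<And>y. integrable M (\<lambda>z. \<kappa> z y)"
  shows "((\<lambda>y. LINT z|M. \<kappa> z y) has_derivative (\<lambda>u. LINT z|M. \<kappa>' z y u)) (at y)"
proof -
  note int' = integrable_has_derivative[OF assms]
  have lin: "linear (\<kappa>' z y)" for z y using has_derivative_linear[OF der] .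
  have "bounded_linear (\<lambda>u. LINT z|M. \<kappa>' z y u)"
  proof (rule bounded_linear_intro[where K = "LINT z|M. W z"])
    show "(LINT z|M. \<kappa>' z y (u + v)) = (LINT z|M. \<kappa>' z y u) + (LINT z|M. \<kappa>' z y v)" for u v
      by (simp add: linear_add[OF lin] int')
    show "(LINT z|M. \<kappa>' z y (r *\<^sub>R u)) = r *\<^sub>R (LINT z|M. \<kappa>' z y u)" for r u
      by (simp add: linear_scale[OF lin])
    show "norm (LINT z|M. \<kappa>' z y u) \<le> norm u * (LINT z|M. W z)" for u
      using integral_mono[OF integrable_norm[OF int'] integrable_mult_left[OF W] bnd, of y u]
      by (intro order_trans[OF integral_norm_bound]) (simp add: mult.commute)
  qed
  moreover have "((\<lambda>h. norm ((LINT z|M. \<kappa> z (y + h)) - (LINT z|M. \<kappa> z y) - (LINT z|M. \<kappa>' z y h)) / norm h) \<longlongrightarrow> 0) (at 0)"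
    unfolding tendsto_at_iff_sequentially
  proof (intro allI impI, unfold o_def)
    fix X :: "nat \<Rightarrow> 'a" assume X: "\<forall>i. X i \<in> UNIV - {0}" "X \<longlonglongrightarrow> 0"
    let ?R = "\<lambda>n z. norm (\<kappa> z (y + X n) - \<kappa> z y - \<kappa>' z y (X n)) / norm (X n)"
    have R_int: "integrable M (?R n)" for n
      by (intro integrable_divide integrable_norm Bochner_Integration.integrable_diff int int')
    have "(\<lambda>n. LINT z|M. ?R n z) \<longlonglongrightarrow> (LINT z|M. 0)"
    proof (rule integral_dominated_convergence[where w = "\<lambda>z. 2 * W z"])
      show "integrable M (\<lambda>z. 2 * W z)" using W by simp
      show "?R n \<in> borel_measurable M" for n using R_int by blast
      show "AE z in M. (\<lambda>n. ?R n z) \<longlonglongrightarrow> 0"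
      proof (intro AE_I2)
        fix z
        have "((\<lambda>h. norm (\<kappa> z (y + h) - \<kappa> z y - \<kappa>' z y h) / norm h) \<longlongrightarrow> 0) (at 0)"
          using der[of z y] by (simp add: has_derivative_at)
        then show "(\<lambda>n. ?R n z) \<longlonglongrightarrow> 0"
          using X unfolding tendsto_at_iff_sequentially by (auto simp: o_def)
      qed
      show "AE z in M. norm (?R n z) \<le> 2 * W z" for n
      proof (intro AE_I2)
        fix z
        have "norm (\<kappa> z (y + X n) - \<kappa> z y) \<le> W z * norm (y + X n - y)"
        proof (rule differentiable_bound[where S = UNIV and f' = "\<kappa>' z"])
          show "onorm (\<kappa>' z x) \<le> W z" for x
            by (rule onorm_le) (use bnd in auto)
        qed (auto intro: der)
        then have "norm (\<kappa> z (y + X n) - \<kappa> z y - \<kappa>' z y (X n)) \<le> 2 * W z * norm (X n)"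
          using bnd[of z y "X n"] norm_triangle_ineq4[of "\<kappa> z (y + X n) - \<kappa> z y" "\<kappa>' z y (X n)"] by simp
        then show "norm (?R n z) \<le> 2 * W z"
          using X by (simp add: pos_divide_le_eq)
      qed
    qed simp
    then have lim: "(\<lambda>n. LINT z|M. ?R n z) \<longlonglongrightarrow> 0" by simp
    show "(\<lambda>n. norm ((LINT z|M. \<kappa> z (y + X n)) - (LINT z|M. \<kappa> z y) - (LINT z|M. \<kappa>' z y (X n))) / norm (X n)) \<longlonglongrightarrow> 0"
    proof (rule Lim_null_comparison[OF always_eventually lim], rule allI)
      fix n
      have "(LINT z|M. \<kappa> z (y + X n)) - (LINT z|M. \<kappa> z y) - (LINT z|M. \<kappa>' z y (X n))
        = (LINT z|M. \<kappa> z (y + X n) - \<kappa> z y - \<kappa>' z y (X n))"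
        by (simp add: int int')
      then have "norm ((LINT z|M. \<kappa> z (y + X n)) - (LINT z|M. \<kappa> z y) - (LINT z|M. \<kappa>' z y (X n)))
        \<le> (LINT z|M. norm (\<kappa> z (y + X n) - \<kappa> z y - \<kappa>' z y (X n)))"
        by simp
      then show "norm (norm ((LINT z|M. \<kappa> z (y + X n)) - (LINT z|M. \<kappa> z y) - (LINT z|M. \<kappa>' z y (X n))) / norm (X n))
        \<le> (LINT z|M. ?R n z)"
        by (simp add: divide_right_mono)
    qed
  qed
  ultimately show ?thesis by (simp add: has_derivative_at)
qed

lemma continuous_on_integral:
  fixes \<kappa> :: "'z \<Rightarrow> 'a::metric_space \<Rightarrow> 'b::{banach, second_countable_topology}"
  assumes cont: "\<And>z. continuous_on UNIV (\<kappa> z)"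
    and W: "integrable M W" and bnd: "\<And>z y. norm (\<kappa> z y) \<le> W z"
    and meas: "\<And>y. (\<lambda>z. \<kappa> z y) \<in> borel_measurable M"
  shows "continuous_on UNIV (\<lambda>y. LINT z|M. \<kappa> z y)"
  unfolding continuous_on_sequentially
proof (intro allI ballI impI, unfold o_def, elim conjE)
  fix x :: "nat \<Rightarrow> 'a" and a assume x: "x \<longlonglongrightarrow> a"
  show "(\<lambda>n. LINT z|M. \<kappa> z (x n)) \<longlonglongrightarrow> (LINT z|M. \<kappa> z a)"
  proof (rule integral_dominated_convergence[where w = W])
    show "AE z in M. (\<lambda>n. \<kappa> z (x n)) \<longlonglongrightarrow> \<kappa> z a"
      by (intro AE_I2 continuous_on_tendsto_compose[OF cont x]) auto
  qed (use meas W bnd in auto)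
qed

context bounded_marginal
begin

text \<open>Points are Lebesgue null, and the marginal is dominated by a multiple of Lebesgue
  measure. At such a point the softened kernels \<open>1 / soft_norm d\<close> blow up as
  \<open>d\<close> tends to 0, while \<open>1 / norm\<close> takes the value 0.\<close>

lemma AE_fst_neq: "AE z in \<mu>. fst z \<noteq> x"
proof -
  have "emeasure \<mu> {z. fst z = x} = (\<integral>\<^sup>+z. indicator {x} (fst z) \<partial>\<mu>)"
  proof -
    have [measurable]: "{z. fst z = x} \<in> sets \<mu>"
      by (auto intro!: borel_closed closed_Collect_eq continuous_intros)
    have "(\<integral>\<^sup>+z. indicator {x} (fst z) \<partial>\<mu>) = (\<integral>\<^sup>+z. indicator {z. fst z = x} z \<partial>\<mu>)"
      by (auto intro!: nn_integral_cong simp: indicator_def)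
    then show ?thesis by simp
  qed
  also have "\<dots> \<le> ennreal A * (\<integral>\<^sup>+y. indicator {x} y \<partial>lborel)"
    by (rule marginal_le) auto
  finally have "emeasure \<mu> {z. fst z = x} = 0" by simp
  then show ?thesis
    by (auto simp: AE_iff_measurable[OF _ refl])
qed

lemma has_derivative_soft_potential:
  assumes "d > 0"
  shows "((\<lambda>x. LINT z|\<mu>. 1 / soft_norm d (x - fst z)) has_derivative (\<lambda>v. - (field d \<mu> x \<bullet> v))) (at x)"
proof -
  have "((\<lambda>x. LINT z|\<mu>. 1 / soft_norm d (x - fst z)) has_derivative (\<lambda>v. LINT z|\<mu>. - (coulomb d (x - fst z) \<bullet> v))) (at x)"
  proof (rule has_derivative_integral[where W = "\<lambda>_. 1 / d\<^sup>2"])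
    show "((\<lambda>x. 1 / soft_norm d (x - fst z)) has_derivative (\<lambda>v. - (coulomb d (x - fst z) \<bullet> v))) (at x)" for z :: "R3 \<times> R3" and x
      by (rule has_derivative_compose[of "\<lambda>x. x - fst z" _ _ _ "\<lambda>x. 1 / soft_norm d x", OF _ has_derivative_inverse_soft_norm[OF assms]])
        (auto intro!: derivative_eq_intros)
    show "norm (- (coulomb d (x - fst z) \<bullet> v)) \<le> 1 / d\<^sup>2 * norm v" for z :: "R3 \<times> R3" and x v
      using Cauchy_Schwarz_ineq2[of "coulomb d (x - fst z)" v] mult_right_mono[OF norm_coulomb_le_const[OF assms, of "x - fst z"], of "norm v"]
      by simp
    show "integrable \<mu> (\<lambda>z. 1 / soft_norm d (x - fst z))" for x
    proof (rule integrable_const_bound[where B = "1 / d"])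
      show "AE z in \<mu>. norm (1 / soft_norm d (x - fst z)) \<le> 1 / d"
        using assms soft_norm_ge[of d] soft_norm_pos[OF assms] by (auto intro!: AE_I2 divide_left_mono simp: less_imp_le)
    qed measurable
  qed simp
  then show ?thesis
    by (simp add: field_def integrable_coulomb inner_commute[of _ "_ :: R3"] flip: integral_inner_right)
qed

text \<open>The singular kernel cannot be differentiated under the integral. The softened potentials
  can; they converge pointwise, and by \<open>norm_field_diff_le\<close> their gradients converge
  uniformly in \<open>x\<close>, so the limit may be differentiated.\<close>

lemma grad_potential: "grad (potential \<epsilon> \<mu>) x = (\<epsilon> / (4 * pi)) *\<^sub>R field 0 \<mu> x"
proof -
  define d where "d n = 1 / real (Suc n)" for n
  have d: "d n > 0" for n by (simp add: d_def)
  have d_lim: "d \<longlonglongrightarrow> 0" unfolding d_def by (rule LIMSEQ_Suc[OF lim_1_over_n])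
  define V where "V n x = (LINT z|\<mu>. 1 / soft_norm (d n) (x - fst z))" for n x
  define V0 where "V0 x = (LINT z|\<mu>. 1 / norm (x - fst z))" for x
  have V_lim: "(\<lambda>n. V n x) \<longlonglongrightarrow> V0 x" for x
    unfolding V_def V0_def
  proof (rule integral_dominated_convergence[where w = "\<lambda>z. 1 + 1 / (norm (x - fst z))\<^sup>2"])
    show "integrable \<mu> (\<lambda>z. 1 + 1 / (norm (x - fst z))\<^sup>2)"
      using integrable_inverse_square by simp
    show "AE z in \<mu>. (\<lambda>n. 1 / soft_norm (d n) (x - fst z)) \<longlonglongrightarrow> 1 / norm (x - fst z)"
      using AE_fst_neq[of x]
    proof eventually_elim
      fix z :: "R3 \<times> R3" assume "fst z \<noteq> x"
      then have "(\<lambda>n. 1 / soft_norm (d n) (x - fst z)) \<longlonglongrightarrow> 1 / sqrt ((norm (x - fst z))\<^sup>2 + 0\<^sup>2)"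
        unfolding soft_norm_def by (intro tendsto_intros d_lim) auto
      then show "(\<lambda>n. 1 / soft_norm (d n) (x - fst z)) \<longlonglongrightarrow> 1 / norm (x - fst z)" by simp
    qed
    show "AE z in \<mu>. norm (1 / soft_norm (d n) (x - fst z)) \<le> 1 + 1 / (norm (x - fst z))\<^sup>2" for n
      using AE_fst_neq[of x]
    proof eventually_elim
      fix z :: "R3 \<times> R3" assume z: "fst z \<noteq> x"
      define r where "r = norm (x - fst z)"
      have r: "r > 0" using z by (simp add: r_def)
      have "1 / soft_norm (d n) (x - fst z) \<le> 1 / r"
        using r soft_norm_ge_norm[of "x - fst z" "d n"] soft_norm_pos[OF d[of n], of "x - fst z"] unfolding r_def by (intro divide_left_mono) auto
      also have "1 / r \<le> 1 + 1 / r\<^sup>2"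
      proof (cases "r \<ge> 1")
        case True
        then have "1 / r \<le> 1" by simp
        then show ?thesis by (simp add: add_increasing2)
      next
        case False
        then have "r\<^sup>2 \<le> r" using r by (simp add: power2_eq_square)
        then have "1 / r \<le> 1 / r\<^sup>2" using r by (intro divide_left_mono) auto
        then show ?thesis by simp
      qed
      finally show "norm (1 / soft_norm (d n) (x - fst z)) \<le> 1 + 1 / (norm (x - fst z))\<^sup>2"
        using soft_norm_pos[OF d, of n "x - fst z"] by (simp add: r_def)
    qed
  qed auto
  have "\<exists>g. \<forall>x\<in>UNIV. (\<lambda>n. V n x) \<longlonglongrightarrow> g x \<and> (g has_derivative (\<lambda>v. - (field 0 \<mu> x \<bullet> v))) (at x within UNIV)"
  proof (rule has_derivative_sequence[where f' = "\<lambda>n x v. - (field (d n) \<mu> x \<bullet> v)"])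
    show "(V n has_derivative (\<lambda>v. - (field (d n) \<mu> x \<bullet> v))) (at x within UNIV)" for n x
      unfolding V_def using has_derivative_soft_potential[OF d] by simp
    fix e :: real assume "e > 0"
    have "(\<lambda>n. 16 * pi * d n * A) \<longlonglongrightarrow> 16 * pi * 0 * A"
      by (intro tendsto_intros d_lim)
    then have "\<forall>\<^sub>F n in sequentially. 16 * pi * d n * A < e"
      by (rule order_tendstoD) (simp add: \<open>e > 0\<close>)
    then show "\<forall>\<^sub>F n in sequentially. \<forall>x\<in>UNIV. \<forall>v. norm (- (field (d n) \<mu> x \<bullet> v) - - (field 0 \<mu> x \<bullet> v)) \<le> e * norm v"
    proof eventually_elim
      case (elim n)
      have "norm (- (field (d n) \<mu> x \<bullet> v) - - (field 0 \<mu> x \<bullet> v)) = \<bar>(field 0 \<mu> x - field (d n) \<mu> x) \<bullet> v\<bar>" for x v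
        by (simp add: inner_diff_left)
      moreover have "\<bar>(field 0 \<mu> x - field (d n) \<mu> x) \<bullet> v\<bar> \<le> e * norm v" for x v
        by (rule order_trans[OF Cauchy_Schwarz_ineq2])
          (use norm_field_diff_le[OF d, of x n] elim in \<open>auto intro!: mult_right_mono\<close>)
      ultimately show ?case by simp
    qed
  qed (use V_lim in auto)
  then obtain g where g: "\<And>x. (\<lambda>n. V n x) \<longlonglongrightarrow> g x" "\<And>x. (g has_derivative (\<lambda>v. - (field 0 \<mu> x \<bullet> v))) (at x)"
    by auto
  have "g = V0" using LIMSEQ_unique[OF g(1) V_lim] by auto
  moreover have "potential \<epsilon> \<mu> = (\<lambda>x. - (\<epsilon> / (4 * pi)) * V0 x)"
    unfolding potential_def spatial_marginal_def V0_def
    by (subst integral_distr) (simp_all flip: integral_mult_right_zero add: field_simps)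
  ultimately have "(potential \<epsilon> \<mu> has_derivative (\<lambda>v. - (\<epsilon> / (4 * pi)) * - (field 0 \<mu> x \<bullet> v))) (at x)"
    using g(2) by (auto intro!: derivative_eq_intros)
  then show ?thesis
    by (intro grad_eqI) (simp add: gderiv_def inner_commute)
qed

end

section \<open>Mollification\<close>

text \<open>Induction on \<open>k\<close> over all members of the class at once. Smoothness thus
  needs only a class that contains its own directional derivatives, and no formula for derivatives
  of higher order.\<close>

lemma smooth_coinduct:
  assumes "P f"
    and diff: "\<And>f z. P f \<Longrightarrow> f differentiable (at z)"
    and deriv: "\<And>f v. P f \<Longrightarrow> P (\<lambda>z. frechet_derivative f (at z) v)"
  shows "smooth f"
proof -
  have "\<forall>f. P f \<longrightarrow> Ck k f" for k
  proof (induction k)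
    case 0
    show ?case
      using diff by (auto intro!: differentiable_imp_continuous_on simp: differentiable_on_def)
  qed (use diff deriv in auto)
  then show ?thesis using assms(1) by (auto simp: smooth_def)
qed

text \<open>All derivatives of the flat function \<open>exp (- 1 / t)\<close>, extended by 0, have
  this form. Keeping the polynomial as a parameter makes the family closed under
  differentiation.\<close>

definition flat_exp :: "real poly \<Rightarrow> real \<Rightarrow> real" where
  "flat_exp p t = (if t > 0 then poly p (1 / t) * exp (- 1 / t) else 0)"

text \<open>In the variable \<open>u = 1 / t\<close> the derivative in \<open>t\<close> is
  \<open>- u^2\<close> times the derivative in \<open>u\<close>, which turns
  \<open>p(u) * exp (- u)\<close> into \<open>u^2 * (p(u) - p'(u)) * exp (- u)\<close>.\<close>

definition flat_exp_pderiv :: "real poly \<Rightarrow> real poly" where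
  "flat_exp_pderiv p = monom 1 2 * (p - pderiv p)"

lemma flat_exp_tendsto_0: "((\<lambda>t. poly p (1 / t) * exp (- 1 / t)) \<longlongrightarrow> 0) (at_right (0::real))"
proof -
  have "((\<lambda>u. \<Sum>i\<le>degree p. coeff p i * (u ^ i / exp u)) \<longlongrightarrow> (\<Sum>i\<le>degree p. coeff p i * 0)) at_top"
    by (intro tendsto_intros tendsto_power_div_exp_0)
  then have "((\<lambda>u. poly p u * exp (- u)) \<longlongrightarrow> 0) at_top"
    by (simp add: poly_altdef sum_distrib_right exp_minus divide_inverse mult.assoc)
  from filterlim_compose[OF this filterlim_inverse_at_top_right] show ?thesis
    by (simp add: divide_inverse)
qed

lemma DERIV_flat_exp: "DERIV (flat_exp p) t :> flat_exp (flat_exp_pderiv p) t"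
proof -
  consider "t > 0" | "t < 0" | "t = 0" by linarith
  then show ?thesis
  proof cases
    case 1
    have "DERIV (\<lambda>t. poly p (1 / t) * exp (- 1 / t)) t :> flat_exp (flat_exp_pderiv p) t"
      using 1 by (auto intro!: derivative_eq_intros DERIV_chain'[OF _ poly_DERIV]
          simp: flat_exp_def flat_exp_pderiv_def poly_monom power2_eq_square algebra_simps divide_simps)
    moreover have "\<forall>\<^sub>F x in nhds t. flat_exp p x = poly p (1 / x) * exp (- 1 / x)"
      using eventually_nhds_in_open[of "{0<..}" t] 1 by (auto elim!: eventually_mono simp: flat_exp_def)
    ultimately show ?thesis by (subst DERIV_cong_ev[OF refl _ refl])
  next
    case 2
    have "DERIV (\<lambda>_. 0) t :> flat_exp (flat_exp_pderiv p) t"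
      using 2 by (auto simp: flat_exp_def)
    moreover have "\<forall>\<^sub>F x in nhds t. flat_exp p x = 0"
      using eventually_nhds_in_open[of "{..<0}" t] 2 by (auto elim!: eventually_mono simp: flat_exp_def)
    ultimately show ?thesis by (subst DERIV_cong_ev[OF refl _ refl])
  next
    case 3
    have "((\<lambda>h. flat_exp p h / h) \<longlongrightarrow> 0) (at 0)"
    proof (rule filterlim_split_at)
      show "((\<lambda>h. flat_exp p h / h) \<longlongrightarrow> 0) (at_left 0)"
        by (rule tendsto_eventually) (auto simp: eventually_at_filter flat_exp_def)
      \<comment> \<open>Dividing by \<open>h\<close> multiplies the polynomial by its variable, so
        the difference quotient at 0 is a function of the same family.\<close>
      have "\<forall>\<^sub>F h in at_right 0. poly (monom 1 1 * p) (1 / h) * exp (- 1 / h) = flat_exp p h / h"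
        by (auto simp: eventually_at_filter flat_exp_def poly_monom)
      then show "((\<lambda>h. flat_exp p h / h) \<longlongrightarrow> 0) (at_right 0)"
        by (rule Lim_transform_eventually[OF flat_exp_tendsto_0])
    qed
    then show ?thesis using 3 by (simp add: DERIV_def flat_exp_def)
  qed
qed

text \<open>The smallest class of functions that contains the radial bump of radius \<open>1 / sqrt N\<close> and is closed
  under partial derivatives.\<close>

inductive bump_class :: "real \<Rightarrow> ('a::euclidean_space \<Rightarrow> real) \<Rightarrow> bool" for N where
  base: "bump_class N (\<lambda>z. flat_exp p (1 - N * (z \<bullet> z)))"
| mult: "bump_class N f \<Longrightarrow> bump_class N (\<lambda>z. f z * (z \<bullet> v))"
| add: "bump_class N f \<Longrightarrow> bump_class N g \<Longrightarrow> bump_class N (\<lambda>z. f z + g z)"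
| scale: "bump_class N f \<Longrightarrow> bump_class N (\<lambda>z. c * f z)"

lemma bump_class_has_derivative:
  assumes "bump_class N f"
  obtains f' where "\<And>z. (f has_derivative f' z) (at z)" "\<And>v. bump_class N (\<lambda>z. f' z v)"
proof -
  from assms have "\<exists>f'. (\<forall>z. (f has_derivative f' z) (at z)) \<and> (\<forall>v. bump_class N (\<lambda>z. f' z v))"
  proof induction
    case (base p)
    let ?f' = "\<lambda>z v. (- 2 * N) * (flat_exp (flat_exp_pderiv p) (1 - N * (z \<bullet> z)) * (z \<bullet> v))"
    have "((\<lambda>z. flat_exp p (1 - N * (z \<bullet> z))) has_derivative ?f' z) (at z)" for z :: 'a
    proof -
      have "((\<lambda>z. 1 - N * (z \<bullet> z)) has_derivative (\<lambda>v. - (N * (2 * (z \<bullet> v))))) (at z)"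
        by (auto intro!: derivative_eq_intros simp: inner_commute)
      from has_derivative_compose[OF this DERIV_flat_exp[of p, unfolded has_field_derivative_def]]
      show ?thesis by (simp add: mult_ac)
    qed
    moreover have "bump_class N (\<lambda>z. ?f' z v)" for v :: 'a
      by (intro bump_class.intros)
    ultimately show ?case by (intro exI[of _ ?f']) auto
  next
    case (mult f v)
    then obtain f' where f': "\<And>z. (f has_derivative f' z) (at z)" "\<And>v. bump_class N (\<lambda>z. f' z v)" by auto
    have "((\<lambda>z. f z * (z \<bullet> v)) has_derivative (\<lambda>u. f' z u * (z \<bullet> v) + (u \<bullet> v) * f z)) (at z)" for z
      by (auto intro!: derivative_eq_intros f')
    moreover have "bump_class N (\<lambda>z. f' z u * (z \<bullet> v) + (u \<bullet> v) * f z)" for u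
      by (intro bump_class.intros f' mult.hyps)
    ultimately show ?case by (intro exI[of _ "\<lambda>z u. f' z u * (z \<bullet> v) + (u \<bullet> v) * f z"]) auto
  next
    case (add f g)
    then obtain f' g' where "\<And>z. (f has_derivative f' z) (at z)" "\<And>v. bump_class N (\<lambda>z. f' z v)"
      "\<And>z. (g has_derivative g' z) (at z)" "\<And>v. bump_class N (\<lambda>z. g' z v)" by auto
    then show ?case
      by (intro exI[of _ "\<lambda>z u. f' z u + g' z u"]) (auto intro!: derivative_eq_intros bump_class.intros)
  next
    case (scale f c)
    then obtain f' where "\<And>z. (f has_derivative f' z) (at z)" "\<And>v. bump_class N (\<lambda>z. f' z v)" by auto
    then show ?case
      by (intro exI[of _ "\<lambda>z u. c * f' z u"]) (auto intro!: derivative_eq_intros bump_class.intros)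
  qed
  then show ?thesis using that by auto
qed

lemma bump_class_eq_0: "bump_class N f \<Longrightarrow> 1 \<le> N * (z \<bullet> z) \<Longrightarrow> f z = 0"
  by (induction rule: bump_class.induct) (auto simp: flat_exp_def)

lemma bump_class_continuous: "bump_class N f \<Longrightarrow> continuous_on S f"
  by (meson bump_class_has_derivative has_derivative_continuous_on has_derivative_at_withinI)

definition compactly_supported :: "('a::real_normed_vector \<Rightarrow> 'b::real_normed_vector) \<Rightarrow> bool" where
  "compactly_supported f \<longleftrightarrow> continuous_on UNIV f \<and> (\<exists>R. \<forall>z. R < norm z \<longrightarrow> f z = 0)"

lemma compactly_supported_bounded:
  fixes f :: "'a::euclidean_space \<Rightarrow> 'b::real_normed_vector"
  assumes "compactly_supported f"
  obtains B where "B > 0" "\<And>z. norm (f z) \<le> B"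
proof -
  from assms obtain R where R: "\<And>z. R < norm z \<Longrightarrow> f z = 0" and cont: "continuous_on UNIV f"
    by (auto simp: compactly_supported_def)
  have "compact (f ` cball 0 R)"
    by (intro compact_continuous_image continuous_on_subset[OF cont]) auto
  then obtain B where B: "B > 0" "\<forall>y\<in>f ` cball 0 R. norm y \<le> B"
    using compact_imp_bounded bounded_pos by blast
  have "norm (f z) \<le> B" for z
    using B R[of z] by (cases "R < norm z") auto
  with B show ?thesis using that by blast
qed

lemma compactly_supported_integrable:
  fixes f :: "'a::euclidean_space \<Rightarrow> 'b::euclidean_space"
  assumes "compactly_supported f"
  shows "integrable lborel f"
proof -
  from assms obtain R where R: "\<And>z. R < norm z \<Longrightarrow> f z = 0" and cont: "continuous_on UNIV f"
    by (auto simp: compactly_supported_def)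
  have "integrable lborel (\<lambda>x. indicator (cball 0 R) x *\<^sub>R f x)"
    by (intro borel_integrable_compact continuous_on_subset[OF cont]) auto
  also have "(\<lambda>x. indicator (cball 0 R) x *\<^sub>R f x) = f"
    using R by (fastforce simp: indicator_def)
  finally show ?thesis .
qed

lemma compactly_supported_C0:
  fixes f :: "'a::euclidean_space \<Rightarrow> real"
  assumes "compactly_supported f"
  shows "f \<in> C0_functions"
proof -
  from assms obtain R where R: "\<And>z. R < norm z \<Longrightarrow> f z = 0" and cont: "continuous_on UNIV f"
    by (auto simp: compactly_supported_def)
  have "(f \<longlongrightarrow> 0) at_infinity"
    by (rule tendsto_eventually) (use R in \<open>auto simp: eventually_at_infinity intro!: exI[of _ "R + 1"]\<close>)
  with cont show ?thesis by (simp add: C0_functions_def)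
qed

lemma bump_class_compactly_supported:
  assumes "bump_class N f" "N > 0"
  shows "compactly_supported f"
  unfolding compactly_supported_def
proof (intro conjI exI allI impI)
  fix z :: 'a assume "sqrt (1 / N) < norm z"
  then have "1 / N \<le> z \<bullet> z"
    using assms(2) by (metis less_imp_le norm_eq_sqrt_inner real_sqrt_le_iff)
  then show "f z = 0" using assms by (intro bump_class_eq_0[OF assms(1)]) (simp add: field_simps)
qed (rule bump_class_continuous[OF assms(1)])

lemma linear_expand_Basis:
  fixes f :: "'a::euclidean_space \<Rightarrow> real"
  assumes "linear f"
  shows "f v = (\<Sum>b\<in>Basis. (v \<bullet> b) * f b)"
proof -
  have "f v = f (\<Sum>b\<in>Basis. (v \<bullet> b) *\<^sub>R b)" by (simp add: euclidean_representation)
  then show ?thesis by (simp add: linear_sum[OF assms] linear_scale[OF assms])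
qed

lemma linear_bound_Basis:
  fixes f :: "'a::euclidean_space \<Rightarrow> real"
  assumes "linear f" "\<And>b. b \<in> Basis \<Longrightarrow> \<bar>f b\<bar> \<le> B b"
  shows "\<bar>f v\<bar> \<le> (\<Sum>b\<in>Basis. B b) * norm v"
proof -
  have "f v = (\<Sum>b\<in>Basis. (v \<bullet> b) * f b)" by (rule linear_expand_Basis[OF assms(1)])
  also have "\<bar>\<dots>\<bar> \<le> (\<Sum>b\<in>Basis. norm v * B b)"
    by (intro order_trans[OF sum_abs] sum_mono) (auto simp: abs_mult Basis_le_norm intro!: mult_mono assms)
  finally show ?thesis by (simp add: sum_distrib_left mult.commute)
qed

lemma linear_family_bounded:
  fixes D :: "'z \<Rightarrow> 'a::euclidean_space \<Rightarrow> real"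
  assumes "\<And>z. linear (D z)" "\<And>b. b \<in> Basis \<Longrightarrow> \<exists>B. \<forall>z. \<bar>D z b\<bar> \<le> B"
  obtains B where "B > 0" "\<And>z v. \<bar>D z v\<bar> \<le> B * norm v"
proof -
  from assms(2) obtain B where B: "\<And>b z. b \<in> Basis \<Longrightarrow> \<bar>D z b\<bar> \<le> B b" by metis
  have "\<bar>D z v\<bar> \<le> (\<bar>\<Sum>b\<in>Basis. B b\<bar> + 1) * norm v" for z v
    by (rule order_trans[OF linear_bound_Basis[OF assms(1) B]]) (auto intro!: mult_right_mono)
  then show ?thesis by (intro that) (auto intro: add_nonneg_pos)
qed

text \<open>Derivatives fall on the bump, and \<open>bump_class\<close> contains the derivatives of
  its members. The convolutions of \<open>\<Phi>\<close> with the whole class therefore form a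
  family for \<open>smooth_coinduct\<close>.\<close>

lemma smooth_bump_convolution:
  fixes \<beta> :: "'a::euclidean_space \<Rightarrow> real"
  assumes "bump_class N \<beta>" "N > 0" and \<Phi>: "compactly_supported \<Phi>"
  shows "smooth (\<lambda>z. c * (LINT w|lborel. \<Phi> w * \<beta> (z - w)))"
proof -
  define H where "H \<beta> z = c * (LINT w|lborel. \<Phi> w * \<beta> (z - w))" for \<beta> and z :: 'a
  have *: "\<exists>\<beta>'. (\<forall>z. (H \<beta> has_derivative (\<lambda>v. H (\<lambda>z. \<beta>' z v) z)) (at z)) \<and> (\<forall>v. bump_class N (\<lambda>z. \<beta>' z v))"
    if \<beta>: "bump_class N \<beta>" for \<beta>
  proof -
    from \<beta> obtain \<beta>' where \<beta>': "\<And>z. (\<beta> has_derivative \<beta>' z) (at z)" "\<And>v. bump_class N (\<lambda>z. \<beta>' z v)"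
      using bump_class_has_derivative by blast
    obtain B where B: "B > 0" "\<And>z v. \<bar>\<beta>' z v\<bar> \<le> B * norm v"
    proof (rule linear_family_bounded[of \<beta>'])
      show "\<exists>B. \<forall>z. \<bar>\<beta>' z b\<bar> \<le> B" for b
        using compactly_supported_bounded[OF bump_class_compactly_supported[OF \<beta>'(2) assms(2)], of b] by (auto simp: real_norm_def)
    qed (auto intro: has_derivative_linear \<beta>')
    obtain B' where B': "B' > 0" "\<And>z. norm (\<beta> z) \<le> B'"
      using compactly_supported_bounded[OF bump_class_compactly_supported[OF \<beta> assms(2)]] by auto
    have [measurable]: "\<beta> \<in> borel_measurable borel"
      by (intro borel_measurable_continuous_onI bump_class_continuous[OF \<beta>])
    have "((\<lambda>z. LINT w|lborel. \<Phi> w * \<beta> (z - w)) has_derivative (\<lambda>v. LINT w|lborel. \<Phi> w * \<beta>' (z - w) v)) (at z)" for z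
    proof (rule has_derivative_integral[where W = "\<lambda>w. norm (\<Phi> w) * B"])
      show "((\<lambda>z. \<Phi> w * \<beta> (z - w)) has_derivative (\<lambda>v. \<Phi> w * \<beta>' (z - w) v)) (at z)" for w z
        by (intro has_derivative_mult_right has_derivative_compose[of "\<lambda>z. z - w" _ _ _ \<beta>, OF _ \<beta>'(1)])
          (auto intro!: derivative_eq_intros)
      show "integrable lborel (\<lambda>w. norm (\<Phi> w) * B)"
        using compactly_supported_integrable[OF \<Phi>] by simp
      show "norm (\<Phi> w * \<beta>' (z - w) v) \<le> norm (\<Phi> w) * B * norm v" for w z v
        using B(2)[of "z - w" v] by (simp add: abs_mult mult.assoc mult_left_mono)
      show "integrable lborel (\<lambda>w. \<Phi> w * \<beta> (z - w))" for z
      proof (rule Bochner_Integration.integrable_bound)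
        show "integrable lborel (\<lambda>w. norm (\<Phi> w) * B')"
          using compactly_supported_integrable[OF \<Phi>] by simp
        have [measurable]: "\<Phi> \<in> borel_measurable borel"
          using compactly_supported_integrable[OF \<Phi>] by auto
        show "(\<lambda>w. \<Phi> w * \<beta> (z - w)) \<in> borel_measurable lborel" by measurable
        show "AE w in lborel. norm (\<Phi> w * \<beta> (z - w)) \<le> norm (norm (\<Phi> w) * B')"
          using B' by (auto simp: abs_mult intro!: mult_mono)
      qed
    qed
    then have "(H \<beta> has_derivative (\<lambda>v. H (\<lambda>z. \<beta>' z v) z)) (at z)" for z
      unfolding H_def by (intro has_derivative_mult_right)
    with \<beta>'(2) show ?thesis by blast
  qed
  have "smooth (H \<beta>)"
  proof (rule smooth_coinduct[where P = "\<lambda>f. \<exists>\<beta>. bump_class N \<beta> \<and> f = H \<beta>"])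
    fix f assume "\<exists>\<beta>. bump_class N \<beta> \<and> f = H \<beta>"
    then obtain \<beta>' where \<beta>': "\<And>z. (f has_derivative (\<lambda>v. H (\<lambda>z. \<beta>' z v) z)) (at z)" "\<And>v. bump_class N (\<lambda>z. \<beta>' z v)"
      using * by blast
    show "f differentiable (at z)" for z
      by (rule differentiableI[OF \<beta>'(1)])
    have "(\<lambda>z. frechet_derivative f (at z) v) = H (\<lambda>z. \<beta>' z v)" for v
      by (rule ext) (simp flip: frechet_derivative_at[OF \<beta>'(1)])
    then show "\<exists>\<beta>. bump_class N \<beta> \<and> (\<lambda>z. frechet_derivative f (at z) v) = H \<beta>" for v
      using \<beta>'(2) by blast
  qed (use assms in auto)
  then show ?thesis by (simp add: H_def[abs_def])
qed

section \<open>Mollification by normalised bumps of radius \<open>1 / Suc n\<close>\<close>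

definition bump :: "nat \<Rightarrow> 'a::euclidean_space \<Rightarrow> real" where
  "bump n z = flat_exp 1 (1 - (real (Suc n))\<^sup>2 * (z \<bullet> z))"

lemma bump_class_bump: "bump_class ((real (Suc n))\<^sup>2) (bump n)"
  unfolding bump_def[abs_def] by (rule bump_class.base)

lemma bump_compactly_supported: "compactly_supported (bump n)"
  by (rule bump_class_compactly_supported[OF bump_class_bump]) simp

lemma bump_nonneg: "0 \<le> bump n z"
  by (simp add: bump_def flat_exp_def)

lemma bump_eq_0_iff: "bump n z = 0 \<longleftrightarrow> 1 / real (Suc n) \<le> norm z"
proof -
  have "bump n z = 0 \<longleftrightarrow> 1\<^sup>2 \<le> (real (Suc n) * norm z)\<^sup>2"
    by (simp add: bump_def flat_exp_def power_mult_distrib power2_norm_eq_inner del: of_nat_Suc)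
  also have "\<dots> \<longleftrightarrow> 1 \<le> real (Suc n) * norm z"
    by (subst power_mono_iff) auto
  finally show ?thesis by (simp add: pos_divide_le_eq mult.commute del: of_nat_Suc)
qed

lemma integral_bump_pos: "(LINT z|lborel. bump n (z::'a::euclidean_space)) > 0"
proof (rule ccontr)
  assume "\<not> ?thesis"
  moreover have "0 \<le> (LINT z|lborel. bump n (z::'a))"
    by (intro integral_nonneg_AE) (auto simp: bump_nonneg)
  ultimately have "(LINT z|lborel. bump n (z::'a)) = 0" by simp
  then have "AE z::'a in lborel. bump n z = 0"
    by (subst (asm) integral_nonneg_eq_0_iff_AE)
      (auto intro: compactly_supported_integrable bump_compactly_supported simp: bump_nonneg)
  then have "AE z::'a in lborel. z \<notin> ball 0 (1 / real (Suc n))"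
    by (auto elim!: eventually_mono simp: bump_eq_0_iff)
  then have "emeasure lborel (ball (0::'a) (1 / real (Suc n))) = 0"
    by (subst (asm) AE_iff_measurable[OF _ refl]) (auto simp: not_le ball_def)
  then have "measure lborel (ball (0::'a) (1 / real (Suc n))) = 0"
    by (simp add: measure_def)
  then show False
    using content_ball_pos[of "1 / real (Suc n)" "0::'a"] by simp
qed

definition mollify :: "nat \<Rightarrow> ('a::euclidean_space \<Rightarrow> real) \<Rightarrow> 'a \<Rightarrow> real" where
  "mollify n \<Phi> z = 1 / (LINT w|lborel. bump n (w::'a)) * (LINT w|lborel. \<Phi> (z - w) * bump n w)"

text \<open>Two forms of one convolution. With the shift on the bump it is visibly smooth; with the
  shift on \<open>\<Phi>\<close>, as in the definition, it is an average of nearby values and passes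
  derivatives on to \<open>\<Phi>\<close>.\<close>

lemma mollify_alt:
  fixes \<Phi> :: "'a::euclidean_space \<Rightarrow> real"
  assumes [measurable]: "\<Phi> \<in> borel_measurable borel"
  shows "mollify n \<Phi> z = 1 / (LINT w|lborel. bump n (w::'a)) * (LINT w|lborel. \<Phi> w * bump n (z - w))"
proof -
  have [measurable]: "(bump n :: 'a \<Rightarrow> real) \<in> borel_measurable borel"
    using bump_compactly_supported by (intro borel_measurable_continuous_onI) (auto simp: compactly_supported_def)
  have "lborel = distr lborel borel (\<lambda>x::'a. z - x)"
    using lborel_affine[of "-1" z] by (simp add: density_1)
  then have "(LINT w|lborel. \<Phi> w * bump n (z - w)) = (LINT w|distr lborel borel (\<lambda>x. z - x). \<Phi> w * bump n (z - w))"
    by simp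
  also have "\<dots> = (LINT w|lborel. \<Phi> (z - w) * bump n w)"
    by (subst integral_distr) auto
  finally show ?thesis by (simp add: mollify_def)
qed

text \<open>A weighted average obeys every bound that the averaged values obey. Besides convergence
  this yields uniform bounds (\<open>a = 0\<close>, \<open>e\<close> the bound of
  \<open>\<Phi>\<close>) and vanishing outside an enlarged support (\<open>a = 0\<close>,
  \<open>e = 0\<close>).\<close>

lemma mollify_near:
  fixes \<Phi> :: "'a::euclidean_space \<Rightarrow> real"
  assumes [measurable]: "\<Phi> \<in> borel_measurable borel"
    and near: "\<And>w. dist w z \<le> 1 / real (Suc n) \<Longrightarrow> \<bar>\<Phi> w - a\<bar> \<le> e"
  shows "\<bar>mollify n \<Phi> z - a\<bar> \<le> e"
proof -
  let ?c = "LINT w|lborel. bump n (w::'a)"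
  have int: "integrable lborel (bump n :: 'a \<Rightarrow> real)"
    by (intro compactly_supported_integrable bump_compactly_supported)
  have [measurable]: "(bump n :: 'a \<Rightarrow> real) \<in> borel_measurable borel"
    using int by auto
  have bd: "\<bar>(\<Phi> (z - w) - a) * bump n w\<bar> \<le> e * bump n w" for w
  proof (cases "norm w < 1 / real (Suc n)")
    case True
    then show ?thesis using near[of "z - w"] bump_nonneg[of n w] by (auto simp: dist_norm abs_mult intro!: mult_right_mono)
  next
    case False
    then have "bump n w = 0" by (simp add: bump_eq_0_iff)
    then show ?thesis by simp
  qed
  have int2: "integrable lborel (\<lambda>w. (\<Phi> (z - w) - a) * bump n w)"
  proof (rule Bochner_Integration.integrable_bound)
    show "integrable lborel (\<lambda>w. e * bump n (w::'a))" using int by simp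
    show "AE w in lborel. norm ((\<Phi> (z - w) - a) * bump n w) \<le> norm (e * bump n w)"
      using bd by (auto intro!: AE_I2 order_trans[OF bd])
  qed measurable
  have "(LINT w|lborel. \<Phi> (z - w) * bump n w) = (LINT w|lborel. (\<Phi> (z - w) - a) * bump n w + a * bump n w)"
    by (simp add: algebra_simps)
  also have "\<dots> = (LINT w|lborel. (\<Phi> (z - w) - a) * bump n w) + a * ?c"
    using int int2 by simp
  finally have "mollify n \<Phi> z - a = (LINT w|lborel. (\<Phi> (z - w) - a) * bump n w) / ?c"
    using integral_bump_pos[of n, where 'a = 'a] by (simp add: mollify_def field_simps)
  moreover have "\<bar>LINT w|lborel. (\<Phi> (z - w) - a) * bump n w\<bar> \<le> (LINT w|lborel. e * bump n (w::'a))"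
  proof -
    have "(LINT w|lborel. \<bar>(\<Phi> (z - w) - a) * bump n w\<bar>) \<le> (LINT w|lborel. e * bump n (w::'a))"
      using int by (intro integral_mono[OF integrable_abs[OF int2]] bd) simp
    then show ?thesis by (rule order_trans[OF integral_abs_bound])
  qed
  ultimately show ?thesis
    using integral_bump_pos[of n, where 'a = 'a] by (simp add: pos_divide_le_eq)
qed

lemma mollify_tendsto:
  fixes \<Phi> :: "'a::euclidean_space \<Rightarrow> real"
  assumes "continuous_on UNIV \<Phi>"
  shows "(\<lambda>n. mollify n \<Phi> z) \<longlonglongrightarrow> \<Phi> z"
proof (rule LIMSEQ_I)
  fix r :: real assume "r > 0"
  have "isCont \<Phi> z" using assms by (simp add: continuous_on_eq_continuous_at)
  then obtain \<delta> where \<delta>: "\<delta> > 0" "\<And>w. dist w z < \<delta> \<Longrightarrow> dist (\<Phi> w) (\<Phi> z) < r / 2"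
    using \<open>r > 0\<close> unfolding continuous_at_eps_delta by (meson half_gt_zero)
  obtain N where N: "1 / real (Suc N) < \<delta>"
    using \<delta>(1) nat_approx_posE by blast
  have "norm (mollify n \<Phi> z - \<Phi> z) < r" if "n \<ge> N" for n
  proof -
    have "1 / real (Suc n) \<le> 1 / real (Suc N)" using that by (simp add: frac_le)
    with N have "1 / real (Suc n) < \<delta>" by linarith
    then have "\<bar>mollify n \<Phi> z - \<Phi> z\<bar> \<le> r / 2"
      using \<delta>(2) by (intro mollify_near borel_measurable_continuous_onI assms) (auto simp: dist_real_def intro: less_imp_le le_less_trans)
    then show ?thesis using \<open>r > 0\<close> by simp
  qed
  then show "\<exists>no. \<forall>n\<ge>no. norm (mollify n \<Phi> z - \<Phi> z) < r" by blast
qed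

lemma mollify_smooth:
  fixes \<Phi> :: "'a::euclidean_space \<Rightarrow> real"
  assumes "compactly_supported \<Phi>"
  shows "smooth (mollify n \<Phi>)"
proof -
  have "\<Phi> \<in> borel_measurable borel"
    using assms by (intro borel_measurable_continuous_onI) (simp add: compactly_supported_def)
  then have "mollify n \<Phi> = (\<lambda>z. 1 / (LINT w|lborel. bump n (w::'a)) * (LINT w|lborel. \<Phi> w * bump n (z - w)))"
    by (intro ext) (rule mollify_alt)
  then show ?thesis
    by (simp only:) (rule smooth_bump_convolution[OF bump_class_bump _ assms], simp)
qed

lemma mollify_has_derivative:
  fixes \<Phi> :: "'a::euclidean_space \<Rightarrow> real"
  assumes "compactly_supported \<Phi>" and D: "\<And>z. (\<Phi> has_derivative D z) (at z)"
    and B: "\<And>z v. \<bar>D z v\<bar> \<le> B * norm v"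
  shows "(mollify n \<Phi> has_derivative (\<lambda>v. mollify n (\<lambda>w. D w v) z)) (at z)"
  unfolding mollify_def
proof (intro has_derivative_mult_right has_derivative_integral[where W = "\<lambda>w. B * bump n w"])
  have int: "integrable lborel (bump n :: 'a \<Rightarrow> real)"
    by (intro compactly_supported_integrable bump_compactly_supported)
  then have [measurable]: "(bump n :: 'a \<Rightarrow> real) \<in> borel_measurable borel" by auto
  have [measurable]: "\<Phi> \<in> borel_measurable borel"
    using assms by (intro borel_measurable_continuous_onI) (simp add: compactly_supported_def)
  show "integrable lborel (\<lambda>w::'a. B * bump n w)" using int by simp
  show "((\<lambda>z. \<Phi> (z - w) * bump n w) has_derivative (\<lambda>v. D (z - w) v * bump n w)) (at z)" for w z
    by (intro has_derivative_mult_left has_derivative_compose[of "\<lambda>z. z - w" _ _ _ \<Phi>, OF _ D])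
      (auto intro!: derivative_eq_intros)
  show "norm (D (z - w) v * bump n w) \<le> B * bump n w * norm v" for w z v
    using mult_right_mono[OF B[of "z - w" v] bump_nonneg[of n w]] bump_nonneg[of n w] by (simp add: abs_mult mult_ac)
  obtain C where C: "\<And>z. norm (\<Phi> z) \<le> C"
    using compactly_supported_bounded[OF assms(1)] by metis
  show "integrable lborel (\<lambda>w. \<Phi> (z - w) * bump n w)" for z
  proof (rule Bochner_Integration.integrable_bound)
    show "integrable lborel (\<lambda>w::'a. C * bump n w)" using int by simp
    show "AE w in lborel. norm (\<Phi> (z - w) * bump n w) \<le> norm (C * bump n w)"
      using C bump_nonneg[of n] by (auto intro!: AE_I2 order_trans[OF _ abs_ge_self] mult_right_mono simp: abs_mult)
  qed measurable
qed

section \<open>Weak-* continuous families of measures\<close>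

lemma integrable_bounded_continuous:
  fixes g :: "'a::euclidean_space \<Rightarrow> 'b::euclidean_space"
  assumes "finite_measure \<mu>" "sets \<mu> = sets borel" "continuous_on UNIV g" "\<And>z. norm (g z) \<le> B"
  shows "integrable \<mu> g"
proof -
  interpret finite_measure \<mu> by fact
  have "g \<in> borel_measurable borel" using assms by (intro borel_measurable_continuous_onI)
  then have "g \<in> borel_measurable \<mu>" using measurable_cong_sets[OF assms(2) refl] by blast
  then show ?thesis using assms by (intro integrable_const_bound[where B = B]) auto
qed

text \<open>Each tent is 1 up to radius \<open>r n\<close> and 0 beyond \<open>r n + 1\<close>. The
  radii may grow arbitrarily fast, so the sum need not have compact support; it tends to 0 because
  beyond the first \<open>N\<close> tents at most \<open>2 * (1/2)^N\<close> remains.\<close>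

lemma tent_series_C0:
  fixes r :: "nat \<Rightarrow> real"
  defines "g \<equiv> \<lambda>z::'a::euclidean_space. \<Sum>n. (1/2)^n * max 0 (min 1 (r n + 1 - norm z))"
  shows "g \<in> C0_functions" "(1/2)^n * max 0 (min 1 (r n + 1 - norm z)) \<le> g z" "\<And>z. \<bar>g z\<bar> \<le> 2"
proof -
  let ?\<chi> = "\<lambda>n (z::'a). max 0 (min 1 (r n + 1 - norm z))"
  have \<chi>: "0 \<le> ?\<chi> n z" "?\<chi> n z \<le> 1" for n z by auto
  have geo: "summable (\<lambda>n. (1/2::real)^n)" by (simp add: summable_geometric)
  have bd: "norm ((1/2)^n * ?\<chi> n z) \<le> (1/2)^n" for n z
    using \<chi>[of n z] by (simp add: abs_mult mult_left_le)
  have sm: "summable (\<lambda>n. (1/2)^n * ?\<chi> n z)" for z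
    by (rule summable_comparison_test'[OF geo]) (use bd in auto)
  show "(1/2)^n * ?\<chi> n z \<le> g z" for n z
    using sum_le_suminf[OF sm, of "{n}" z] \<chi> by (simp add: g_def)
  have tail: "\<bar>g z\<bar> \<le> 2 * (1/2)^N" if "\<And>n. n < N \<Longrightarrow> ?\<chi> n z = 0" for N z
  proof -
    have "g z = (\<Sum>n. (1/2)^(n+N) * ?\<chi> (n+N) z)"
      unfolding g_def using suminf_split_initial_segment[OF sm, of z N] that by simp
    also have "norm \<dots> \<le> (\<Sum>n. (1/2)^(n+N))"
      by (rule norm_suminf_le) (use bd geo summable_ignore_initial_segment[OF geo] in auto)
    also have "\<dots> = 2 * (1/2)^N"
      using suminf_mult2[OF geo, of "(1/2)^N"] by (simp add: power_add suminf_geometric)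
    finally show ?thesis by simp
  qed
  from tail[of 0] show "\<bar>g z\<bar> \<le> 2" for z by simp
  have "uniform_limit UNIV (\<lambda>N z. \<Sum>n<N. (1/2)^n * ?\<chi> n z) g sequentially"
    unfolding g_def by (rule Weierstrass_m_test[OF _ geo]) (use bd in auto)
  then have "continuous_on UNIV g"
    by (rule uniform_limit_theorem[rotated]) (auto intro!: always_eventually continuous_intros)
  moreover have "(g \<longlongrightarrow> 0) at_infinity"
  proof (rule tendstoI)
    fix e :: real assume "e > 0"
    then obtain N where N: "(1/2::real)^N < e / 2"
      using real_arch_pow_inv[of "e / 2" "1/2"] by auto
    have "\<bar>g z\<bar> < e" if "norm z \<ge> (\<Sum>n<N. \<bar>r n\<bar> + 1)" for z
    proof -
      have z0: "?\<chi> n z = 0" if "n < N" for n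
      proof -
        have "\<bar>r n\<bar> + 1 \<le> (\<Sum>n<N. \<bar>r n\<bar> + 1)"
          using that by (intro member_le_sum) auto
        with \<open>norm z \<ge> _\<close> show ?thesis by auto
      qed
      have "\<bar>g z\<bar> \<le> 2 * (1/2) ^ N" by (rule tail[OF z0])
      with N show ?thesis by simp
    qed
    then show "\<forall>\<^sub>F z in at_infinity. dist (g z) 0 < e"
      by (auto simp: eventually_at_infinity)
  qed
  ultimately show "g \<in> C0_functions" by (simp add: C0_functions_def)
qed

text \<open>A gliding hump: if the masses \<open>\<mu> (t n)\<close> grew like \<open>4 ^ n\<close>, the function \<open>\<Sum>n. 2 ^ - n * \<chi> n\<close> with suitable
  cutoffs \<open>\<chi> n\<close> would have unbounded integrals.\<close>

lemma weak_star_mass_bounded: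
  fixes f :: "real \<Rightarrow> 'a::euclidean_space measure"
  assumes cont: "\<And>g. g \<in> C0_functions \<Longrightarrow> continuous_on {0..S} (\<lambda>t. LINT z|f t. g z)"
    and f: "\<And>t. t \<in> {0..S} \<Longrightarrow> sets (f t) = sets borel" "\<And>t. t \<in> {0..S} \<Longrightarrow> finite_measure (f t)"
  obtains M where "\<And>t. t \<in> {0..S} \<Longrightarrow> measure (f t) UNIV \<le> M"
proof (rule ccontr)
  assume "\<not> thesis"
  with that have "\<forall>n. \<exists>t\<in>{0..S}. 4 ^ n < measure (f t) UNIV" by (metis not_le)
  then obtain t where t: "\<And>n. t n \<in> {0..S}" "\<And>n. 4 ^ n < measure (f (t n)) UNIV" by metis
  have "\<exists>r. 4 ^ n < measure (f (t n)) (cball 0 r)" for n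
  proof -
    interpret finite_measure "f (t n)" using f t by auto
    have "(\<lambda>k. measure (f (t n)) (cball 0 (real k))) \<longlonglongrightarrow> measure (f (t n)) (\<Union>k. cball 0 (real k))"
      by (rule finite_Lim_measure_incseq) (auto simp: f(1)[OF t(1)] incseq_def)
    moreover have "(\<Union>k. cball (0::'a) (real k)) = UNIV"
      by (auto intro: real_arch_simple)
    ultimately have "\<forall>\<^sub>F k in sequentially. 4 ^ n < measure (f (t n)) (cball 0 (real k))"
      using t(2)[of n] order_tendstoD(1) by fastforce
    then show ?thesis by (meson eventually_happens sequentially_bot)
  qed
  then obtain r where r: "\<And>n. 4 ^ n < measure (f (t n)) (cball 0 (r n))" by metis
  define g where "g z = (\<Sum>n. (1/2)^n * max 0 (min 1 (r n + 1 - norm z)))" for z :: 'a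
  note g = tent_series_C0[where 'a = 'a and r = r, folded g_def]
  have gc: "continuous_on UNIV g" using g(1) by (simp add: C0_functions_def)
  have "compact ((\<lambda>t. LINT z|f t. g z) ` {0..S})"
    using cont[OF g(1)] by (intro compact_continuous_image) auto
  then obtain B where B: "\<And>t. t \<in> {0..S} \<Longrightarrow> \<bar>LINT z|f t. g z\<bar> \<le> B"
    using compact_imp_bounded bounded_real by (metis image_eqI)
  have "2 ^ n \<le> B" for n
  proof -
    interpret finite_measure "f (t n)" using f t by auto
    have "(2::real) ^ n = (1/2) ^ n * 4 ^ n"
      by (simp add: power_mult_distrib[symmetric])
    also have "\<dots> \<le> (1/2) ^ n * measure (f (t n)) (cball 0 (r n))"
      using r[of n] by simp
    also have "\<dots> = (LINT z|f (t n). (1/2) ^ n * indicator (cball 0 (r n)) z)"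
      using f t by (simp add: sets_eq_imp_space_eq[OF f(1)])
    also have "\<dots> \<le> (LINT z|f (t n). g z)"
    proof (rule integral_mono)
      show "integrable (f (t n)) (\<lambda>z. (1/2) ^ n * indicator (cball 0 (r n)) z :: real)"
        using f t by (intro integrable_mult_right integrable_real_indicator) (auto simp: emeasure_eq_measure)
      show "integrable (f (t n)) g"
        using f t g(3) by (intro integrable_bounded_continuous[OF _ _ gc, where B = 2]) auto
      show "(1/2) ^ n * indicator (cball 0 (r n)) z \<le> g z" for z
        by (rule order_trans[OF _ g(2)[of n]]) (auto simp: indicator_def)
    qed
    also have "\<dots> \<le> B" using B[OF t(1)[of n]] by simp
    finally show ?thesis .
  qed
  then show False
    using real_arch_pow[of 2 B] by (meson not_le one_less_numeral_iff semiring_norm(76))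
qed

lemma Int_stable_boxes: "Int_stable (range (\<lambda>(a, b). box a b :: 'a::euclidean_space set))"
  by (auto simp: Int_stable_def box_Int_box image_iff)

text \<open>The truncated multiples of the distance to the complement increase to the indicator of
  the open box. One sequence serves all finite measures, so it can be used both for a whole family
  \<open>f t\<close> and for comparing two measures.\<close>

lemma box_approximation:
  fixes a b :: "'a::euclidean_space"
  obtains g :: "nat \<Rightarrow> 'a \<Rightarrow> real" where "\<And>n. compactly_supported (g n)"
    "\<And>\<mu>. finite_measure \<mu> \<Longrightarrow> sets \<mu> = sets borel \<Longrightarrow> (\<lambda>n. LINT z|\<mu>. g n z) \<longlonglongrightarrow> measure \<mu> (box a b)"
proof
  define g where "g n z = min 1 (real n * infdist z (- box a b))" for n :: nat and z :: 'a
  have ne: "- box a b \<noteq> {}" using bounded_box[of a b] not_bounded_UNIV by (metis Compl_empty_eq double_complement)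
  show cs: "compactly_supported (g n)" for n
  proof -
    obtain R where "\<forall>z\<in>box a b. norm z \<le> R" using bounded_box[of a b] bounded_iff by blast
    then have "\<forall>z. R < norm z \<longrightarrow> g n z = 0"
      by (auto simp: g_def not_le[symmetric])
    then show ?thesis unfolding compactly_supported_def g_def by (auto intro!: continuous_intros)
  qed
  have g01: "0 \<le> g n z" "g n z \<le> 1" for n z by (auto simp: g_def infdist_nonneg)
  have lim: "(\<lambda>n. g n z) \<longlonglongrightarrow> indicator (box a b) z" for z
  proof (cases "z \<in> box a b")
    case True
    have "closed (- box a b)" by (simp add: closed_def open_box)
    with True ne have "infdist z (- box a b) > 0"
      by (metis ComplD in_closed_iff_infdist_zero infdist_nonneg less_eq_real_def)
    then have "\<forall>\<^sub>F n in sequentially. g n z = 1"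
      by (auto simp: g_def eventually_sequentially min_def field_simps intro!: exI[of _ "nat \<lceil>1 / infdist z (- box a b)\<rceil>"])
    then show ?thesis using True by (simp add: tendsto_eventually)
  qed (auto simp: g_def)
  show "(\<lambda>n. LINT z|\<mu>. g n z) \<longlonglongrightarrow> measure \<mu> (box a b)" if \<mu>: "finite_measure \<mu>" "sets \<mu> = sets borel" for \<mu>
  proof -
    interpret finite_measure \<mu> by fact
    have "(\<lambda>n. LINT z|\<mu>. g n z) \<longlonglongrightarrow> (LINT z|\<mu>. indicator (box a b) z)"
    proof (rule integral_dominated_convergence[where w = "\<lambda>_. 1"])
      show "g n \<in> borel_measurable \<mu>" for n
        using integrable_bounded_continuous[OF \<mu>, of "g n" 1] cs[of n] g01
        by (auto simp: compactly_supported_def)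
      have "box a b \<in> sets \<mu>" using \<mu> by simp
      then show "indicator (box a b) \<in> borel_measurable \<mu>" by (rule borel_measurable_indicator)
    qed (use lim g01 in auto)
    then show ?thesis using \<mu> by (simp add: sets_eq_imp_space_eq[OF \<mu>(2)])
  qed
qed

lemma weak_star_emeasure_box_measurable:
  fixes f :: "real \<Rightarrow> 'a::euclidean_space measure"
  assumes cont: "\<And>g. g \<in> C0_functions \<Longrightarrow> continuous_on {0..S} (\<lambda>t. LINT z|f t. g z)"
    and f: "\<And>t. t \<in> {0..S} \<Longrightarrow> sets (f t) = sets borel" "\<And>t. t \<in> {0..S} \<Longrightarrow> finite_measure (f t)"
  shows "(\<lambda>t. emeasure (f t) (box a b)) \<in> borel_measurable (restrict_space borel {0..S})"
proof -
  obtain g :: "nat \<Rightarrow> 'a \<Rightarrow> real" where g: "\<And>n. compactly_supported (g n)"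
    "\<And>\<mu>. finite_measure \<mu> \<Longrightarrow> sets \<mu> = sets borel \<Longrightarrow> (\<lambda>n. LINT z|\<mu>. g n z) \<longlonglongrightarrow> measure \<mu> (box a b)"
    using box_approximation[of a b] by blast
  have "(\<lambda>t. measure (f t) (box a b)) \<in> borel_measurable (restrict_space borel {0..S})"
  proof (rule borel_measurable_LIMSEQ_real)
    show "(\<lambda>t. LINT z|f t. g n z) \<in> borel_measurable (restrict_space borel {0..S})" for n
      by (rule borel_measurable_continuous_on_restrict[OF cont[OF compactly_supported_C0[OF g(1)]]])
    show "(\<lambda>n. LINT z|f t. g n z) \<longlonglongrightarrow> measure (f t) (box a b)" if "t \<in> space (restrict_space borel {0..S})" for t
      using that f by (intro g(2)) (auto simp: space_restrict_space)
  qed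
  then have "(\<lambda>t. ennreal (measure (f t) (box a b))) \<in> borel_measurable (restrict_space borel {0..S})"
    by measurable
  then show ?thesis
    using f(2) by (subst measurable_cong[where g = "\<lambda>t. ennreal (measure (f t) (box a b))"])
      (auto simp: space_restrict_space finite_measure.emeasure_eq_measure)
qed

text \<open>Scaling by \<open>m\<close> turns the family into a kernel of sub-probabilities, for
  which measurability on boxes extends to all Borel sets. An integrand that depends on the parameter
  is integrated against the image of the kernel under \<open>y \<mapsto> (x, y)\<close>. The map
  \<open>\<tau>\<close> admits parameters beyond time, such as the position in
  \<open>force_measurable\<close>.\<close>

lemma integral_measurable_kernel:
  fixes f :: "real \<Rightarrow> 'a::euclidean_space measure" and H :: "'c \<Rightarrow> 'a \<Rightarrow> 'b::{banach, second_countable_topology}"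
  assumes cont: "\<And>g. g \<in> C0_functions \<Longrightarrow> continuous_on {0..S} (\<lambda>t. LINT z|f t. g z)"
    and f: "\<And>t. t \<in> {0..S} \<Longrightarrow> sets (f t) = sets borel" "\<And>t. t \<in> {0..S} \<Longrightarrow> finite_measure (f t)"
    and M: "\<And>t. t \<in> {0..S} \<Longrightarrow> measure (f t) UNIV \<le> M"
    and \<tau>: "\<tau> \<in> measurable N (restrict_space borel {0..S})"
    and H: "case_prod H \<in> borel_measurable (N \<Otimes>\<^sub>M borel)"
  shows "(\<lambda>x. LINT z|f (\<tau> x). H x z) \<in> borel_measurable N"
proof -
  define m where "m = 1 / (\<bar>M\<bar> + 1)"
  have m: "m > 0" by (simp add: m_def)
  define \<kappa> where "\<kappa> t = density (f t) (\<lambda>_. ennreal m)" for t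
  have em: "emeasure (\<kappa> t) X = ennreal m * emeasure (f t) X" if "t \<in> {0..S}" "X \<in> sets borel" for t X
  proof -
    have "X \<in> sets (f t)" using that f by simp
    then show ?thesis by (simp add: \<kappa>_def emeasure_density nn_integral_cmult_indicator)
  qed
  have \<kappa>: "\<kappa> \<in> measurable (restrict_space borel {0..S}) (subprob_algebra borel)"
  proof (rule measurable_subprob_algebra_generated[where G = "range (\<lambda>(a, b). box a b)" and \<Omega> = UNIV])
    show "sets borel = sigma_sets UNIV (range (\<lambda>(a, b). box a b :: 'a set))" by (simp add: borel_eq_box)
    show "Int_stable (range (\<lambda>(a, b). box a b :: 'a set))" by (rule Int_stable_boxes)
    show "subprob_space (\<kappa> t)" if "t \<in> space (restrict_space borel {0..S})" for t
    proof
      from that have t: "t \<in> {0..S}" by (simp add: space_restrict_space)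
      have sp: "space (\<kappa> t) = UNIV" using sets_eq_imp_space_eq[OF f(1)[OF t]] by (simp add: \<kappa>_def)
      show "space (\<kappa> t) \<noteq> {}" using sp by simp
      have "emeasure (\<kappa> t) (space (\<kappa> t)) = ennreal (m * measure (f t) UNIV)"
        using em[OF t] sp f t m by (simp add: finite_measure.emeasure_eq_measure ennreal_mult)
      also have "m * measure (f t) UNIV \<le> 1"
        using M[OF t] by (simp add: m_def pos_divide_le_eq)
      finally show "emeasure (\<kappa> t) (space (\<kappa> t)) \<le> 1" by (simp add: ennreal_leI)
    qed
    show "sets (\<kappa> t) = sets borel" if "t \<in> space (restrict_space borel {0..S})" for t
      using that f by (simp add: \<kappa>_def space_restrict_space)
    have box: "(\<lambda>t. emeasure (\<kappa> t) (box a b)) \<in> borel_measurable (restrict_space borel {0..S})" for a b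
      using weak_star_emeasure_box_measurable[OF cont f, of a b]
      by (subst measurable_cong[where g = "\<lambda>t. ennreal m * emeasure (f t) (box a b)"]) (auto simp: em space_restrict_space)
    then show "(\<lambda>t. emeasure (\<kappa> t) X) \<in> borel_measurable (restrict_space borel {0..S})"
      if "X \<in> range (\<lambda>(a, b). box a b)" for X using that by auto
    \<comment> \<open>The generator theorem also asks for the total mass, and the whole space is not
      a box; it is exhausted by boxes instead.\<close>
    let ?B = "\<lambda>i::nat. box (- (real i *\<^sub>R One)) (real i *\<^sub>R One :: 'a)"
    have "emeasure (\<kappa> t) UNIV = (SUP i. emeasure (\<kappa> t) (?B i))" if "t \<in> {0..S}" for t
    proof -
      have "incseq ?B"
        by (auto simp: incseq_def box_def)
      then have "(SUP i. emeasure (\<kappa> t) (?B i)) = emeasure (\<kappa> t) (\<Union>i. ?B i)"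
        using that f by (intro SUP_emeasure_incseq) (auto simp: \<kappa>_def)
      then show ?thesis by (simp add: UN_box_eq_UNIV)
    qed
    then show "(\<lambda>t. emeasure (\<kappa> t) UNIV) \<in> borel_measurable (restrict_space borel {0..S})"
      using box by (subst measurable_cong[where g = "\<lambda>t. SUP i. emeasure (\<kappa> t) (?B i)"]) (auto simp: space_restrict_space)
  qed auto
  have \<tau>S: "\<tau> x \<in> {0..S}" if "x \<in> space N" for x
    using measurable_space[OF \<tau> that] by (simp add: space_restrict_space)
  have [measurable]: "(\<lambda>x. \<kappa> (\<tau> x)) \<in> measurable N (subprob_algebra borel)"
    by (rule measurable_compose[OF \<tau> \<kappa>])
  note [measurable] = H
  note integral_measurable_subprob_algebra[measurable] measurable_distr2[measurable]
  have *: "(\<lambda>x. integral\<^sup>L (distr (\<kappa> (\<tau> x)) (N \<Otimes>\<^sub>M borel) (\<lambda>y. (x, y))) (case_prod H)) \<in> borel_measurable N"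
    by measurable
  have eq: "(LINT z|f (\<tau> x). H x z) = (1 / m) *\<^sub>R integral\<^sup>L (distr (\<kappa> (\<tau> x)) (N \<Otimes>\<^sub>M borel) (\<lambda>y. (x, y))) (case_prod H)"
    if x: "x \<in> space N" for x
  proof -
    note s = f(1)[OF \<tau>S[OF x]]
    have [measurable]: "H x \<in> borel_measurable borel"
      using H x by measurable
    then have [measurable]: "H x \<in> borel_measurable (f (\<tau> x))"
      using measurable_cong_sets[OF s refl] by blast
    have s': "sets (\<kappa> (\<tau> x)) = sets borel" by (simp add: \<kappa>_def s)
    have "(\<lambda>y. (x, y)) \<in> measurable borel (N \<Otimes>\<^sub>M borel)" using x by measurable
    then have pm: "(\<lambda>y. (x, y)) \<in> measurable (\<kappa> (\<tau> x)) (N \<Otimes>\<^sub>M borel)"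
      using measurable_cong_sets[OF s' refl] by blast
    have "integral\<^sup>L (distr (\<kappa> (\<tau> x)) (N \<Otimes>\<^sub>M borel) (\<lambda>y. (x, y))) (case_prod H) = (LINT z|\<kappa> (\<tau> x). H x z)"
      by (subst integral_distr[OF pm H]) simp
    also have "\<dots> = m *\<^sub>R (LINT z|f (\<tau> x). H x z)"
      unfolding \<kappa>_def by (subst integral_density) (simp_all add: less_imp_le[OF m])
    finally show ?thesis using m by simp
  qed
  have "(\<lambda>x. (1 / m) *\<^sub>R integral\<^sup>L (distr (\<kappa> (\<tau> x)) (N \<Otimes>\<^sub>M borel) (\<lambda>y. (x, y))) (case_prod H)) \<in> borel_measurable N"
    using * by (intro borel_measurable_scaleR borel_measurable_const)
  then show ?thesis by (subst measurable_cong[OF eq])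
qed

section \<open>The weak formulation\<close>

text \<open>A measure without density has norm \<open>\<infinity>\<close> by convention, which a
  finite bound excludes. The Radon-Nikodym density is then almost everywhere below its essential
  supremum, hence below \<open>A\<close>.\<close>

lemma nn_integral_marginal_le_Linfty:
  assumes \<mu>: "sets \<mu> = sets borel" and A: "Linfty_norm_density (spatial_marginal \<mu>) \<le> ennreal A"
    and [measurable]: "h \<in> borel_measurable borel"
  shows "(\<integral>\<^sup>+z. h (fst z) \<partial>\<mu>) \<le> ennreal A * (\<integral>\<^sup>+y. h y \<partial>lborel)"
proof -
  define \<nu> where "\<nu> = spatial_marginal \<mu>"
  have ac: "absolutely_continuous lborel \<nu>"
    using A by (auto simp: Linfty_norm_density_def \<nu>_def top_unique split: if_splits)
  have [measurable]: "fst \<in> measurable \<mu> borel"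
    using \<mu> by (simp cong: measurable_cong_sets)
  have "(\<integral>\<^sup>+z. h (fst z) \<partial>\<mu>) = (\<integral>\<^sup>+y. h y \<partial>\<nu>)"
    by (simp add: \<nu>_def spatial_marginal_def nn_integral_distr)
  also have "\<nu> = density lborel (RN_deriv lborel \<nu>)"
    using ac by (intro sigma_finite_measure.density_RN_deriv[symmetric, OF lborel.sigma_finite_measure_axioms]) (auto simp: \<nu>_def spatial_marginal_def)
  also have "(\<integral>\<^sup>+y. h y \<partial>\<dots>) = (\<integral>\<^sup>+y. RN_deriv lborel \<nu> y * h y \<partial>lborel)"
    by (subst nn_integral_density) auto
  also have "\<dots> \<le> (\<integral>\<^sup>+y. ennreal A * h y \<partial>lborel)"
  proof (rule nn_integral_mono_AE)
    show "AE y in lborel. RN_deriv lborel \<nu> y * h y \<le> ennreal A * h y"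
      using esssup_AE[of "RN_deriv lborel \<nu>" lborel]
    proof eventually_elim
      case (elim y)
      also have "esssup lborel (RN_deriv lborel \<nu>) \<le> ennreal A"
        using A ac by (simp add: Linfty_norm_density_def \<nu>_def)
      finally show ?case by (intro mult_right_mono) auto
    qed
  qed
  also have "\<dots> = ennreal A * (\<integral>\<^sup>+y. h y \<partial>lborel)"
    by (rule nn_integral_cmult) simp
  finally show ?thesis .
qed

lemma inner_grad:
  fixes \<phi> :: "'a::euclidean_space \<Rightarrow> real"
  assumes "(\<phi> has_derivative D) (at x)"
  shows "u \<bullet> grad \<phi> x = D u"
proof -
  define g where "g = (\<Sum>b\<in>Basis. D b *\<^sub>R b)"
  have g: "v \<bullet> g = D v" for v
    by (subst linear_expand_Basis[OF has_derivative_linear[OF assms], of v]) (simp add: g_def inner_sum_right mult.commute)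
  have "GDERIV \<phi> x :> g" using assms by (simp add: gderiv_def g)
  then show ?thesis using g by (simp add: grad_eqI)
qed

text \<open>The derivative travels with the function, so that it can be composed and estimated
  explicitly. In finite dimension continuity in each direction \<open>v\<close> is the same as
  continuity in operator norm.\<close>

definition C1 :: "('a::euclidean_space \<Rightarrow> real) \<Rightarrow> ('a \<Rightarrow> 'a \<Rightarrow> real) \<Rightarrow> bool" where
  "C1 \<phi> D \<longleftrightarrow> (\<forall>z. (\<phi> has_derivative D z) (at z)) \<and> (\<forall>v. continuous_on UNIV (\<lambda>z. D z v))"

lemma C1D: 
  assumes "C1 \<phi> D" 
  shows "(\<phi> has_derivative D z) (at z)" "continuous_on UNIV (\<lambda>z. D z v)" "linear (D z)" "continuous_on UNIV \<phi>"
proof -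
  show D: "(\<phi> has_derivative D z) (at z)" for z using assms by (simp add: C1_def)
  show "continuous_on UNIV (\<lambda>z. D z v)" using assms by (simp add: C1_def)
  show "linear (D z)" by (rule has_derivative_linear[OF D])
  show "continuous_on UNIV \<phi>" by (rule has_derivative_continuous_on[where f' = D]) (simp add: D)
qed

lemma derivative_eq_0_open:
  assumes "(\<phi> has_derivative D) (at z)" "open U" "z \<in> U" "\<And>w. w \<in> U \<Longrightarrow> \<phi> w = 0"
  shows "D v = 0"
proof -
  have "((\<lambda>_. 0) has_derivative D) (at z)"
    by (rule has_derivative_transform_within_open[OF assms(1-3)]) (simp add: assms(4))
  then have "D = (\<lambda>_. 0)" by (rule has_derivative_unique[OF _ has_derivative_const])
  then show ?thesis by simp
qed

lemma linear_family_measurable: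
  fixes D :: "'z::euclidean_space \<Rightarrow> 'a::euclidean_space \<Rightarrow> real"
  assumes lin: "\<And>z. linear (D z)" and cont: "\<And>v. continuous_on UNIV (\<lambda>z. D z v)"
    and [measurable]: "Z \<in> borel_measurable N" "V \<in> borel_measurable N"
  shows "(\<lambda>y. D (Z y) (V y)) \<in> borel_measurable N"
proof -
  have [measurable]: "(\<lambda>z. D z b) \<in> borel_measurable borel" for b
    by (rule borel_measurable_continuous_onI[OF cont])
  have "D (Z y) (V y) = (\<Sum>b\<in>Basis. (V y \<bullet> b) * D (Z y) b)" for y
    by (rule linear_expand_Basis[OF lin])
  then show ?thesis by (simp only:) measurable
qed

lemma C1_measurable:
  assumes "C1 \<phi> D" "Z \<in> borel_measurable N" "V \<in> borel_measurable N"
  shows "(\<lambda>y. D (Z y) (V y)) \<in> borel_measurable N"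
  by (rule linear_family_measurable[OF C1D(3)[OF assms(1)] C1D(2)[OF assms(1)] assms(2,3)])

lemma C1_support:
  assumes "C1 \<phi> D" "open {z. P z}" "\<And>z. P z \<Longrightarrow> \<phi> z = 0" "P z"
  shows "D z v = 0"
  using derivative_eq_0_open[OF C1D(1)[OF assms(1)] assms(2)] assms(3,4) by auto

lemma C1_bounded:
  assumes "C1 \<phi> D" "\<And>z. R < norm z \<Longrightarrow> \<phi> z = 0"
  obtains B where "B > 0" "\<And>z v. \<bar>D z v\<bar> \<le> B * norm v"
proof (rule linear_family_bounded[of D])
  have "D z v = 0" if "R < norm z" for z v
    by (rule C1_support[OF assms(1), of "\<lambda>z. R < norm z"])
      (use assms(2) that in \<open>auto intro!: open_Collect_less continuous_intros\<close>)
  then have "compactly_supported (\<lambda>z. D z v)" for v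
    using C1D(2)[OF assms(1)] by (auto simp: compactly_supported_def)
  then show "\<exists>B. \<forall>z. \<bar>D z b\<bar> \<le> B" for b
    by (metis compactly_supported_bounded real_norm_def)
qed (use C1D[OF assms(1)] that in auto)

section \<open>A one-dimensional \<open>C1\<close> transition function\<close>

lemma DERIV_max_0_square: "DERIV (\<lambda>u::real. (max 0 u)\<^sup>2) u :> 2 * max 0 u"
proof -
  consider "u > 0" | "u < 0" | "u = 0" by linarith
  then show ?thesis
  proof cases
    case 1
    have "DERIV (\<lambda>u. u\<^sup>2) u :> 2 * max 0 u"
      using 1 by (auto intro!: derivative_eq_intros)
    moreover have "\<forall>\<^sub>F x in nhds u. (max 0 x)\<^sup>2 = x\<^sup>2"
      using eventually_nhds_in_open[of "{0<..}" u] 1 by (auto elim!: eventually_mono)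
    ultimately show ?thesis by (subst DERIV_cong_ev[OF refl _ refl])
  next
    case 2
    have "DERIV (\<lambda>u. 0) u :> 2 * max 0 u"
      using 2 by auto
    moreover have "\<forall>\<^sub>F x in nhds u. (max 0 x)\<^sup>2 = 0"
      using eventually_nhds_in_open[of "{..<0}" u] 2 by (auto elim!: eventually_mono)
    ultimately show ?thesis by (subst DERIV_cong_ev[OF refl _ refl])
  next
    case 3
    have "((\<lambda>h::real. (max 0 h)\<^sup>2 / h) \<longlongrightarrow> 0) (at 0)"
    proof (rule Lim_null_comparison)
      show "\<forall>\<^sub>F h in at 0. norm ((max 0 h)\<^sup>2 / h) \<le> \<bar>h\<bar>"
        by (rule always_eventually) (auto simp: max_def power2_eq_square)
      show "((\<lambda>h::real. \<bar>h\<bar>) \<longlongrightarrow> 0) (at 0)"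
        by (rule tendsto_eq_intros) (auto intro!: tendsto_eq_intros)
    qed
    then show ?thesis using 3 by (simp add: DERIV_def)
  qed
qed

text \<open>A \<open>C\<^sup>1\<close> transition from 1 to 0 on \<open>[0, 1]\<close>, whose second derivative is a step function.\<close>

definition sstep :: "real \<Rightarrow> real" where
  "sstep u = 1 - 2 * (max 0 u)\<^sup>2 + 4 * (max 0 (u - 1/2))\<^sup>2 - 2 * (max 0 (u - 1))\<^sup>2"

definition sstep' :: "real \<Rightarrow> real" where
  "sstep' u = - 4 * max 0 u + 8 * max 0 (u - 1/2) - 4 * max 0 (u - 1)"

lemma DERIV_sstep: "DERIV sstep u :> sstep' u"
proof -
  have *: "DERIV (\<lambda>u. (max 0 (u - a))\<^sup>2) u :> 2 * max 0 (u - a)" for a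
  proof -
    have "DERIV (\<lambda>u. u - a) u :> 1" by (auto intro!: derivative_eq_intros)
    from DERIV_chain'[OF this DERIV_max_0_square] show ?thesis by simp
  qed
  have "DERIV sstep u :> 0 - 2 * (2 * max 0 u) + 4 * (2 * max 0 (u - 1/2)) - 2 * (2 * max 0 (u - 1))"
    unfolding sstep_def[abs_def] by (intro DERIV_add DERIV_diff DERIV_cmult DERIV_const DERIV_max_0_square * )
  then show ?thesis by (simp add: sstep'_def)
qed

lemma sstep_le_0 [simp]: "u \<le> 0 \<Longrightarrow> sstep u = 1" "u \<le> 0 \<Longrightarrow> sstep' u = 0"
  by (auto simp: sstep_def sstep'_def)

lemma sstep_ge_1 [simp]: "1 \<le> u \<Longrightarrow> sstep u = 0" "1 \<le> u \<Longrightarrow> sstep' u = 0"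
  by (auto simp: sstep_def sstep'_def power2_eq_square algebra_simps)

lemma sstep_bounds: "0 \<le> sstep u" "sstep u \<le> 1"
proof -
  consider "u \<le> 0" | "0 \<le> u" "u \<le> 1/2" | "1/2 \<le> u" "u \<le> 1" | "1 \<le> u" by linarith
  then have "0 \<le> sstep u \<and> sstep u \<le> 1"
  proof cases
    case 2
    then have "u * u \<le> 1/2 * (1/2)" by (intro mult_mono) auto
    then show ?thesis using 2 by (auto simp: sstep_def power2_eq_square)
  next
    case 3
    then have eq: "sstep u = 2 * ((1 - u) * (1 - u))"
      by (auto simp: sstep_def power2_eq_square algebra_simps)
    have "(1 - u) * (1 - u) \<le> 1/2 * (1/2)" using 3 by (intro mult_mono) auto
    then show ?thesis using 3 by (auto simp: eq)
  qed auto
  then show "0 \<le> sstep u" "sstep u \<le> 1" by auto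
qed

lemma sstep'_bounds: "- 2 \<le> sstep' u" "sstep' u \<le> 0"
  by (auto simp: sstep'_def max_def)

lemma continuous_on_sstep' [continuous_intros]:
  "continuous_on X g \<Longrightarrow> continuous_on X (\<lambda>x. sstep' (g x))"
  unfolding sstep'_def by (intro continuous_intros)

lemma continuous_on_sstep [continuous_intros]:
  "continuous_on X g \<Longrightarrow> continuous_on X (\<lambda>x. sstep (g x))"
  unfolding sstep_def by (intro continuous_intros)

text \<open>Weak-* continuity bounds the masses on compact time intervals only, hence the bound
  \<open>M\<close> on \<open>[0, S]\<close> with \<open>S < T\<close>. The density bound is kept on
  all of \<open>[0, T[\<close>, where the weak formulation integrates and where \<open>grad\<close>
  of the potential must be identified.\<close>

locale vp_solution =
  fixes \<epsilon> T S A M :: real and f0 :: "(R3 \<times> R3) measure" and f :: "real \<Rightarrow> (R3 \<times> R3) measure"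
  assumes S: "0 < S" "S < T"
    and f0: "f0 \<in> bounded_positive_measures"
    and weak: "vlasov_poisson_weak_solution \<epsilon> T f0 f"
    and marginal: "\<And>t. t \<in> {0..<T} \<Longrightarrow> bounded_marginal (f t) A (measure (f t) UNIV)"
    and mass: "\<And>t. t \<in> {0..S} \<Longrightarrow> measure (f t) UNIV \<le> M"
begin

definition c where "c = \<epsilon> / (4 * pi)"

definition force :: "real \<Rightarrow> R3 \<Rightarrow> R3" where
  "force t x = c *\<^sub>R field 0 (f t) x"

definition Cb where "Cb = \<bar>c\<bar> * (A * (4 * pi) + M)"

text \<open>The direction \<open>(1, snd z, force t (fst z))\<close> is the velocity of the
  characteristics in space-time, so the integrand is the transport operator of the equation applied
  to the test function with derivative \<open>D\<close>.\<close>

definition rate :: "(real \<times> R3 \<times> R3 \<Rightarrow> real \<times> R3 \<times> R3 \<Rightarrow> real) \<Rightarrow> real \<Rightarrow> real" where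
  "rate D t = (LINT z|f t. D (t, z) (1, snd z, force t (fst z)))"

lemma bounded_marginal: "t \<in> {0..S} \<Longrightarrow> bounded_marginal (f t) A M"
  using marginal[of t] mass[of t] S by (auto simp: bounded_marginal_def bounded_marginal_axioms_def)

lemma sets_f: "t \<in> {0..S} \<Longrightarrow> sets (f t) = sets borel"
  and finite_f: "t \<in> {0..S} \<Longrightarrow> finite_measure (f t)"
  using bounded_marginal[of t] by (auto simp: bounded_marginal_def bounded_marginal_axioms_def)

lemma M_nonneg: "0 \<le> M"
  using bounded_marginal.M_nonneg[OF bounded_marginal, of 0] S by simp

lemma A_nonneg: "0 \<le> A"
  using bounded_marginal.A_nonneg[OF bounded_marginal, of 0] S by simp

lemma Cb_nonneg: "0 \<le> Cb"
  using M_nonneg A_nonneg by (simp add: Cb_def)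

lemma norm_force_le: "t \<in> {0..S} \<Longrightarrow> norm (force t x) \<le> Cb"
  using bounded_marginal.norm_field_le[OF bounded_marginal, of t 0 x]
  by (simp add: force_def Cb_def mult_left_mono)

lemma continuous_integral:
  assumes "g \<in> C0_functions"
  shows "continuous_on {0..S} (\<lambda>t. LINT z|f t. g z)"
proof -
  have "continuous_map (top_of_set {0..<T}) euclideanreal (\<lambda>t. LINT z|f t. g z)"
    using weak assms by (auto simp: vlasov_poisson_weak_solution_def continuous_map_weak_star_topology_iff)
  then have "continuous_on {0..<T} (\<lambda>t. LINT z|f t. g z)" by simp
  then show ?thesis by (rule continuous_on_subset) (use S in auto)
qed

lemma integral_measurable:
  fixes H :: "'c \<Rightarrow> R3 \<times> R3 \<Rightarrow> 'b::{banach, second_countable_topology}"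
  assumes "\<tau> \<in> measurable N (restrict_space borel {0..S})" "case_prod H \<in> borel_measurable (N \<Otimes>\<^sub>M borel)"
  shows "(\<lambda>x. LINT z|f (\<tau> x). H x z) \<in> borel_measurable N"
  by (rule integral_measurable_kernel[OF continuous_integral sets_f finite_f mass assms])

lemma force_measurable [measurable]:
  "(\<lambda>y. force (fst y) (snd y)) \<in> borel_measurable (restrict_space borel {0..S} \<Otimes>\<^sub>M borel)"
proof -
  have "(\<lambda>y. LINT z|f (fst y). coulomb 0 (snd y - fst z)) \<in> borel_measurable (restrict_space borel {0..S} \<Otimes>\<^sub>M borel)"
    by (rule integral_measurable) measurable
  then show ?thesis unfolding force_def field_def by measurable
qed

lemma integrand_measurable:
  assumes "C1 \<Phi> D"
  shows "(\<lambda>(t, z). D (t, z) (1, snd z, force t (fst z))) \<in> borel_measurable (restrict_space borel {0..S} \<Otimes>\<^sub>M borel)"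
proof -
  have [measurable]: "(\<lambda>y. fst y) \<in> borel_measurable (restrict_space borel {0..S} \<Otimes>\<^sub>M (borel :: (R3 \<times> R3) measure))"
    by (rule measurable_compose[OF measurable_fst measurable_restrict_space1]) simp
  have [measurable]: "(\<lambda>y. force (fst y) (fst (snd y))) \<in> borel_measurable (restrict_space borel {0..S} \<Otimes>\<^sub>M (borel :: (R3 \<times> R3) measure))"
  proof -
    have "(\<lambda>y. (fst y, fst (snd y))) \<in> measurable (restrict_space borel {0..S} \<Otimes>\<^sub>M (borel :: (R3 \<times> R3) measure)) (restrict_space borel {0..S} \<Otimes>\<^sub>M borel)"
      by measurable
    from measurable_compose[OF this force_measurable] show ?thesis by simp
  qed
  show ?thesis
    unfolding case_prod_unfold by (rule C1_measurable[OF assms]) (intro borel_measurable_Pair; measurable)+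
qed

lemma rate_measurable:
  assumes "C1 \<Phi> D"
  shows "rate D \<in> borel_measurable (restrict_space borel {0..S})"
  unfolding rate_def[abs_def]
  by (rule integral_measurable[where \<tau> = "\<lambda>t. t"]) (use integrand_measurable[OF assms] in simp_all)

lemma rate_integrand_measurable:
  assumes "C1 \<Phi> D" and t: "t \<in> {0..S}"
  shows "(\<lambda>z. D (t, z) (1, snd z, force t (fst z))) \<in> borel_measurable (f t)"
proof -
  have "(\<lambda>z. (t, z)) \<in> measurable borel (restrict_space borel {0..S} \<Otimes>\<^sub>M (borel :: (R3 \<times> R3) measure))"
    using t by (auto intro!: measurable_Pair measurable_restrict_space2)
  from measurable_compose[OF this integrand_measurable[OF assms(1)]]
  show ?thesis by (subst measurable_cong_sets[OF sets_f[OF t] refl]) simp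
qed

text \<open>The time derivative and the two gradients are partial derivatives of one Frechet
  derivative, and linearity adds them up to its value in the characteristic direction.
  \<open>grad_potential\<close> identifies the force.\<close>

lemma weak_form_smooth:
  assumes \<phi>: "\<phi> \<in> test_functions T" and D: "\<And>z. (\<phi> has_derivative D z) (at z)"
  shows "(LINT t:{0..<T}|lborel. rate D t) = - (LINT z|f0. \<phi> (0, z))"
proof -
  have D_slice1: "((\<lambda>s. \<phi> (s, x, \<xi>)) has_derivative (\<lambda>u. D (t, x, \<xi>) (u, 0, 0))) (at t)" for t x \<xi>
    by (rule has_derivative_compose[OF _ D, of "\<lambda>s. (s, x, \<xi>)"]) (auto intro!: derivative_eq_intros simp: zero_prod_def)
  have D_slice2: "((\<lambda>y. \<phi> (t, y, \<xi>)) has_derivative (\<lambda>u. D (t, x, \<xi>) (0, u, 0))) (at x)" for t x \<xi>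
    by (rule has_derivative_compose[OF _ D, of "\<lambda>y. (t, y, \<xi>)"]) (auto intro!: derivative_eq_intros simp: zero_prod_def)
  have D_slice3: "((\<lambda>\<eta>. \<phi> (t, x, \<eta>)) has_derivative (\<lambda>u. D (t, x, \<xi>) (0, 0, u))) (at \<xi>)" for t x \<xi>
    by (rule has_derivative_compose[OF _ D, of "\<lambda>\<eta>. (t, x, \<eta>)"]) (auto intro!: derivative_eq_intros simp: zero_prod_def)
  have eq: "deriv (\<lambda>s. \<phi> (s, x, \<xi>)) t + \<xi> \<bullet> grad (\<lambda>y. \<phi> (t, y, \<xi>)) x
      + grad (potential \<epsilon> (f t)) x \<bullet> grad (\<lambda>\<eta>. \<phi> (t, x, \<eta>)) \<xi> = D (t, x, \<xi>) (1, \<xi>, force t x)"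
    if t: "t \<in> {0..<T}" for t x \<xi>
  proof -
    have lin: "linear (D (t, x, \<xi>))" using has_derivative_linear[OF D] .
    have "DERIV (\<lambda>s. \<phi> (s, x, \<xi>)) t :> D (t, x, \<xi>) (1, 0, 0)"
    proof -
      have "D (t, x, \<xi>) (u, 0, 0) = D (t, x, \<xi>) (1, 0, 0) * u" for u
        using linear_scale[OF lin, of u "(1, 0, 0)"] by (simp add: mult.commute)
      then have "(\<lambda>u. D (t, x, \<xi>) (u, 0, 0)) = (*) (D (t, x, \<xi>) (1, 0, 0))" by (rule ext)
      then show ?thesis using D_slice1[of x \<xi> t] by (simp only: has_field_derivative_def)
    qed
    then have "deriv (\<lambda>s. \<phi> (s, x, \<xi>)) t = D (t, x, \<xi>) (1, 0, 0)" by (rule DERIV_imp_deriv)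
    moreover have "grad (potential \<epsilon> (f t)) x = force t x"
      using bounded_marginal.grad_potential[OF marginal[OF t]] by (simp add: force_def c_def)
    moreover have "D (t, x, \<xi>) (1, \<xi>, v) = D (t, x, \<xi>) (1, 0, 0) + D (t, x, \<xi>) (0, \<xi>, 0) + D (t, x, \<xi>) (0, 0, v)" for v
      by (simp add: linear_add[OF lin, symmetric])
    ultimately show ?thesis
      by (simp add: inner_grad[OF D_slice2] inner_grad[OF D_slice3])
  qed
  have eq': "deriv (\<lambda>s. \<phi> (s, p)) t + snd p \<bullet> grad (\<lambda>y. \<phi> (t, y, snd p)) (fst p)
      + grad (potential \<epsilon> (f t)) (fst p) \<bullet> grad (\<lambda>\<eta>. \<phi> (t, fst p, \<eta>)) (snd p) = D (t, p) (1, snd p, force t (fst p))"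
    if "t \<in> {0..<T}" for t p
    using eq[OF that, of "fst p" "snd p"] by simp
  have "(LINT t:{0..<T}|lborel. rate D t) = (LINT t:{0..<T}|lborel. (LINT (x, \<xi>)|f t.
             deriv (\<lambda>s. \<phi> (s, x, \<xi>)) t
             + \<xi> \<bullet> grad (\<lambda>y. \<phi> (t, y, \<xi>)) x
             + grad (potential \<epsilon> (f t)) x \<bullet> grad (\<lambda>\<eta>. \<phi> (t, x, \<eta>)) \<xi>))"
    unfolding set_lebesgue_integral_def
    by (rule Bochner_Integration.integral_cong[OF refl]) (auto simp: indicator_def rate_def case_prod_unfold eq')
  also have "\<dots> = - (LINT (x, \<xi>)|f0. \<phi> (0, x, \<xi>))"
    using weak \<phi> unfolding vlasov_poisson_weak_solution_def by blast
  finally show ?thesis by (simp add: case_prod_unfold)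
qed

end

section \<open>From smooth to \<open>C1\<close> test functions\<close>

lemma norm_triple_le: "norm (a, b, c) \<le> \<bar>a::real\<bar> + norm b + norm c"
  using norm_Pair_le[of a "(b, c)"] norm_Pair_le[of b c] by simp

lemma smooth_continuous: "smooth f \<Longrightarrow> continuous_on UNIV f"
  by (metis Ck.simps(1) smooth_def)

context vp_solution
begin

lemma integrable_bounded:
  assumes t: "t \<in> {0..S}" and "h \<in> borel_measurable borel" "\<And>z. norm (h z) \<le> K"
  shows "integrable (f t) (h :: _ \<Rightarrow> 'b::{banach, second_countable_topology})"
proof -
  interpret finite_measure "f t" using finite_f[OF t] .
  have "h \<in> borel_measurable (f t)" using assms(2) measurable_cong_sets[OF sets_f[OF t] refl] by blast
  then show ?thesis using assms(3) by (intro integrable_const_bound[where B = K]) auto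
qed

lemma abs_integral_le:
  fixes h :: "R3 \<times> R3 \<Rightarrow> real"
  assumes t: "t \<in> {0..S}" and h: "\<And>z. \<bar>h z\<bar> \<le> K"
  shows "\<bar>LINT z|f t. h z\<bar> \<le> K * M"
proof -
  interpret bounded_marginal "f t" A M using bounded_marginal[OF t] .
  have K: "0 \<le> K" using h[of 0] by linarith
  show ?thesis
  proof (cases "integrable (f t) h")
    case True
    have "\<bar>LINT z|f t. h z\<bar> \<le> (LINT z|f t. K)"
      using True h by (intro order_trans[OF integral_abs_bound] integral_mono) auto
    also have "\<dots> = K * measure (f t) UNIV" by (simp add: mult.commute)
    also have "\<dots> \<le> K * M" using K mass_le by (rule mult_left_mono[rotated])
    finally show ?thesis .
  qed (use K M_nonneg in \<open>simp add: not_integrable_integral_eq\<close>)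
qed

lemma integrand_le:
  fixes D :: "real \<times> R3 \<times> R3 \<Rightarrow> real \<times> R3 \<times> R3 \<Rightarrow> real"
  assumes B: "\<And>z v. \<bar>D z v\<bar> \<le> B * norm v" "0 \<le> B"
    and R: "\<And>v. R < norm (snd z) \<Longrightarrow> D (t, z) v = 0" "0 \<le> R" and t: "t \<in> {0..S}"
  shows "\<bar>D (t, z) (1, snd z, force t (fst z))\<bar> \<le> B * (1 + R + Cb)"
proof (cases "R < norm (snd z)")
  case True
  then show ?thesis using R B(2) Cb_nonneg by simp
next
  case False
  then have "norm (1::real, snd z, force t (fst z)) \<le> 1 + R + Cb"
    using norm_force_le[OF t, of "fst z"] by (intro order_trans[OF norm_triple_le]) simp
  then show ?thesis
    using B(2) by (intro order_trans[OF B(1)] mult_left_mono)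
qed

text \<open>The cutoffs and sheared test functions used below are only handled as \<open>C1\<close>
  functions, so the formulation is extended by mollification. The scale stays below 1 and below
  \<open>S - S0\<close>, which keeps all supports in one ball and before time \<open>S\<close>.
  Velocities are bounded there, so a single constant dominates the integrands and the derivatives
  converge under both integrals.\<close>

lemma weak_form_C1:
  assumes \<Phi>: "C1 \<Phi> D" and R: "\<And>z. R < norm z \<Longrightarrow> \<Phi> z = 0"
    and S0: "S0 < S" "\<And>z. S0 < fst z \<Longrightarrow> \<Phi> z = 0"
  shows "(LINT t:{0..<T}|lborel. rate D t) = - (LINT z|f0. \<Phi> (0, z))"
proof -
  obtain N where N: "1 / real (Suc N) < min 1 (S - S0)"
    using S0(1) by (elim nat_approx_posE[of "min 1 (S - S0)", rotated]) simp
  define \<phi> where "\<phi> n = mollify (n + N) \<Phi>" for n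
  define Dn where "Dn n z v = mollify (n + N) (\<lambda>w. D w v) z" for n z v
  have cs: "compactly_supported \<Phi>"
    using R C1D(4)[OF \<Phi>] by (auto simp: compactly_supported_def)
  have \<Phi>_eq_0: "\<Phi> z = 0" if "R < norm z \<or> S0 < fst z" for z
    using that R S0(2) by blast
  have D0: "D z v = 0" if "R < norm z \<or> S0 < fst z" for z v
    by (rule C1_support[OF \<Phi>, of "\<lambda>z. R < norm z \<or> S0 < fst z"])
      (use that R S0 in \<open>auto intro!: open_Collect_disj open_Collect_less continuous_intros\<close>)
  have csD: "compactly_supported (\<lambda>z. D z v)" for v
    unfolding compactly_supported_def by (intro conjI C1D(2)[OF \<Phi>] exI[of _ R]) (use D0 in blast)
  obtain B where B: "B > 0" "\<And>z v. \<bar>D z v\<bar> \<le> B * norm v"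
    using C1_bounded[OF \<Phi> R] by blast
  obtain B' where B': "B' > 0" "\<And>z. norm (\<Phi> z) \<le> B'"
    using compactly_supported_bounded[OF cs] by blast
  have small: "1 / real (Suc (n + N)) < 1" "1 / real (Suc (n + N)) < S - S0" for n
  proof -
    have "1 / real (Suc (n + N)) \<le> 1 / real (Suc N)" by (simp add: frac_le)
    with N show "1 / real (Suc (n + N)) < 1" "1 / real (Suc (n + N)) < S - S0" by linarith+
  qed
  have near: "R < norm w \<or> S0 < fst w"
    if "dist w z \<le> 1 / real (Suc (n + N))" "R + 1 < norm z \<or> S < fst z" for w z :: "real \<times> R3 \<times> R3" and n
  proof -
    have "norm z \<le> norm w + dist w z" using norm_triangle_sub[of z w] by (simp add: dist_norm norm_minus_commute)
    moreover have "\<bar>fst w - fst z\<bar> \<le> dist w z" using dist_fst_le[of w z] by (simp add: dist_real_def)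
    ultimately show ?thesis using that small[of n] by linarith
  qed
  have meas: "\<Phi> \<in> borel_measurable borel" "(\<lambda>z. D z v) \<in> borel_measurable borel" for v
    by (intro borel_measurable_continuous_onI C1D(4)[OF \<Phi>] C1D(2)[OF \<Phi>])+
  have \<phi>0: "\<phi> n z = 0" if "R + 1 < norm z \<or> S < fst z" for n z
  proof -
    have "\<bar>\<phi> n z - 0\<bar> \<le> 0"
      unfolding \<phi>_def by (rule mollify_near[OF meas(1)], drule near[OF _ that], drule \<Phi>_eq_0, simp)
    then show ?thesis by simp
  qed
  have Dn0: "Dn n z v = 0" if "R + 1 < norm z \<or> S < fst z" for n z v
  proof -
    have "\<bar>Dn n z v - 0\<bar> \<le> 0"
      unfolding Dn_def by (rule mollify_near[OF meas(2)], drule near[OF _ that], drule D0, simp)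
    then show ?thesis by simp
  qed
  have DnB: "\<bar>Dn n z v\<bar> \<le> B * norm v" for n z v
    using mollify_near[OF meas(2), of z "n + N" v 0 "B * norm v"] B(2) by (simp add: Dn_def)
  have \<phi>B: "\<bar>\<phi> n z\<bar> \<le> B'" for n z
    using mollify_near[OF meas(1), of z "n + N" 0 "B'"] B'(2) by (simp add: \<phi>_def)
  have C1n: "C1 (\<phi> n) (Dn n)" for n
    unfolding C1_def \<phi>_def Dn_def
    using mollify_has_derivative[OF cs C1D(1)[OF \<Phi>] B(2)] smooth_continuous[OF mollify_smooth[OF csD]] by auto
  have test: "\<phi> n \<in> test_functions T" for n
  proof -
    let ?Z = "{z \<in> {0..} \<times> UNIV. \<phi> n z \<noteq> 0}"
    have sub: "?Z \<subseteq> cball 0 (R + 1) \<inter> ({0..S} \<times> UNIV)"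
      using \<phi>0[of _ n] by (auto simp: not_less[symmetric])
    have "closed (cball 0 (R + 1) \<inter> ({0..S} \<times> (UNIV :: (R3 \<times> R3) set)))"
      by (intro closed_Int closed_Times) auto
    then have cl: "closure ?Z \<subseteq> cball 0 (R + 1) \<inter> ({0..S} \<times> UNIV)"
      using sub by (rule closure_minimal[rotated])
    have "closure ?Z \<subseteq> cball 0 (R + 1)" using cl by blast
    then have "bounded (closure ?Z)" by (rule bounded_subset[OF bounded_cball])
    then have "compact (closure ?Z)" by (simp add: compact_eq_bounded_closed)
    moreover have "closure ?Z \<subseteq> {0..<T} \<times> UNIV"
      by (rule order_trans[OF cl]) (use S in auto)
    moreover have "smooth (\<phi> n)" unfolding \<phi>_def by (rule mollify_smooth[OF cs])
    ultimately show ?thesis unfolding test_functions_def by blast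
  qed
  have eq: "(LINT t:{0..<T}|lborel. rate (Dn n) t) = - (LINT z|f0. \<phi> n (0, z))" for n
    by (rule weak_form_smooth[OF test C1D(1)[OF C1n]])
  have "(\<lambda>n. LINT z|f0. \<phi> n (0, z)) \<longlonglongrightarrow> (LINT z|f0. \<Phi> (0, z))"
  proof (rule integral_dominated_convergence[where w = "\<lambda>_. B'"])
    have f0: "sets f0 = sets borel" "finite_measure f0" using f0 by (auto simp: bounded_positive_measures_def)
    show "integrable f0 (\<lambda>_. B')" using finite_measure.integrable_const[OF f0(2)] .
    have "continuous_on UNIV (\<lambda>z. g (0::real, z))" if "continuous_on UNIV g" for g :: "real \<times> R3 \<times> R3 \<Rightarrow> real"
      by (rule continuous_on_compose2[OF that]) (auto intro!: continuous_intros)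
    then have m: "(\<lambda>z. g (0::real, z)) \<in> borel_measurable f0" if "continuous_on UNIV g" for g :: "real \<times> R3 \<times> R3 \<Rightarrow> real"
      using borel_measurable_continuous_onI that measurable_cong_sets[OF f0(1) refl] by blast
    show "(\<lambda>z. \<Phi> (0, z)) \<in> borel_measurable f0" "(\<lambda>z. \<phi> n (0, z)) \<in> borel_measurable f0" for n
      by (intro m C1D(4)[OF \<Phi>] C1D(4)[OF C1n])+
    show "AE z in f0. (\<lambda>n. \<phi> n (0, z)) \<longlonglongrightarrow> \<Phi> (0, z)"
      unfolding \<phi>_def by (intro AE_I2 LIMSEQ_ignore_initial_segment mollify_tendsto C1D(4)[OF \<Phi>])
  qed (use \<phi>B in auto)
  then have lim0: "(\<lambda>n. - (LINT z|f0. \<phi> n (0, z))) \<longlonglongrightarrow> - (LINT z|f0. \<Phi> (0, z))"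
    by (rule tendsto_minus)
  have K: "\<bar>E (t, z) (1, snd z, force t (fst z))\<bar> \<le> B * (1 + (\<bar>R\<bar> + 1) + Cb)"
    if "t \<in> {0..S}" "\<And>z v. R + 1 < norm z \<or> S < fst z \<Longrightarrow> E z v = 0" "\<And>z v. \<bar>E z v\<bar> \<le> B * norm v"
    for E :: "real \<times> R3 \<times> R3 \<Rightarrow> real \<times> R3 \<times> R3 \<Rightarrow> real" and t z
  proof (rule integrand_le[OF that(3) _ _ _ that(1)])
    show "E (t, z) v = 0" if "\<bar>R\<bar> + 1 < norm (snd z)" for v
    proof -
      have "norm (snd z) \<le> norm z" "norm z \<le> norm (t, z)"
        using norm_snd_le[of "snd z" "fst z"] norm_snd_le[of z t] by auto
      with \<open>\<bar>R\<bar> + 1 < norm (snd z)\<close> have "R + 1 < norm (t, z)" by linarith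
      then show ?thesis using \<open>\<And>z v. R + 1 < norm z \<or> S < fst z \<Longrightarrow> E z v = 0\<close> by simp
    qed
  qed (use B in auto)
  have "(\<lambda>n. LINT t|lborel. indicator {0..<T} t *\<^sub>R rate (Dn n) t) \<longlonglongrightarrow> (LINT t|lborel. indicator {0..<T} t *\<^sub>R rate D t)"
  proof (rule integral_dominated_convergence[where w = "\<lambda>t. B * (1 + (\<bar>R\<bar> + 1) + Cb) * M * indicator {0..S} t"])
    have z: "rate E t = 0" if "t > S" "\<And>z v. R + 1 < norm z \<or> S < fst z \<Longrightarrow> E z v = 0" for E t
      using that by (simp add: rate_def)
    have m: "(\<lambda>t. indicator {0..<T} t *\<^sub>R rate E t) \<in> borel_measurable lborel"
      if "C1 F E" "\<And>z v. R + 1 < norm z \<or> S < fst z \<Longrightarrow> E z v = 0" for F E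
    proof -
      have "(\<lambda>t. indicator {0..<T} t *\<^sub>R rate E t) = (\<lambda>t. indicator {0..S} t *\<^sub>R rate E t)"
        using z[of _ E] that(2) S by (auto simp: indicator_def fun_eq_iff)
      moreover have "(\<lambda>t. indicator {0..S} t *\<^sub>R rate E t) \<in> borel_measurable borel"
        using rate_measurable[OF that(1)] by (subst (asm) borel_measurable_restrict_space_iff) auto
      ultimately show ?thesis by simp
    qed
    have D0': "R + 1 < norm z \<or> S < fst z \<Longrightarrow> D z v = 0" for z v
      by (rule D0) (use S0 in auto)
    show "(\<lambda>t. indicator {0..<T} t *\<^sub>R rate D t) \<in> borel_measurable lborel"
      by (rule m[OF \<Phi> D0'])
    show "(\<lambda>t. indicator {0..<T} t *\<^sub>R rate (Dn n) t) \<in> borel_measurable lborel" for n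
      by (rule m[OF C1n Dn0])
    show "integrable lborel (\<lambda>t. B * (1 + (\<bar>R\<bar> + 1) + Cb) * M * indicator {0..S} t)"
      using S by (intro integrable_mult_right integrable_real_indicator) auto
    show "AE t in lborel. norm (indicator {0..<T} t *\<^sub>R rate (Dn n) t) \<le> B * (1 + (\<bar>R\<bar> + 1) + Cb) * M * indicator {0..S} t" for n
    proof (intro AE_I2)
      fix t :: real
      have "\<bar>rate (Dn n) t\<bar> \<le> B * (1 + (\<bar>R\<bar> + 1) + Cb) * M" if "t \<in> {0..S}"
        unfolding rate_def by (rule abs_integral_le[OF that K[OF that Dn0 DnB]])
      then show "norm (indicator {0..<T} t *\<^sub>R rate (Dn n) t) \<le> B * (1 + (\<bar>R\<bar> + 1) + Cb) * M * indicator {0..S} t"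
        using z[of t "Dn n"] Dn0[of _ n] S by (auto simp: indicator_def)
    qed
    show "AE t in lborel. (\<lambda>n. indicator {0..<T} t *\<^sub>R rate (Dn n) t) \<longlonglongrightarrow> indicator {0..<T} t *\<^sub>R rate D t"
    proof (rule AE_I2)
      fix t :: real
      consider "t \<in> {0..S}" | "t > S" | "t < 0" by force
      then show "(\<lambda>n. indicator {0..<T} t *\<^sub>R rate (Dn n) t) \<longlonglongrightarrow> indicator {0..<T} t *\<^sub>R rate D t"
      proof cases
        case 1
        interpret finite_measure "f t" using finite_f[OF 1] .
        have "(\<lambda>n. rate (Dn n) t) \<longlonglongrightarrow> rate D t"
          unfolding rate_def
        proof (rule integral_dominated_convergence[where w = "\<lambda>_. B * (1 + (\<bar>R\<bar> + 1) + Cb)"])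
          show "AE z in f t. (\<lambda>n. Dn n (t, z) (1, snd z, force t (fst z))) \<longlonglongrightarrow> D (t, z) (1, snd z, force t (fst z))"
            unfolding Dn_def by (intro AE_I2 LIMSEQ_ignore_initial_segment mollify_tendsto C1D(2)[OF \<Phi>])
          show "AE z in f t. norm (Dn n (t, z) (1, snd z, force t (fst z))) \<le> B * (1 + (\<bar>R\<bar> + 1) + Cb)" for n
            by (rule AE_I2, unfold real_norm_def, rule K[OF 1 Dn0 DnB])
        qed (use rate_integrand_measurable[OF _ 1] \<Phi> C1n in auto)
        then show ?thesis by (intro tendsto_intros)
      next
        case 2
        then show ?thesis using z[of t D] D0' z[of t "Dn _"] Dn0 by simp
      qed (auto simp: indicator_def)
    qed
  qed
  then have "(\<lambda>n. LINT t:{0..<T}|lborel. rate (Dn n) t) \<longlonglongrightarrow> (LINT t:{0..<T}|lborel. rate D t)"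
    by (simp add: set_lebesgue_integral_def)
  then show ?thesis
    using lim0 LIMSEQ_unique unfolding eq by blast
qed

end

section \<open>Evolution of integrals between two times\<close>

lemma C1_bounded_on_compact:
  assumes "C1 \<phi> D" "compact K"
  obtains B where "B > 0" "\<And>z v. z \<in> K \<Longrightarrow> \<bar>D z v\<bar> \<le> B * norm v"
proof -
  let ?D = "\<lambda>z. if z \<in> K then D z else (\<lambda>_. 0)"
  obtain B where B: "B > 0" "\<And>z v. \<bar>?D z v\<bar> \<le> B * norm v"
  proof (rule linear_family_bounded[of ?D])
    show "linear (?D z)" for z using C1D(3)[OF assms(1)] by (simp add: linear_zero)
    show "\<exists>B. \<forall>z. \<bar>?D z b\<bar> \<le> B" for b
    proof -
      have "compact ((\<lambda>z. D z b) ` K)"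
        by (intro compact_continuous_image continuous_on_subset[OF C1D(2)[OF assms(1)]] assms) auto
      then obtain C where "\<And>z. z \<in> K \<Longrightarrow> \<bar>D z b\<bar> \<le> C"
        using compact_imp_bounded bounded_real by (metis image_eqI)
      then show ?thesis by (intro exI[of _ "\<bar>C\<bar>"]) (auto intro: order_trans[OF _ abs_ge_self])
    qed
  qed blast
  then show ?thesis using that by (metis (full_types))
qed

text \<open>An approximate identity concentrating at \<open>t\<close> from the right: the
  fundamental theorem gives the mass \<open>sstep 0 - sstep 1 = 1\<close>.\<close>

lemma sstep_scaled_integral:
  assumes "k > 0"
  shows "integrable lborel (\<lambda>s. - (k * sstep' (k * (s - t))) * indicator {t..t + 1 / k} s)"
    "(LINT s|lborel. - (k * sstep' (k * (s - t))) * indicator {t..t + 1 / k} s) = 1"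
proof -
  have D: "DERIV (\<lambda>s. - sstep (k * (s - t))) s :> - (k * sstep' (k * (s - t)))" for s
  proof -
    have "DERIV (\<lambda>s. k * (s - t)) s :> k" by (auto intro!: derivative_eq_intros)
    from DERIV_chain'[OF this DERIV_sstep] show ?thesis by (auto intro!: derivative_eq_intros)
  qed
  have nn: "0 \<le> - (k * sstep' (k * (s - t)))" for s
    using sstep'_bounds(2)[of "k * (s - t)"] assms by (simp add: mult_nonneg_nonpos)
  have m: "(\<lambda>s. - (k * sstep' (k * (s - t)))) \<in> borel_measurable borel"
    by (intro borel_measurable_continuous_onI continuous_intros)
  show "integrable lborel (\<lambda>s. - (k * sstep' (k * (s - t))) * indicator {t..t + 1 / k} s)"
    by (rule integrable_FTC_Icc_nonneg[OF m D nn]) (use assms in auto)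
  have "(LINT s|lborel. - (k * sstep' (k * (s - t))) * indicator {t..t + 1 / k} s)
    = - sstep (k * (t + 1 / k - t)) - - sstep (k * (t - t))"
    by (rule integral_FTC_Icc_nonneg[OF m D nn]) (use assms in auto)
  then show "(LINT s|lborel. - (k * sstep' (k * (s - t))) * indicator {t..t + 1 / k} s) = 1"
    using assms by simp
qed

context vp_solution
begin

lemma continuous_integral_param:
  assumes cont: "continuous_on UNIV \<Phi>" and R: "\<And>s z. s \<in> {0..S} \<Longrightarrow> R < norm z \<Longrightarrow> \<Phi> (s, z) = (0::real)"
  shows "continuous_on {0..S} (\<lambda>s. LINT z|f s. \<Phi> (s, z))"
  unfolding continuous_on_iff
proof (intro ballI allI impI)
  fix t e :: real assume t: "t \<in> {0..S}" and e: "e > 0"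
  have slice: "continuous_on UNIV (\<lambda>z. \<Phi> (s, z))" for s
    by (rule continuous_on_compose2[OF cont]) (auto intro!: continuous_intros)
  have cs: "compactly_supported (\<lambda>z. \<Phi> (s, z))" if "s \<in> {0..S}" for s
    using slice R[OF that] by (auto simp: compactly_supported_def)
  have int: "integrable (f s) (\<lambda>z. \<Phi> (s', z))" if "s \<in> {0..S}" "s' \<in> {0..S}" for s s'
    using compactly_supported_bounded[OF cs[OF that(2)]] integrable_bounded[OF that(1) borel_measurable_continuous_onI[OF slice]] by metis
  define e' where "e' = e / (2 * (M + 1))"
  have e': "e' > 0" "e' * M \<le> e / 2"
    using e M_nonneg by (auto simp: e'_def divide_simps mult_left_mono)
  have "uniformly_continuous_on ({0..S} \<times> cball 0 R) \<Phi>"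
    by (intro compact_uniformly_continuous continuous_on_subset[OF cont] compact_Times) auto
  then obtain d1 where d1: "d1 > 0" "\<And>x x'. x \<in> {0..S} \<times> cball 0 R \<Longrightarrow> x' \<in> {0..S} \<times> cball 0 R \<Longrightarrow> dist x' x < d1 \<Longrightarrow> dist (\<Phi> x') (\<Phi> x) < e'"
    using e'(1) unfolding uniformly_continuous_on_def by metis
  have "continuous_on {0..S} (\<lambda>s. LINT z|f s. \<Phi> (t, z))"
    by (rule continuous_integral[OF compactly_supported_C0[OF cs[OF t]]])
  then obtain d2 where d2: "d2 > 0" "\<And>s. s \<in> {0..S} \<Longrightarrow> dist s t < d2 \<Longrightarrow> dist (LINT z|f s. \<Phi> (t, z)) (LINT z|f t. \<Phi> (t, z)) < e / 2"
    using t e unfolding continuous_on_iff by (meson half_gt_zero)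
  show "\<exists>d>0. \<forall>s\<in>{0..S}. dist s t < d \<longrightarrow> dist (LINT z|f s. \<Phi> (s, z)) (LINT z|f t. \<Phi> (t, z)) < e"
  proof (intro exI[of _ "min d1 d2"] conjI ballI impI)
    fix s assume s: "s \<in> {0..S}" "dist s t < min d1 d2"
    have "\<bar>\<Phi> (s, z) - \<Phi> (t, z)\<bar> \<le> e'" for z
    proof (cases "R < norm z")
      case False
      then show ?thesis
        using d1(2)[of "(t, z)" "(s, z)"] s t by (simp add: dist_Pair_Pair dist_real_def)
    qed (use R s t e' in auto)
    then have "\<bar>LINT z|f s. \<Phi> (s, z) - \<Phi> (t, z)\<bar> \<le> e' * M"
      by (rule abs_integral_le[OF s(1)])
    then have "\<bar>(LINT z|f s. \<Phi> (s, z)) - (LINT z|f s. \<Phi> (t, z))\<bar> \<le> e / 2"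
      using e'(2) int s t by simp
    moreover have "\<bar>(LINT z|f s. \<Phi> (t, z)) - (LINT z|f t. \<Phi> (t, z))\<bar> < e / 2"
      using d2(2)[OF s(1)] s(2) by (simp add: dist_real_def)
    ultimately show "dist (LINT z|f s. \<Phi> (s, z)) (LINT z|f t. \<Phi> (t, z)) < e"
      unfolding dist_real_def by linarith
  qed (use d1 d2 in auto)
qed

text \<open>A derivative is known to vanish only where the function vanishes on a neighbourhood. The
  support hypothesis therefore starts at \<open>- 1\<close>, which makes \<open>- 1 < s < S\<close>
  an open set around the times in \<open>[0, S[\<close>.\<close>

lemma rate_bounded:
  assumes \<Phi>: "C1 \<Phi> D" and R: "\<And>s z. s \<in> {-1..S} \<Longrightarrow> R < norm z \<Longrightarrow> \<Phi> (s, z) = 0"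
  obtains K where "K \<ge> 0" "\<And>s z. s \<in> {0..<S} \<Longrightarrow> \<bar>D (s, z) (1, snd z, force s (fst z))\<bar> \<le> K"
proof -
  have D0: "D (s, z) v = 0" if "s \<in> {0..<S}" "R < norm z" for s z v
  proof (rule C1_support[OF \<Phi>, of "\<lambda>y. - 1 < fst y \<and> fst y < S \<and> R < norm (snd y)"])
    show "open {y :: real \<times> R3 \<times> R3. - 1 < fst y \<and> fst y < S \<and> R < norm (snd y)}"
      by (intro open_Collect_conj open_Collect_less continuous_intros)
  qed (use R that in auto)
  have "compact ({0..S} \<times> cball 0 R :: (real \<times> R3 \<times> R3) set)" by (intro compact_Times) auto
  from C1_bounded_on_compact[OF \<Phi> this] obtain B where B: "B > 0"
    "\<And>z v. z \<in> {0..S} \<times> cball 0 R \<Longrightarrow> \<bar>D z v\<bar> \<le> B * norm v" by metis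
  have "\<bar>D (s, z) (1, snd z, force s (fst z))\<bar> \<le> B * (1 + \<bar>R\<bar> + Cb)" if s: "s \<in> {0..<S}" for s z
  proof (cases "R < norm z")
    case True
    then show ?thesis using D0[OF s] B Cb_nonneg by simp
  next
    case False
    have "norm (snd z) \<le> \<bar>R\<bar>" using False norm_snd_le[of "snd z" "fst z"] by auto
    then have "norm (1::real, snd z, force s (fst z)) \<le> 1 + \<bar>R\<bar> + Cb"
      using norm_force_le[of s "fst z"] s by (intro order_trans[OF norm_triple_le]) simp
    moreover have "(s, z) \<in> {0..S} \<times> cball 0 R" using False s by simp
    ultimately show ?thesis
      using B by (meson less_imp_le mult_left_mono order_trans)
  qed
  moreover have "0 \<le> B * (1 + \<bar>R\<bar> + Cb)" using B Cb_nonneg by simp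
  ultimately show ?thesis using that by blast
qed

text \<open>Test with \<open>\<theta> n s * \<Phi>\<close>, where \<open>\<theta> n\<close> drops
  from 1 to 0 on \<open>[t, t + 1 / k n]\<close>. Its derivative tends to minus a point mass at
  \<open>t\<close>, and continuity of \<open>m\<close> turns that term into \<open>- m t\<close>;
  the remaining term converges by domination.\<close>

lemma transport_identity_0:
  assumes t: "0 \<le> t" "t < S" and \<Phi>: "C1 \<Phi> D"
    and R: "\<And>s z. s \<in> {-1..S} \<Longrightarrow> R < norm z \<Longrightarrow> \<Phi> (s, z) = 0"
  shows "(LINT z|f t. \<Phi> (t, z)) = (LINT z|f0. \<Phi> (0, z)) + (LINT s|lborel. indicator {0..t} s * rate D s)"
proof -
  define m where "m s = (LINT z|f s. \<Phi> (s, z))" for s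
  have m_cont: "continuous_on {0..S} m"
    unfolding m_def by (rule continuous_integral_param[OF C1D(4)[OF \<Phi>], of R]) (use R in auto)
  obtain K where K: "K \<ge> 0" "\<And>s z. s \<in> {0..<S} \<Longrightarrow> \<bar>D (s, z) (1, snd z, force s (fst z))\<bar> \<le> K"
    using rate_bounded[OF \<Phi> R] by blast
  obtain N where N: "1 / real (Suc N) < S - t"
    using t by (elim nat_approx_posE[of "S - t", rotated]) simp
  define k where "k n = real (Suc (n + N))" for n
  have k: "k n > 0" "1 / k n < S - t" for n
  proof -
    have "1 / real (Suc (n + N)) \<le> 1 / real (Suc N)" by (simp add: frac_le)
    with N show "k n > 0" "1 / k n < S - t" by (auto simp: k_def)
  qed
  have k_lim: "(\<lambda>n. 1 / k n) \<longlonglongrightarrow> 0"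
    unfolding k_def by (rule LIMSEQ_ignore_initial_segment[OF LIMSEQ_Suc[OF lim_1_over_n]])
  \<comment> \<open>The factor \<open>sstep (- s)\<close> is 1 for \<open>s \<ge> 0\<close> and 0
    for \<open>s \<le> - 1\<close>. It bounds the support in negative times without touching those
    over which the formulation integrates.\<close>
  define \<theta> where "\<theta> n s = sstep (k n * (s - t)) * sstep (- s)" for n s
  define \<theta>' where "\<theta>' n s = k n * sstep' (k n * (s - t)) * sstep (- s) - sstep (k n * (s - t)) * sstep' (- s)" for n s
  have \<theta>_der: "DERIV (\<theta> n) s :> \<theta>' n s" for n s
  proof -
    have "DERIV (\<lambda>s. k n * (s - t)) s :> k n" "DERIV (\<lambda>s. - s) s :> - 1" by (auto intro!: derivative_eq_intros)
    then have "DERIV (\<lambda>s. sstep (k n * (s - t))) s :> sstep' (k n * (s - t)) * k n" "DERIV (\<lambda>s. sstep (- s)) s :> sstep' (- s) * - 1"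
      using DERIV_chain'[OF _ DERIV_sstep] by (fastforce simp: mult.commute)+
    from DERIV_mult[OF this] show ?thesis
      by (simp add: \<theta>_def[abs_def] \<theta>'_def algebra_simps)
  qed
  have \<theta>_supp: "- 1 < s" "s < S" if "\<theta> n s \<noteq> 0" for n s
  proof -
    show "- 1 < s" using that by (cases "s \<le> - 1") (auto simp: \<theta>_def)
    have "k n * (s - t) < 1" using that by (cases "1 \<le> k n * (s - t)") (auto simp: \<theta>_def)
    then have "s - t < 1 / k n" using k[of n] by (simp add: pos_less_divide_eq mult.commute)
    then show "s < S" using k[of n] by simp
  qed
  have \<theta>_bd: "0 \<le> \<theta> n s" "\<theta> n s \<le> 1" for n s
    using sstep_bounds by (auto simp: \<theta>_def mult_le_one)
  define \<Psi> where "\<Psi> n z = \<theta> n (fst z) * \<Phi> z" for n z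
  define E where "E n z v = \<theta>' n (fst z) * fst v * \<Phi> z + \<theta> n (fst z) * D z v" for n z v
  have C1\<Psi>: "C1 (\<Psi> n) (E n)" for n
    unfolding C1_def
  proof (intro conjI allI)
    fix z :: "real \<times> R3 \<times> R3"
    have "((\<lambda>z. \<theta> n (fst z)) has_derivative (\<lambda>v. \<theta>' n (fst z) * fst v)) (at z)"
      by (rule has_derivative_compose[OF has_derivative_fst[OF has_derivative_ident]
            \<theta>_der[unfolded has_field_derivative_def]])
    from has_derivative_mult[OF this C1D(1)[OF \<Phi>]]
    show "(\<Psi> n has_derivative E n z) (at z)"
      by (simp add: \<Psi>_def[abs_def] E_def[abs_def] algebra_simps)
    have "continuous_on UNIV (\<theta> n)" "continuous_on UNIV (\<theta>' n)"
      unfolding \<theta>_def[abs_def] \<theta>'_def[abs_def] by (intro continuous_intros)+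
    then have "continuous_on UNIV (\<lambda>z::real \<times> R3 \<times> R3. \<theta> n (fst z))" "continuous_on UNIV (\<lambda>z::real \<times> R3 \<times> R3. \<theta>' n (fst z))"
      by (auto intro!: continuous_on_compose2[where f = fst] continuous_intros)
    then show "continuous_on UNIV (\<lambda>z. E n z v)" for v
      unfolding E_def by (intro continuous_intros C1D(4)[OF \<Phi>] C1D(2)[OF \<Phi>])
  qed
  have ge1: "1 \<le> k n * (s - t)" if "t + 1 / k n < s" for n s
  proof -
    have "1 / k n < s - t" using that by simp
    then show ?thesis using k(1)[of n] by (simp add: pos_divide_less_eq mult.commute)
  qed
  have \<Psi>_supp: "\<Psi> n z = 0" if "\<bar>R\<bar> + S + 1 < norm z" for n z
  proof (rule ccontr)
    assume "\<Psi> n z \<noteq> 0"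
    then have nz: "\<theta> n (fst z) \<noteq> 0" "\<Phi> (fst z, snd z) \<noteq> 0" by (auto simp: \<Psi>_def)
    from \<theta>_supp[OF nz(1)] have fs: "fst z \<in> {-1..S}" "\<bar>fst z\<bar> \<le> S + 1" using S by auto
    have "norm z \<le> \<bar>fst z\<bar> + norm (snd z)" using norm_Pair_le[of "fst z" "snd z"] by simp
    with that fs have "R < norm (snd z)" by linarith
    from R[OF fs(1) this] nz(2) show False by simp
  qed
  have weak_n: "(LINT s|lborel. indicator {0..<T} s * rate (E n) s) = - (LINT z|f0. \<Phi> (0, z))" for n
  proof -
    have "(LINT s:{0..<T}|lborel. rate (E n) s) = - (LINT z|f0. \<Psi> n (0, z))"
    proof (rule weak_form_C1[OF C1\<Psi> \<Psi>_supp])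
      show "t + 1 / k n < S" using k[of n] by simp
      show "\<Psi> n z = 0" if "t + 1 / k n < fst z" for z
      proof -
        have "1 \<le> k n * (fst z - t)" by (rule ge1[OF that])
        then show ?thesis by (simp add: \<Psi>_def \<theta>_def)
      qed
    qed
    moreover have "\<theta> n 0 = 1" using t k(1)[of n] by (simp add: \<theta>_def)
    ultimately show ?thesis by (simp add: set_lebesgue_integral_def \<Psi>_def)
  qed
  have \<theta>'_nn: "\<theta>' n s = k n * sstep' (k n * (s - t))" if "0 \<le> s" for n s
    using that by (simp add: \<theta>'_def)
  have rate_E: "indicator {0..<T} s * rate (E n) s
      = k n * sstep' (k n * (s - t)) * indicator {t..t + 1 / k n} s * m s + indicator {0..<S} s * \<theta> n s * rate D s" for n s
  proof -
    consider "s < 0" | "S \<le> s" | "0 \<le> s" "s < S" by linarith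
    then show ?thesis
    proof cases
      case 1
      then show ?thesis using t by simp
    next
      case 2
      then have s: "t + 1 / k n < s" using k[of n] by simp
      then have "1 \<le> k n * (s - t)" by (rule ge1)
      then have "\<theta>' n s = 0" "\<theta> n s = 0" by (simp_all add: \<theta>'_def \<theta>_def)
      then have "rate (E n) s = 0" by (simp add: rate_def E_def)
      with s 2 show ?thesis by simp
    next
      case 3
      then have s: "s \<in> {0..S}" "s \<in> {0..<S}" by auto
      have slice: "continuous_on UNIV (\<lambda>z. \<Phi> (s, z))"
        by (rule continuous_on_compose2[OF C1D(4)[OF \<Phi>]]) (auto intro!: continuous_intros)
      then have "compactly_supported (\<lambda>z. \<Phi> (s, z))"
        using R[of s] 3 by (auto simp: compactly_supported_def)
      then obtain B where "\<And>z. norm (\<Phi> (s, z)) \<le> B" by (metis compactly_supported_bounded)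
      then have int1: "integrable (f s) (\<lambda>z. \<Phi> (s, z))"
        by (rule integrable_bounded[OF s(1) borel_measurable_continuous_onI[OF slice]])
      interpret finite_measure "f s" using finite_f[OF s(1)] .
      have int2: "integrable (f s) (\<lambda>z. D (s, z) (1, snd z, force s (fst z)))"
        by (rule integrable_const_bound[where B = K]) (use K(2)[OF s(2)] rate_integrand_measurable[OF \<Phi> s(1)] in auto)
      have "rate (E n) s = \<theta>' n s * m s + \<theta> n s * rate D s"
        using int1 int2 by (simp add: rate_def E_def m_def)
      moreover have "\<theta>' n s = k n * sstep' (k n * (s - t)) * indicator {t..t + 1 / k n} s"
      proof (cases "s \<in> {t..t + 1 / k n}")
        case False
        then have "k n * (s - t) \<le> 0 \<or> 1 \<le> k n * (s - t)"
          using k[of n] by (auto simp: mult_le_0_iff field_simps not_le)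
        then show ?thesis using False \<theta>'_nn[OF 3(1), of n] by auto
      qed (simp add: \<theta>'_nn[OF 3(1)])
      ultimately show ?thesis using 3 S by simp
    qed
  qed
  have rD: "(\<lambda>s. indicator {0..S} s * rate D s) \<in> borel_measurable lborel"
    using rate_measurable[OF \<Phi>] by (subst (asm) borel_measurable_restrict_space_iff) auto
  have \<theta>_meas: "\<theta> n \<in> borel_measurable borel" for n
    unfolding \<theta>_def[abs_def] by (intro borel_measurable_continuous_onI continuous_intros)
  have rDb: "\<bar>rate D s\<bar> \<le> K * M" if "s \<in> {0..<S}" for s
    unfolding rate_def by (rule abs_integral_le) (use that K in auto)
  have meas2: "(\<lambda>s. indicator {0..<S} s * \<theta> n s * rate D s) \<in> borel_measurable lborel" for n
  proof -
    have "(\<lambda>s. indicator {0..<S} s * \<theta> n s * rate D s) = (\<lambda>s. (indicator {0..<S} s * \<theta> n s) * (indicator {0..S} s * rate D s))"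
      by (auto simp: indicator_def)
    then show ?thesis using rD \<theta>_meas by simp
  qed
  have intw: "integrable lborel (\<lambda>s. K * M * indicator {0..S} s)"
    using S by (intro integrable_mult_right integrable_real_indicator) auto
  have bd2: "norm (indicator {0..<S} s * \<theta> n s * rate D s) \<le> K * M * indicator {0..S} s" for n s
    using rDb[of s] \<theta>_bd[of n s] K(1) M_nonneg mult_mono[of "\<theta> n s" 1 "\<bar>rate D s\<bar>" "K * M"]
    by (auto simp: indicator_def abs_mult)
  have lim2: "(\<lambda>n. LINT s|lborel. indicator {0..<S} s * \<theta> n s * rate D s) \<longlonglongrightarrow> (LINT s|lborel. indicator {0..t} s * rate D s)"
  proof (rule integral_dominated_convergence[OF _ meas2 intw])
    have "(\<lambda>s. indicator {0..t} s * rate D s) = (\<lambda>s. indicator {0..t} s * (indicator {0..S} s * rate D s))"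
      using t by (auto simp: indicator_def)
    then show "(\<lambda>s. indicator {0..t} s * rate D s) \<in> borel_measurable lborel" using rD by simp
    show "AE s in lborel. (\<lambda>n. indicator {0..<S} s * \<theta> n s * rate D s) \<longlonglongrightarrow> indicator {0..t} s * rate D s"
    proof (intro AE_I2)
      fix s :: real
      consider "s < 0" | "0 \<le> s" "s \<le> t" | "t < s" by linarith
      then show "(\<lambda>n. indicator {0..<S} s * \<theta> n s * rate D s) \<longlonglongrightarrow> indicator {0..t} s * rate D s"
      proof cases
        case 2
        then have "\<theta> n s = 1" for n using k(1)[of n] by (simp add: \<theta>_def mult_nonneg_nonpos)
        with 2 t show ?thesis by simp
      next
        case 3
        have "\<forall>\<^sub>F n in sequentially. 1 / k n < s - t"
          by (rule order_tendstoD(2)[OF k_lim]) (use 3 in simp)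
        then have "\<forall>\<^sub>F n in sequentially. \<theta> n s = 0"
        proof eventually_elim
          case (elim n)
          then have "1 \<le> k n * (s - t)" using k(1)[of n] by (simp add: pos_divide_less_eq mult.commute)
          then show ?case by (simp add: \<theta>_def)
        qed
        then have "\<forall>\<^sub>F n in sequentially. indicator {0..<S} s * \<theta> n s * rate D s = indicator {0..t} s * rate D s"
          by eventually_elim (use 3 in simp)
        then show ?thesis by (rule tendsto_eventually)
      qed simp
    qed
    show "AE s in lborel. norm (indicator {0..<S} s * \<theta> n s * rate D s) \<le> K * M * indicator {0..S} s" for n
      using bd2 by auto
  qed
  have int2: "integrable lborel (\<lambda>s. indicator {0..<S} s * \<theta> n s * rate D s)" for n
    by (rule Bochner_Integration.integrable_bound[OF intw meas2 AE_I2])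
      (rule order_trans[OF bd2], unfold real_norm_def, rule abs_ge_self)
  have int1: "integrable lborel (\<lambda>s. k n * sstep' (k n * (s - t)) * indicator {t..t + 1 / k n} s * m s)" for n
  proof -
    have "continuous_on {t..t + 1 / k n} m"
      by (rule continuous_on_subset[OF m_cont]) (use t k[of n] in auto)
    then have "continuous_on {t..t + 1 / k n} (\<lambda>s. k n * sstep' (k n * (s - t)) * m s)"
      by (intro continuous_intros)
    from borel_integrable_compact[OF _ this] have "integrable lborel (\<lambda>s. indicator {t..t + 1 / k n} s *\<^sub>R (k n * sstep' (k n * (s - t)) * m s))"
      by simp
    then show ?thesis by (simp add: mult_ac)
  qed
  \<comment> \<open>The weight \<open>?w\<close> is nonnegative with integral 1, so the distance to
    \<open>- m t\<close> is an average of \<open>m t - m s\<close> over an interval shrinking to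
    \<open>t\<close>.\<close>
  have lim1: "(\<lambda>n. LINT s|lborel. k n * sstep' (k n * (s - t)) * indicator {t..t + 1 / k n} s * m s) \<longlonglongrightarrow> - m t"
  proof (rule LIMSEQ_I)
    fix r :: real assume "r > 0"
    then obtain d where d: "d > 0" "\<And>s. s \<in> {0..S} \<Longrightarrow> dist s t < d \<Longrightarrow> dist (m s) (m t) < r / 2"
      using m_cont t unfolding continuous_on_iff by (metis atLeastAtMost_iff half_gt_zero less_imp_le)
    have "\<forall>\<^sub>F n in sequentially. 1 / k n < d" by (rule order_tendstoD(2)[OF k_lim d(1)])
    then obtain n0 where n0: "\<And>n. n \<ge> n0 \<Longrightarrow> 1 / k n < d" by (auto simp: eventually_sequentially)
    have "norm ((LINT s|lborel. k n * sstep' (k n * (s - t)) * indicator {t..t + 1 / k n} s * m s) - - m t) < r" if "n \<ge> n0" for n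
    proof -
      let ?w = "\<lambda>s. - (k n * sstep' (k n * (s - t))) * indicator {t..t + 1 / k n} s"
      note w = sstep_scaled_integral[OF k(1)[of n], of t]
      have "(LINT s|lborel. k n * sstep' (k n * (s - t)) * indicator {t..t + 1 / k n} s * m s) - - m t
        = (LINT s|lborel. k n * sstep' (k n * (s - t)) * indicator {t..t + 1 / k n} s * m s) + (LINT s|lborel. ?w s) * m t"
        using w(2) by simp
      also have "\<dots> = (LINT s|lborel. k n * sstep' (k n * (s - t)) * indicator {t..t + 1 / k n} s * m s + ?w s * m t)"
        using int1[of n] w(1) by (subst Bochner_Integration.integral_add) auto
      also have "\<dots> = (LINT s|lborel. ?w s * (m t - m s))"
        by (simp add: algebra_simps)
      finally have eq: "(LINT s|lborel. k n * sstep' (k n * (s - t)) * indicator {t..t + 1 / k n} s * m s) - - m t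
        = (LINT s|lborel. ?w s * (m t - m s))" .
      have "\<bar>LINT s|lborel. ?w s * (m t - m s)\<bar> \<le> (LINT s|lborel. ?w s * (r / 2))"
      proof (rule order_trans[OF integral_abs_bound integral_mono'])
        show "integrable lborel (\<lambda>s. ?w s * (r / 2))" using w(1) by (rule integrable_mult_left)
        fix s
        have "0 \<le> ?w s"
          using sstep'_bounds(2)[of "k n * (s - t)"] k(1)[of n] by (simp add: indicator_def mult_nonneg_nonpos)
        then show "0 \<le> ?w s * (r / 2)" by (rule mult_nonneg_nonneg) (use \<open>r > 0\<close> in simp)
        show "\<bar>?w s * (m t - m s)\<bar> \<le> ?w s * (r / 2)"
        proof (cases "s \<in> {t..t + 1 / k n}")
          case True
          have "\<bar>?w s * (m t - m s)\<bar> = ?w s * \<bar>m t - m s\<bar>"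
            by (subst abs_mult) (simp only: abs_of_nonneg[OF \<open>0 \<le> ?w s\<close>])
          also have "\<dots> \<le> ?w s * (r / 2)"
            using True d(2)[of s] n0[OF \<open>n \<ge> n0\<close>] t k[of n] \<open>0 \<le> ?w s\<close>
            by (intro mult_left_mono) (auto simp: dist_real_def abs_minus_commute[of "m t"])
          finally show ?thesis .
        qed simp
      qed
      then have "\<bar>LINT s|lborel. ?w s * (m t - m s)\<bar> \<le> r / 2" using w(2) by simp
      then show ?thesis unfolding eq real_norm_def using \<open>r > 0\<close> by linarith
    qed
    then show "\<exists>no. \<forall>n\<ge>no. norm ((LINT s|lborel. k n * sstep' (k n * (s - t)) * indicator {t..t + 1 / k n} s * m s) - - m t) < r"
      by blast
  qed
  have "(\<lambda>n. LINT s|lborel. indicator {0..<T} s * rate (E n) s) \<longlonglongrightarrow> - m t + (LINT s|lborel. indicator {0..t} s * rate D s)"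
    unfolding rate_E using tendsto_add[OF lim1 lim2] int1 int2 by simp
  then have "- m t + (LINT s|lborel. indicator {0..t} s * rate D s) = - (LINT z|f0. \<Phi> (0, z))"
    unfolding weak_n by (simp add: LIMSEQ_const_iff)
  then show ?thesis by (simp add: m_def)
qed

end

section \<open>Phase-space cutoffs and tails of the mass\<close>

definition cutoff :: "real \<Rightarrow> 'a::euclidean_space \<Rightarrow> real" where
  "cutoff R z = sstep ((z \<bullet> z) / R\<^sup>2 - 1)"

definition cutoff_deriv :: "real \<Rightarrow> 'a::euclidean_space \<Rightarrow> 'a \<Rightarrow> real" where
  "cutoff_deriv R z v = sstep' ((z \<bullet> z) / R\<^sup>2 - 1) * (2 * (z \<bullet> v) / R\<^sup>2)"

text \<open>The squared norm in the definition, in place of the norm, avoids a singularity at the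
  origin. For \<open>R > 0\<close> the transition then ends at radius \<open>sqrt 2 * R\<close>; the
  estimates use the rounder radius \<open>2 * R\<close>.\<close>

lemma cutoff_C1: "C1 (cutoff R) (cutoff_deriv R)"
  unfolding C1_def
proof (intro conjI allI)
  fix z v :: 'a
  have "((\<lambda>z. (z \<bullet> z) / R\<^sup>2 - 1) has_derivative (\<lambda>v. 2 * (z \<bullet> v) / R\<^sup>2)) (at z)"
    unfolding divide_inverse by (auto intro!: derivative_eq_intros simp: inner_commute)
  from has_derivative_compose[OF this DERIV_sstep[unfolded has_field_derivative_def]]
  show "(cutoff R has_derivative cutoff_deriv R z) (at z)"
    by (simp add: cutoff_def[abs_def] cutoff_deriv_def[abs_def])
  show "continuous_on UNIV (\<lambda>z. cutoff_deriv R z v)"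
    unfolding cutoff_deriv_def divide_inverse by (intro continuous_intros)
qed

lemma cutoff_bounds: "0 \<le> cutoff R z" "cutoff R z \<le> 1"
  using sstep_bounds by (auto simp: cutoff_def)

lemma cutoff_eq_0:
  assumes "0 < R" "2 * R < norm z"
  shows "cutoff R z = 0"
proof -
  have "(2 * R)\<^sup>2 \<le> (norm z)\<^sup>2" using assms by (intro power_mono) auto
  then have "2 * R\<^sup>2 \<le> z \<bullet> z" by (simp add: power2_norm_eq_inner power_mult_distrib) (use zero_le_power2[of R] in linarith)
  then have "2 \<le> (z \<bullet> z) / R\<^sup>2" using assms by (simp add: pos_le_divide_eq)
  then show ?thesis by (simp add: cutoff_def)
qed

lemma cutoff_eq_1:
  assumes "norm z \<le> R"
  shows "cutoff R z = 1"
proof -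
  have "z \<bullet> z \<le> R\<^sup>2" using assms by (metis norm_ge_zero power2_norm_eq_inner power_mono)
  then have "(z \<bullet> z) / R\<^sup>2 \<le> 1" by (cases "R = 0") (auto simp: pos_divide_le_eq)
  then show ?thesis by (simp add: cutoff_def)
qed

text \<open>The 8 is \<open>2 * 4\<close>: \<open>sstep'\<close> is at most 2 in absolute value, and
  \<open>2 * (z \<bullet> v) / R^2\<close> is at most \<open>4 * norm v / R\<close> inside radius
  \<open>2 * R\<close>.\<close>

lemma cutoff_deriv_le:
  assumes "8 \<le> R"
  shows "\<bar>cutoff_deriv R z v\<bar> \<le> norm v"
proof (cases "2 * R \<le> norm z")
  case True
  have "(2 * R)\<^sup>2 \<le> (norm z)\<^sup>2" using assms True by (intro power_mono) auto
  then have "2 * R\<^sup>2 \<le> z \<bullet> z" by (simp add: power2_norm_eq_inner power_mult_distrib) (use zero_le_power2[of R] in linarith)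
  then have "2 \<le> (z \<bullet> z) / R\<^sup>2" using assms by (simp add: pos_le_divide_eq)
  then show ?thesis by (simp add: cutoff_deriv_def)
next
  case False
  have "\<bar>z \<bullet> v\<bar> \<le> norm z * norm v" by (rule Cauchy_Schwarz_ineq2)
  also have "\<dots> \<le> 2 * R * norm v" using False by (intro mult_right_mono) auto
  finally have "\<bar>2 * (z \<bullet> v) / R\<^sup>2\<bar> \<le> 2 * (2 * R * norm v) / R\<^sup>2"
    by (simp add: abs_mult divide_right_mono)
  also have "\<dots> = 4 * norm v / R" using assms by (simp add: power2_eq_square)
  finally have "\<bar>cutoff_deriv R z v\<bar> \<le> 2 * (4 * norm v / R)"
    unfolding cutoff_deriv_def abs_mult using sstep'_bounds[of "(z \<bullet> z) / R\<^sup>2 - 1"]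
    by (intro mult_mono) auto
  also have "\<dots> \<le> norm v"
    using assms mult_right_mono[OF assms norm_ge_zero[of v]] by (simp add: pos_divide_le_eq mult.commute)
  finally show ?thesis .
qed

lemma C1_mult:
  assumes "C1 f f'" "C1 g g'"
  shows "C1 (\<lambda>z. f z * g z) (\<lambda>z v. f z * g' z v + f' z v * g z)"
  unfolding C1_def
  by (intro conjI allI has_derivative_mult continuous_intros C1D[OF assms(1)] C1D[OF assms(2)])

lemma integrable_const_Icc: "integrable lborel (\<lambda>s::real. k * indicator {a..b} s :: real)"
  by (cases "a \<le> b") (auto intro!: integrable_mult_right integrable_real_indicator)

context vp_solution
begin

lemma rate_integrable:
  assumes ab: "0 \<le> a" "b < S" and \<Phi>: "C1 \<Phi> D"
    and R: "\<And>s z. s \<in> {-1..S} \<Longrightarrow> R < norm z \<Longrightarrow> \<Phi> (s, z) = 0" and X: "X \<in> sets borel" "X \<subseteq> {a..b}"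
  shows "integrable lborel (\<lambda>s. indicator X s * rate D s)"
proof -
  obtain K where K: "K \<ge> 0" "\<And>s z. s \<in> {0..<S} \<Longrightarrow> \<bar>D (s, z) (1, snd z, force s (fst z))\<bar> \<le> K"
    using rate_bounded[OF \<Phi> R] by blast
  have rDb: "\<bar>rate D s\<bar> \<le> K * M" if "s \<in> {0..<S}" for s
    unfolding rate_def by (rule abs_integral_le) (use that K in auto)
  have rD: "(\<lambda>s. indicator {0..S} s * rate D s) \<in> borel_measurable lborel"
    using rate_measurable[OF \<Phi>] by (subst (asm) borel_measurable_restrict_space_iff) auto
  have eq: "(\<lambda>s. indicator X s * rate D s) = (\<lambda>s. indicator X s * (indicator {0..S} s * rate D s))"
    using X ab by (auto simp: indicator_def fun_eq_iff)
  show ?thesis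
  proof (rule Bochner_Integration.integrable_bound)
    show "integrable lborel (\<lambda>s. K * M * indicator {a..b} s)"
      by (rule integrable_const_Icc)
    show "(\<lambda>s. indicator X s * rate D s) \<in> borel_measurable lborel"
      unfolding eq using rD X(1) by simp
    show "AE s in lborel. norm (indicator X s * rate D s) \<le> norm (K * M * indicator {a..b} s)"
    proof (rule AE_I2)
      fix s
      show "norm (indicator X s * rate D s) \<le> norm (K * M * indicator {a..b} s)"
      proof (cases "s \<in> X")
        case True
        then have "s \<in> {a..b}" "s \<in> {0..<S}" using X ab by auto
        then show ?thesis using rDb[of s] K(1) M_nonneg True by simp
      qed simp
    qed
  qed
qed

lemma transport_identity:
  assumes ab: "0 \<le> a" "a \<le> b" "b < S" and \<Phi>: "C1 \<Phi> D"
    and R: "\<And>s z. s \<in> {-1..S} \<Longrightarrow> R < norm z \<Longrightarrow> \<Phi> (s, z) = 0"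
  shows "(LINT z|f b. \<Phi> (b, z)) = (LINT z|f a. \<Phi> (a, z)) + (LINT s|lborel. indicator {a<..b} s * rate D s)"
proof -
  have ints: "integrable lborel (\<lambda>s. indicator {0..a} s * rate D s)" "integrable lborel (\<lambda>s. indicator {a<..b} s * rate D s)"
    by (rule rate_integrable[OF order_refl ab(3) \<Phi> R]; use ab in auto)+
  have "(LINT s|lborel. indicator {0..b} s * rate D s) = (LINT s|lborel. indicator {0..a} s * rate D s + indicator {a<..b} s * rate D s)"
    using ab by (intro Bochner_Integration.integral_cong) (auto simp: indicator_def)
  also have "\<dots> = (LINT s|lborel. indicator {0..a} s * rate D s) + (LINT s|lborel. indicator {a<..b} s * rate D s)"
    using ints by simp
  finally show ?thesis
    using transport_identity_0[OF _ ab(3) \<Phi> R] transport_identity_0[OF ab(1) _ \<Phi> R] ab by simp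
qed

text \<open>The transport identity for a test function that does not depend on time. On its support
  velocities are at most \<open>R\<close> and forces at most \<open>Cb\<close>; it is this use of a
  velocity bound that requires a source to be cut off before it is compared at two times.\<close>

lemma time_lipschitz:
  assumes ab: "0 \<le> a" "a \<le> b" "b < S" and \<phi>: "C1 \<phi> D" "\<And>z v. \<bar>D z v\<bar> \<le> L * norm v" "0 \<le> L"
    and R: "\<And>z. R < norm z \<Longrightarrow> \<phi> z = 0" "0 \<le> R"
  shows "\<bar>(LINT z|f b. \<phi> z) - (LINT z|f a. \<phi> z)\<bar> \<le> (b - a) * (L * (R + Cb) * M)"
proof -
  define \<Phi> where "\<Phi> = (\<lambda>y :: real \<times> R3 \<times> R3. \<phi> (snd y))"
  define E where "E = (\<lambda>(y :: real \<times> R3 \<times> R3) (v :: real \<times> R3 \<times> R3). D (snd y) (snd v))"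
  have \<Phi>: "C1 \<Phi> E"
    unfolding C1_def
  proof (intro conjI allI)
    fix z v :: "real \<times> R3 \<times> R3"
    show "(\<Phi> has_derivative E z) (at z)"
      unfolding \<Phi>_def E_def by (rule has_derivative_compose[OF has_derivative_snd[OF has_derivative_ident] C1D(1)[OF \<phi>(1)]])
    show "continuous_on UNIV (\<lambda>z. E z v)"
      unfolding E_def by (rule continuous_on_compose2[OF C1D(2)[OF \<phi>(1)]]) (auto intro!: continuous_intros)
  qed
  have R': "\<Phi> (s, z) = 0" if "R < norm z" for s z using R(1)[OF that] by (simp add: \<Phi>_def)
  have D0: "D z v = 0" if "R < norm z" for z v
    by (rule C1_support[OF \<phi>(1), of "\<lambda>z. R < norm z"]) (use that R in \<open>auto intro!: open_Collect_less continuous_intros\<close>)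
  have le: "\<bar>rate E s\<bar> \<le> L * (R + Cb) * M" if s: "s \<in> {0..S}" for s
    unfolding rate_def
  proof (rule abs_integral_le[OF s])
    fix z :: "R3 \<times> R3"
    show "\<bar>E (s, z) (1, snd z, force s (fst z))\<bar> \<le> L * (R + Cb)"
    proof (cases "R < norm z")
      case False
      then have "norm (snd z) \<le> R" using norm_snd_le[of "snd z" "fst z"] by simp
      then have "norm (snd z, force s (fst z)) \<le> R + Cb"
        using norm_force_le[OF s, of "fst z"] by (intro order_trans[OF norm_Pair_le]) simp
      then show ?thesis
        unfolding E_def snd_conv by (rule order_trans[OF \<phi>(2) mult_left_mono[OF _ \<phi>(3)]])
    qed (use D0 \<phi>(3) R(2) Cb_nonneg in \<open>simp add: E_def\<close>)
  qed
  have "\<bar>LINT s|lborel. indicator {a<..b} s * rate E s\<bar> \<le> (LINT s|lborel. indicator {a<..b} s * (L * (R + Cb) * M))"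
  proof (rule order_trans[OF integral_abs_bound integral_mono])
    show "integrable lborel (\<lambda>s. \<bar>indicator {a<..b} s * rate E s\<bar>)"
      by (intro integrable_abs rate_integrable[OF ab(1,3) \<Phi> R']) auto
    show "integrable lborel (\<lambda>s. indicator {a<..b} s * (L * (R + Cb) * M))"
      using ab by (intro integrable_mult_left integrable_real_indicator) auto
    show "\<bar>indicator {a<..b} s * rate E s\<bar> \<le> indicator {a<..b} s * (L * (R + Cb) * M)" for s
      using le[of s] ab by (auto simp: indicator_def)
  qed
  also have "\<dots> = (b - a) * (L * (R + Cb) * M)" using ab by simp
  finally show ?thesis
    using transport_identity[OF ab \<Phi> R'] by (simp add: \<Phi>_def)
qed

definition tail :: "real \<Rightarrow> real \<Rightarrow> real" where
  "tail R t = (LINT z|f t. 1 - cutoff R z)"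

lemma cutoff_measurable [measurable]: "cutoff R \<in> borel_measurable borel"
  by (rule borel_measurable_continuous_onI[OF C1D(4)[OF cutoff_C1]])

lemma tail_bounds:
  assumes "t \<in> {0..S}" 
  shows "0 \<le> tail R t" "tail R t \<le> M"
proof -
  show "0 \<le> tail R t" unfolding tail_def by (rule integral_nonneg_AE) (simp add: cutoff_bounds)
  have "\<bar>1 - cutoff R z\<bar> \<le> 1" for z :: "R3 \<times> R3" using cutoff_bounds[of R z] by auto
  from abs_integral_le[OF assms, of "\<lambda>z. 1 - cutoff R z", OF this] show "tail R t \<le> M" by (simp add: tail_def)
qed

lemma tail_measurable: "(\<lambda>t. indicator {0..S} t * tail R t) \<in> borel_measurable lborel"
proof -
  have "tail R \<in> borel_measurable (restrict_space borel {0..S})"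
    unfolding tail_def[abs_def] by (rule integral_measurable[where \<tau> = "\<lambda>t. t"]) simp_all
  then show ?thesis by (subst (asm) borel_measurable_restrict_space_iff) auto
qed

lemma tail_integrable:
  assumes "X \<in> sets borel" "X \<subseteq> {0..S}"
  shows "integrable lborel (\<lambda>t. indicator X t * tail R t)"
proof -
  have eq: "(\<lambda>t. indicator X t * tail R t) = (\<lambda>t. indicator X t * (indicator {0..S} t * tail R t))"
    using assms by (auto simp: indicator_def fun_eq_iff)
  show ?thesis
  proof (rule Bochner_Integration.integrable_bound)
    show "integrable lborel (\<lambda>s. M * indicator {0..S} s)"
      by (rule integrable_const_Icc)
    show "(\<lambda>t. indicator X t * tail R t) \<in> borel_measurable lborel"
      unfolding eq using tail_measurable assms(1) by simp
    show "AE s in lborel. norm (indicator X s * tail R s) \<le> norm (M * indicator {0..S} s)"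
      using tail_bounds[of _ R] assms M_nonneg by (intro AE_I2) (auto simp: indicator_def)
  qed
qed

text \<open>Dominated convergence twice: in \<open>z\<close> at a fixed time, because the measure is
  finite, and then in time, because tails are at most \<open>M\<close>.\<close>

lemma tail_integral_tendsto_0: "(\<lambda>n. LINT t|lborel. indicator {0..S} t * tail (real n) t) \<longlonglongrightarrow> 0"
proof -
  have "(\<lambda>n. LINT t|lborel. indicator {0..S} t * tail (real n) t) \<longlonglongrightarrow> (LINT t::real|lborel. (0::real))"
  proof (rule integral_dominated_convergence[where w = "\<lambda>s. M * indicator {0..S} s"])
    show "AE t in lborel. (\<lambda>n. indicator {0..S} t * tail (real n) t) \<longlonglongrightarrow> 0"
    proof (rule AE_I2)
      fix t
      show "(\<lambda>n. indicator {0..S} t * tail (real n) t) \<longlonglongrightarrow> 0"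
      proof (cases "t \<in> {0..S}")
        case True
        interpret finite_measure "f t" using finite_f[OF True] .
        have "(\<lambda>n. tail (real n) t) \<longlonglongrightarrow> (LINT z|f t. (0::real))"
          unfolding tail_def
        proof (rule integral_dominated_convergence[where w = "\<lambda>_. 1"])
          show "(\<lambda>z. 1 - cutoff (real n) z) \<in> borel_measurable (f t)" for n
            by (subst measurable_cong_sets[OF sets_f[OF True] refl]) measurable
          show "AE z in f t. (\<lambda>n. 1 - cutoff (real n) z) \<longlonglongrightarrow> 0"
          proof (rule AE_I2)
            fix z :: "R3 \<times> R3"
            obtain n0 where "norm z \<le> real n0" using real_arch_simple by blast
            have "\<forall>\<^sub>F n in sequentially. norm z \<le> real n"
              using eventually_ge_at_top[of n0] by eventually_elim (use \<open>norm z \<le> real n0\<close> in simp)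
            then have "\<forall>\<^sub>F n in sequentially. 1 - cutoff (real n) z = 0"
              by eventually_elim (simp add: cutoff_eq_1)
            then show "(\<lambda>n. 1 - cutoff (real n) z) \<longlonglongrightarrow> 0" by (rule tendsto_eventually)
          qed
          show "AE z in f t. norm (1 - cutoff (real n) z) \<le> 1" for n
          proof (rule AE_I2)
            fix z :: "R3 \<times> R3"
            show "norm (1 - cutoff (real n) z) \<le> 1" using cutoff_bounds[of "real n" z] by simp
          qed
        qed auto
        then show ?thesis using True by simp
      qed simp
    qed
    show "integrable lborel (\<lambda>s. M * indicator {0..S} s)"
      by (rule integrable_const_Icc)
    show "AE t in lborel. norm (indicator {0..S} t * tail (real n) t) \<le> M * indicator {0..S} t" for n
      using tail_bounds[of _ "real n"] by (intro AE_I2) (auto simp: indicator_def)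
  qed (use tail_measurable in auto)
  then show ?thesis by simp
qed

text \<open>The softening makes the force differentiable in \<open>x\<close>. The cutoff makes its
  integrand, for fixed \<open>x\<close>, a compactly supported \<open>C1\<close> function of the
  source, so that \<open>time_lipschitz\<close> applies to it.\<close>

definition local_force :: "real \<Rightarrow> real \<Rightarrow> real \<Rightarrow> R3 \<Rightarrow> R3" where
  "local_force d R t x = c *\<^sub>R (LINT z|f t. cutoff R z *\<^sub>R coulomb d (x - fst z))"

definition local_force_deriv :: "real \<Rightarrow> real \<Rightarrow> real \<Rightarrow> R3 \<Rightarrow> R3 \<Rightarrow> R3" where
  "local_force_deriv d R t x v = c *\<^sub>R (LINT z|f t. cutoff R z *\<^sub>R coulomb_deriv d (x - fst z) v)"

lemma cutoff_coulomb_integrable: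
  assumes t: "t \<in> {0..S}" and d: "0 < d"
  shows "integrable (f t) (\<lambda>z. cutoff R z *\<^sub>R coulomb d (x - fst z))"
proof (rule integrable_bounded[OF t, where K = "1 / d\<^sup>2"])
  show "norm (cutoff R z *\<^sub>R coulomb d (x - fst z)) \<le> 1 / d\<^sup>2" for z :: "R3 \<times> R3"
    using mult_mono[OF cutoff_bounds(2)[of R z] norm_coulomb_le_const[OF d, of "x - fst z"]] cutoff_bounds[of R z] by simp
qed measurable

lemma local_force_le:
  assumes t: "t \<in> {0..S}" and d: "0 < d"
  shows "norm (local_force d R t x) \<le> Cb"
proof -
  interpret bounded_marginal "f t" A M using bounded_marginal[OF t] .
  have "norm (LINT z|f t. cutoff R z *\<^sub>R coulomb d (x - fst z)) \<le> (LINT z|f t. norm (coulomb d (x - fst z)))"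
  proof (rule order_trans[OF integral_norm_bound integral_mono])
    show "integrable (f t) (\<lambda>z. norm (cutoff R z *\<^sub>R coulomb d (x - fst z)))"
      by (rule integrable_norm[OF cutoff_coulomb_integrable[OF t d]])
    show "integrable (f t) (\<lambda>z. norm (coulomb d (x - fst z)))"
      by (rule integrable_norm[OF integrable_coulomb])
    show "norm (cutoff R z *\<^sub>R coulomb d (x - fst z)) \<le> norm (coulomb d (x - fst z))" for z :: "R3 \<times> R3"
      using cutoff_bounds[of R z] by (simp add: mult_left_le_one_le)
  qed
  also have "\<dots> \<le> A * (4 * pi) + M" by (rule integral_norm_coulomb_le)
  finally show ?thesis by (simp add: local_force_def Cb_def mult_left_mono)
qed

text \<open>Two bounds of the kernel derivative are in play. The crude \<open>4 / d^3\<close> is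
  uniform in \<open>x\<close> and justifies differentiation under the integral; integrating the
  sharp one against the bounded marginal gives the logarithmic Lipschitz constant.\<close>

lemma local_force_has_derivative:
  assumes t: "t \<in> {0..S}" and d: "0 < d"
  shows "(local_force d R t has_derivative local_force_deriv d R t x) (at x)"
    and "d \<le> 1 \<Longrightarrow> norm (local_force_deriv d R t x v) \<le> \<bar>c\<bar> * log_bound A M d * norm v"
    and "continuous_on UNIV (\<lambda>x. local_force_deriv d R t x v)"
proof -
  interpret bounded_marginal "f t" A M using bounded_marginal[OF t] .
  have der: "((\<lambda>x. cutoff R z *\<^sub>R coulomb d (x - fst z)) has_derivative (\<lambda>v. cutoff R z *\<^sub>R coulomb_deriv d (x - fst z) v)) (at x)" for z :: "R3 \<times> R3" and x
    by (intro has_derivative_scaleR_right has_derivative_compose[of "\<lambda>x. x - fst z" _ _ _ "coulomb d", OF _ has_derivative_coulomb[OF d]])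
      (auto intro!: derivative_eq_intros)
  have bd: "norm (cutoff R z *\<^sub>R coulomb_deriv d (x - fst z) v) \<le> 4 / soft_norm d (x - fst z) ^ 3 * norm v" for z :: "R3 \<times> R3" and x v
    using mult_mono[OF cutoff_bounds(2)[of R z] norm_coulomb_deriv_le[OF d, of "x - fst z" v]] cutoff_bounds[of R z] by simp
  have bd': "norm (cutoff R z *\<^sub>R coulomb_deriv d (x - fst z) v) \<le> 4 / d ^ 3 * norm v" for z :: "R3 \<times> R3" and x v
    using mult_mono[OF cutoff_bounds(2)[of R z] norm_coulomb_deriv_le_const[OF d, of "x - fst z" v]] cutoff_bounds[of R z] by simp
  have W: "integrable (f t) (\<lambda>_. 4 / d ^ 3)" by simp
  note int = integrable_has_derivative[OF der W bd' cutoff_coulomb_integrable[OF t d]]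
  show "(local_force d R t has_derivative local_force_deriv d R t x) (at x)"
    unfolding local_force_def[abs_def] local_force_deriv_def[abs_def]
    by (intro has_derivative_scaleR_right has_derivative_integral[OF der W bd' cutoff_coulomb_integrable[OF t d]])
  show "norm (local_force_deriv d R t x v) \<le> \<bar>c\<bar> * log_bound A M d * norm v" if "d \<le> 1"
  proof -
    have "norm (LINT z|f t. cutoff R z *\<^sub>R coulomb_deriv d (x - fst z) v) \<le> (LINT z|f t. 4 / soft_norm d (x - fst z) ^ 3 * norm v)"
      using int integrable_coulomb_deriv(1)[OF d] bd
      by (intro order_trans[OF integral_norm_bound] integral_mono integrable_norm integrable_mult_left) auto
    also have "\<dots> = (LINT z|f t. 4 / soft_norm d (x - fst z) ^ 3) * norm v"
      by (rule integral_mult_left_zero)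
    also have "\<dots> \<le> log_bound A M d * norm v"
      using integrable_coulomb_deriv(2)[OF d that] by (rule mult_right_mono) simp
    finally show ?thesis by (simp add: local_force_deriv_def mult.assoc mult_left_mono)
  qed
  show "continuous_on UNIV (\<lambda>x. local_force_deriv d R t x v)"
    unfolding local_force_deriv_def
  proof (rule continuous_on_scaleR[OF continuous_on_const continuous_on_integral[where W = "\<lambda>_. 4 / d ^ 3 * norm v"]])
    show "continuous_on UNIV (\<lambda>x. cutoff R z *\<^sub>R coulomb_deriv d (x - fst z) v)" for z :: "R3 \<times> R3"
      by (intro continuous_intros d)
    show "(\<lambda>z. cutoff R z *\<^sub>R coulomb_deriv d (x - fst z) v) \<in> borel_measurable (f t)" for x
      by (rule borel_measurable_integrable[OF int])
  qed (use bd' in auto)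
qed

text \<open>Three errors are added: softening of the kernel, truncation of the source (the tail
  times the maximum \<open>1 / d^2\<close> of the softened kernel), and the change of the truncated
  source from time \<open>a\<close> to time \<open>s\<close>.\<close>

lemma force_local_force_le:
  assumes as: "0 \<le> a" "a \<le> s" "s < S" and d: "0 < d" and R: "8 \<le> R"
  shows "norm (force s x - local_force d R a x)
    \<le> \<bar>c\<bar> * (16 * pi * d * A + tail R s / d\<^sup>2 + (s - a) * ((1 / d\<^sup>2 + 4 / d ^ 3) * (2 * R + Cb) * M))"
proof -
  have s: "s \<in> {0..S}" and a: "a \<in> {0..S}" using as by auto
  interpret bounded_marginal "f s" A M using bounded_marginal[OF s] .
  let ?I = "\<lambda>t. LINT z|f t. cutoff R z *\<^sub>R coulomb d (x - fst z)"
  have 1: "norm (field 0 (f s) x - field d (f s) x) \<le> 16 * pi * d * A"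
    by (rule norm_field_diff_le[OF d])
  have 2: "norm (field d (f s) x - ?I s) \<le> tail R s / d\<^sup>2"
  proof -
    have int: "integrable (f s) (\<lambda>z. 1 - cutoff R z)"
    proof (rule integrable_bounded[OF s, where K = 1])
      show "norm (1 - cutoff R z) \<le> 1" for z :: "R3 \<times> R3" using cutoff_bounds[of R z] by simp
    qed measurable
    have "field d (f s) x - ?I s = (LINT z|f s. coulomb d (x - fst z) - cutoff R z *\<^sub>R coulomb d (x - fst z))"
      unfolding field_def using integrable_coulomb cutoff_coulomb_integrable[OF s d] by simp
    also have "norm \<dots> \<le> (LINT z|f s. (1 - cutoff R z) * (1 / d\<^sup>2))"
    proof (rule order_trans[OF integral_norm_bound integral_mono])
      show "integrable (f s) (\<lambda>z. norm (coulomb d (x - fst z) - cutoff R z *\<^sub>R coulomb d (x - fst z)))"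
        using integrable_coulomb cutoff_coulomb_integrable[OF s d] by (intro integrable_norm Bochner_Integration.integrable_diff)
      show "integrable (f s) (\<lambda>z. (1 - cutoff R z) * (1 / d\<^sup>2))" using int by (rule integrable_mult_left)
      fix z :: "R3 \<times> R3"
      have "coulomb d (x - fst z) - cutoff R z *\<^sub>R coulomb d (x - fst z) = (1 - cutoff R z) *\<^sub>R coulomb d (x - fst z)"
        by (simp add: scaleR_diff_left)
      then show "norm (coulomb d (x - fst z) - cutoff R z *\<^sub>R coulomb d (x - fst z)) \<le> (1 - cutoff R z) * (1 / d\<^sup>2)"
        using cutoff_bounds[of R z] norm_coulomb_le_const[OF d, of "x - fst z"] by (simp only: norm_scaleR) (intro mult_mono; simp)
    qed
    also have "\<dots> = tail R s / d\<^sup>2" by (simp add: tail_def)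
    finally show ?thesis .
  qed
  have 3: "norm (?I s - ?I a) \<le> (s - a) * ((1 / d\<^sup>2 + 4 / d ^ 3) * (2 * R + Cb) * M)" (is "_ \<le> ?K")
  proof -
    \<comment> \<open>The vector-valued difference is tested against itself: the scalar estimate in
      direction \<open>u\<close> reads \<open>norm u * norm u \<le> norm u * ?K\<close>.\<close>
    define u where "u = ?I s - ?I a"
    have C1u: "C1 (\<lambda>z::R3 \<times> R3. coulomb d (x - fst z) \<bullet> u) (\<lambda>z v. coulomb_deriv d (x - fst z) (- fst v) \<bullet> u)"
      unfolding C1_def
    proof (intro conjI allI)
      fix z v :: "R3 \<times> R3"
      have "((\<lambda>z::R3 \<times> R3. coulomb d (x - fst z)) has_derivative (\<lambda>v::R3 \<times> R3. coulomb_deriv d (x - fst z) (- fst v))) (at z)"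
        by (rule has_derivative_compose[of "\<lambda>z. x - fst z" _ _ _ "coulomb d", OF _ has_derivative_coulomb[OF d]])
          (auto intro!: derivative_eq_intros)
      then show "((\<lambda>z::R3 \<times> R3. coulomb d (x - fst z) \<bullet> u) has_derivative (\<lambda>v::R3 \<times> R3. coulomb_deriv d (x - fst z) (- fst v) \<bullet> u)) (at z)"
        by (rule has_derivative_inner_left)
      show "continuous_on UNIV (\<lambda>z::R3 \<times> R3. coulomb_deriv d (x - fst z) (- fst v) \<bullet> u)"
        by (intro continuous_intros d)
    qed
    note C1 = C1_mult[OF cutoff_C1[of R] C1u]
    have "\<bar>(LINT z|f s. cutoff R z * (coulomb d (x - fst z) \<bullet> u)) - (LINT z|f a. cutoff R z * (coulomb d (x - fst z) \<bullet> u))\<bar>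
      \<le> (s - a) * ((1 / d\<^sup>2 + 4 / d ^ 3) * norm u * (2 * R + Cb) * M)"
    proof (rule time_lipschitz[OF as C1])
      show "0 \<le> (1 / d\<^sup>2 + 4 / d ^ 3) * norm u" using d by simp
      show "cutoff R z * (coulomb d (x - fst z) \<bullet> u) = 0" if "2 * R < norm z" for z :: "R3 \<times> R3"
        using cutoff_eq_0[OF _ that] R by simp
      fix z v :: "R3 \<times> R3"
      have "\<bar>coulomb_deriv d (x - fst z) (- fst v) \<bullet> u\<bar> \<le> norm (coulomb_deriv d (x - fst z) (- fst v)) * norm u"
        by (rule Cauchy_Schwarz_ineq2)
      also have "\<dots> \<le> 4 / d ^ 3 * norm (- fst v) * norm u"
        by (intro mult_right_mono norm_coulomb_deriv_le_const d) simp
      also have "\<dots> \<le> 4 / d ^ 3 * norm v * norm u"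
        using d norm_fst_le[of "fst v" "snd v"] by (intro mult_right_mono mult_left_mono) auto
      finally have i: "\<bar>cutoff R z * (coulomb_deriv d (x - fst z) (- fst v) \<bullet> u)\<bar> \<le> 1 * (4 / d ^ 3 * norm v * norm u)"
        unfolding abs_mult using cutoff_bounds[of R z] by (intro mult_mono) auto
      have "\<bar>coulomb d (x - fst z) \<bullet> u\<bar> \<le> 1 / d\<^sup>2 * norm u"
        by (rule order_trans[OF Cauchy_Schwarz_ineq2 mult_right_mono[OF norm_coulomb_le_const[OF d]]]) simp
      then have ii: "\<bar>cutoff_deriv R z v * (coulomb d (x - fst z) \<bullet> u)\<bar> \<le> norm v * (1 / d\<^sup>2 * norm u)"
        unfolding abs_mult using cutoff_deriv_le[OF R, of z v] by (intro mult_mono) auto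
      show "\<bar>cutoff R z * (coulomb_deriv d (x - fst z) (- fst v) \<bullet> u) + cutoff_deriv R z v * (coulomb d (x - fst z) \<bullet> u)\<bar>
        \<le> (1 / d\<^sup>2 + 4 / d ^ 3) * norm u * norm v"
        using order_trans[OF abs_triangle_ineq add_mono[OF i ii]] by (simp add: algebra_simps)
    qed (use R in auto)
    moreover have "(LINT z|f t. cutoff R z * (coulomb d (x - fst z) \<bullet> u)) = ?I t \<bullet> u" if "t \<in> {0..S}" for t
      using integral_inner_left[OF cutoff_coulomb_integrable[OF that d]] by simp
    ultimately have "\<bar>u \<bullet> u\<bar> \<le> norm u * ?K"
      using s a by (simp add: u_def inner_diff_left mult_ac)
    then have "norm u * norm u \<le> norm u * ?K" by (simp add: dot_square_norm power2_eq_square)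
    moreover have "0 \<le> ?K" using as d R Cb_nonneg M_nonneg by simp
    ultimately have "norm u \<le> ?K" by (cases "u = 0") (auto simp: mult_le_cancel_left)
    then show ?thesis by (simp add: u_def)
  qed
  have "force s x - local_force d R a x = c *\<^sub>R ((field 0 (f s) x - field d (f s) x) + (field d (f s) x - ?I s) + (?I s - ?I a))"
    by (simp add: force_def local_force_def scaleR_diff_right)
  also have "norm \<dots> \<le> \<bar>c\<bar> * (16 * pi * d * A + tail R s / d\<^sup>2 + ?K)"
    unfolding norm_scaleR by (intro mult_left_mono norm_triangle_le add_mono order_trans[OF norm_triangle_ineq] 1 2 3) auto
  finally show ?thesis .
qed

end

section \<open>Duality estimates for two solutions\<close>

text \<open>Gradients are normalised to 1, so that \<open>gap\<close> on the class is a dual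
  Lipschitz distance of the two measures. The velocity radius \<open>P\<close> is quantified because
  the force derivative is multiplied by the velocity in the error of a step.\<close>

definition test_class :: "real \<Rightarrow> (R3 \<times> R3 \<Rightarrow> real) \<Rightarrow> (R3 \<times> R3 \<Rightarrow> R3 \<times> R3 \<Rightarrow> real) \<Rightarrow> bool" where
  "test_class P \<phi> D \<longleftrightarrow> C1 \<phi> D \<and> (\<forall>z v. \<bar>D z v\<bar> \<le> norm v) \<and> (\<exists>R. \<forall>z. R < norm z \<longrightarrow> \<phi> z = 0) \<and>
     (\<forall>z. P < norm (snd z) \<longrightarrow> \<phi> z = 0)"

lemma C1_continuous_compose:
  assumes "C1 \<phi> D" "continuous_on UNIV W" "continuous_on UNIV V"
  shows "continuous_on UNIV (\<lambda>y. D (W y) (V y))"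
proof -
  have "D (W y) (V y) = (\<Sum>b\<in>Basis. (V y \<bullet> b) * D (W y) b)" for y
    by (rule linear_expand_Basis[OF C1D(3)[OF assms(1)]])
  moreover have "continuous_on UNIV (\<lambda>y. D (W y) b)" for b
    by (rule continuous_on_compose2[OF C1D(2)[OF assms(1)] assms(2)]) simp
  ultimately show ?thesis
    by (simp only:) (intro continuous_intros assms)
qed

lemma C1_cmult: "C1 \<phi> D \<Longrightarrow> C1 (\<lambda>z. k * \<phi> z) (\<lambda>z v. k * D z v)"
  unfolding C1_def by (auto intro!: has_derivative_mult_right continuous_intros)

text \<open>The straight-line approximation, backwards in time from \<open>b\<close>, of the characteristics of the force field \<open>F\<close>.\<close>

definition shear :: "real \<Rightarrow> (R3 \<Rightarrow> R3) \<Rightarrow> real \<times> R3 \<times> R3 \<Rightarrow> R3 \<times> R3" where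
  "shear b F y = (fst (snd y) + (b - fst y) *\<^sub>R snd (snd y), snd (snd y) + (b - fst y) *\<^sub>R F (fst (snd y)))"

definition shear_deriv :: "real \<Rightarrow> (R3 \<Rightarrow> R3) \<Rightarrow> (R3 \<Rightarrow> R3 \<Rightarrow> R3) \<Rightarrow> real \<times> R3 \<times> R3 \<Rightarrow> real \<times> R3 \<times> R3 \<Rightarrow> R3 \<times> R3" where
  "shear_deriv b F F' y w = (fst (snd w) + ((b - fst y) *\<^sub>R snd (snd w) - fst w *\<^sub>R snd (snd y)),
     snd (snd w) + ((b - fst y) *\<^sub>R F' (fst (snd y)) (fst (snd w)) - fst w *\<^sub>R F (fst (snd y))))"

lemma shear_has_derivative:
  assumes "\<And>x. (F has_derivative F' x) (at x)"
  shows "(shear b F has_derivative shear_deriv b F F' y) (at y)"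
proof -
  have F: "((\<lambda>y. F (fst (snd y))) has_derivative (\<lambda>w. F' (fst (snd y)) (fst (snd w)))) (at y)" for y :: "real \<times> R3 \<times> R3"
    by (rule has_derivative_compose[OF has_derivative_fst[OF has_derivative_snd[OF has_derivative_ident]] assms])
  show ?thesis
    unfolding shear_def[abs_def] shear_deriv_def[abs_def]
    by (auto intro!: derivative_eq_intros F)
qed

lemma shear_C1:
  assumes \<phi>: "C1 \<phi> D" and F: "\<And>x. (F has_derivative F' x) (at x)" "\<And>v. continuous_on UNIV (\<lambda>x. F' x v)"
  shows "C1 (\<lambda>y. \<phi> (shear b F y)) (\<lambda>y w. D (shear b F y) (shear_deriv b F F' y w))"
  unfolding C1_def
proof (intro conjI allI)
  fix y w :: "real \<times> R3 \<times> R3"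
  show "((\<lambda>y. \<phi> (shear b F y)) has_derivative (\<lambda>w. D (shear b F y) (shear_deriv b F F' y w))) (at y)"
    by (rule has_derivative_compose[OF shear_has_derivative[OF F(1)] C1D(1)[OF \<phi>]])
  have Fc: "continuous_on UNIV F"
    by (rule has_derivative_continuous_on[where f' = F']) (simp add: F(1))
  have 1: "continuous_on UNIV (\<lambda>y::real \<times> R3 \<times> R3. F (fst (snd y)))"
    by (rule continuous_on_compose2[OF Fc]) (auto intro!: continuous_intros)
  have 2: "continuous_on UNIV (\<lambda>y::real \<times> R3 \<times> R3. F' (fst (snd y)) v)" for v
    by (rule continuous_on_compose2[OF F(2)]) (auto intro!: continuous_intros)
  show "continuous_on UNIV (\<lambda>y. D (shear b F y) (shear_deriv b F F' y w))"
    by (rule C1_continuous_compose[OF \<phi>]; unfold shear_def shear_deriv_def; intro continuous_intros 1 2)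
qed

lemma C1_slice:
  assumes "C1 \<Phi> E"
  shows "C1 (\<lambda>z. \<Phi> (a, z)) (\<lambda>z v. E (a, z) (0, v))"
  unfolding C1_def
proof (intro conjI allI)
  fix z v
  show "((\<lambda>z. \<Phi> (a, z)) has_derivative (\<lambda>v. E (a, z) (0, v))) (at z)"
    by (rule has_derivative_compose[OF _ C1D(1)[OF assms], of "\<lambda>z. (a, z)"]) (auto intro!: derivative_eq_intros)
  show "continuous_on UNIV (\<lambda>z. E (a, z) (0, v))"
    by (rule continuous_on_compose2[OF C1D(2)[OF assms]]) (auto intro!: continuous_intros)
qed

text \<open>At a fixed time the derivative of the shear is the identity plus \<open>h\<close> times
  the map from \<open>v\<close> to \<open>(snd v, F' x (fst v))\<close>: free transport contributes
  the 1 and the force the \<open>K\<close> in the growth factor.\<close>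

lemma shear_slice_bound:
  fixes v :: "R3 \<times> R3"
  assumes "norm (F' x (fst v)) \<le> K * norm (fst v)" "0 \<le> K" "0 \<le> h" "b - s = h"
  shows "norm (shear_deriv b F F' (s, x, \<xi>) (0, v)) \<le> (1 + h * (1 + K)) * norm v"
proof -
  have eq: "shear_deriv b F F' (s, x, \<xi>) (0, v) = v + h *\<^sub>R (snd v, F' x (fst v))"
    using assms(4) by (simp add: shear_deriv_def prod_eq_iff)
  have "norm (snd v, F' x (fst v)) \<le> norm (snd v) + norm (F' x (fst v))" by (rule norm_Pair_le)
  also have "norm (snd v) \<le> norm v" using norm_snd_le[of "snd v" "fst v"] by simp
  also have "norm (F' x (fst v)) \<le> K * norm v"
    using assms(1,2) norm_fst_le[of "fst v" "snd v"] by (auto intro: order_trans mult_left_mono)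
  finally have "norm (snd v, F' x (fst v)) \<le> (1 + K) * norm v" by (simp add: algebra_simps)
  then have "norm (h *\<^sub>R (snd v, F' x (fst v))) \<le> h * ((1 + K) * norm v)"
    unfolding norm_scaleR abs_of_nonneg[OF assms(3)] using assms(3) by (rule mult_left_mono)
  then show ?thesis
    unfolding eq by (intro order_trans[OF norm_triangle_ineq]) (simp add: algebra_simps)
qed

section \<open>Comparison of two solutions with the same constants\<close>

locale vp_pair = F: vp_solution \<epsilon> T S A M f0 f + G: vp_solution \<epsilon> T S A M f0 g
  for \<epsilon> T S A M f0 f g
begin

definition gap :: "real \<Rightarrow> (R3 \<times> R3 \<Rightarrow> real) \<Rightarrow> real" where
  "gap t \<phi> = (LINT z|f t. \<phi> z) - (LINT z|g t. \<phi> z)"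

text \<open>The normalisation that brings \<open>cutoff R z * v (fst z)\<close> in
  \<open>kernel_gap\<close> to gradient at most 1: the Lipschitz constant of \<open>v\<close>, plus
  the bound of \<open>v\<close> that multiplies the derivative of the cutoff, plus 1 to make
  division safe.\<close>

definition N :: "real \<Rightarrow> real" where
  "N d = log_bound A M d + (A * (4 * pi) + M) + 1"

lemma gap_cmult: "gap t (\<lambda>z. k * \<phi> z) = k * gap t \<phi>"
  by (simp add: gap_def right_diff_distrib)

lemma N_bounds:
  assumes "0 < d" "d \<le> 1"
  shows "1 \<le> N d" "0 \<le> log_bound A M d" "log_bound A M d \<le> N d"
proof -
  have "0 \<le> ln (1 / d)" using assms by simp
  then show "0 \<le> log_bound A M d" using F.A_nonneg F.M_nonneg by (simp add: log_bound_def)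
  then show "1 \<le> N d" "log_bound A M d \<le> N d" using F.A_nonneg F.M_nonneg by (simp_all add: N_def)
qed

text \<open>Fubini turns the left side into the gap at time \<open>s\<close> of the dual potential
  \<open>v\<close>. The hypothesis speaks about time \<open>a\<close> and compact supports, so
  \<open>v\<close> is cut off at radius \<open>R\<close>, divided by \<open>N d\<close>, and held
  fixed while \<open>time_lipschitz\<close> carries the gap of the result back to \<open>a\<close>;
  doing this for both solutions gives the factor 2. What the cutoff removes is bounded by the
  tails.\<close>

lemma kernel_gap:
  fixes D' :: "R3 \<times> R3 \<Rightarrow> R3 \<Rightarrow> real"
  assumes as: "0 \<le> a" "a \<le> s" "s < S" and d: "0 < d" "d \<le> 1" and R: "8 \<le> R" "2 * R \<le> P"
    and lin: "\<And>z. linear (D' z)" and D'1: "\<And>z v. \<bar>D' z v\<bar> \<le> norm v" and D'c: "\<And>v. continuous_on UNIV (\<lambda>z. D' z v)"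
    and IH: "\<And>\<phi> D. test_class P \<phi> D \<Longrightarrow> \<bar>gap a \<phi>\<bar> \<le> \<alpha>"
  shows "\<bar>LINT z|g s. D' z (field d (g s) (fst z) - field d (f s) (fst z))\<bar>
    \<le> N d * (\<alpha> + (s - a) * (2 * ((2 * R + F.Cb) * M))) + (A * (4 * pi) + M) * (F.tail R s + G.tail R s)"
proof -
  have s: "s \<in> {0..S}" using as by auto
  interpret f: bounded_marginal "f s" A M using F.bounded_marginal[OF s] .
  interpret g: bounded_marginal "g s" A M using G.bounded_marginal[OF s] .
  define Q where "Q = A * (4 * pi) + M"
  have Q: "0 \<le> Q" using F.A_nonneg F.M_nonneg by (simp add: Q_def)
  note Nd = N_bounds[OF d]
  note D'_meas [measurable] = linear_family_measurable[OF lin D'c]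
  have bl: "bounded_linear (D' z)" for z using lin linear_conv_bounded_linear by blast
  define v where "v y = (LINT z|g s. D' z (coulomb d (fst z - y)))" for y
  define v' where "v' y u = (LINT z|g s. D' z (coulomb_deriv d (fst z - y) (- u)))" for y u
  have der: "((\<lambda>y. D' z (coulomb d (fst z - y))) has_derivative (\<lambda>u. D' z (coulomb_deriv d (fst z - y) (- u)))) (at y)" for z :: "R3 \<times> R3" and y
  proof -
    have "((\<lambda>y. coulomb d (fst z - y)) has_derivative (\<lambda>u. coulomb_deriv d (fst z - y) (- u))) (at y)"
      by (rule has_derivative_compose[of "\<lambda>y. fst z - y" _ _ _ "coulomb d", OF _ has_derivative_coulomb[OF d(1)]])
        (auto intro!: derivative_eq_intros)
    then show ?thesis by (rule bounded_linear.has_derivative[OF bl])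
  qed
  have W: "integrable (g s) (\<lambda>_. 4 / d ^ 3)" by simp
  have bd': "norm (D' z (coulomb_deriv d (fst z - y) (- u))) \<le> 4 / d ^ 3 * norm u" for z y u
    using order_trans[OF D'1 norm_coulomb_deriv_le_const[OF d(1), of "fst z - y" "- u"]] by simp
  have int: "integrable (g s) (\<lambda>z. D' z (coulomb d (fst z - y)))" for y
  proof (rule G.integrable_bounded[OF s, where K = "1 / d\<^sup>2"])
    show "norm (D' z (coulomb d (fst z - y))) \<le> 1 / d\<^sup>2" for z
      using order_trans[OF D'1 norm_coulomb_le_const[OF d(1)]] by simp
  qed measurable
  note int' = integrable_has_derivative[OF der W bd' int]
  have v_der: "(v has_derivative v' y) (at y)" for y
    unfolding v_def[abs_def] v'_def[abs_def] by (rule has_derivative_integral[OF der W bd' int])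
  have v_le: "\<bar>v y\<bar> \<le> Q" for y
  proof -
    have "\<bar>v y\<bar> \<le> (LINT z|g s. norm (coulomb d (y - fst z)))"
      unfolding v_def
    proof (rule order_trans[OF integral_abs_bound integral_mono])
      show "integrable (g s) (\<lambda>z. norm (coulomb d (y - fst z)))" by (rule integrable_norm[OF g.integrable_coulomb])
      show "integrable (g s) (\<lambda>z. \<bar>D' z (coulomb d (fst z - y))\<bar>)" using int by (rule integrable_abs)
      have "norm (coulomb d (fst z - y)) = norm (coulomb d (y - fst z))" for z :: "R3 \<times> R3"
        by (simp add: norm_coulomb soft_norm_def norm_minus_commute)
      then show "\<bar>D' z (coulomb d (fst z - y))\<bar> \<le> norm (coulomb d (y - fst z))" for z
        using D'1[of z "coulomb d (fst z - y)"] by simp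
    qed
    also have "\<dots> \<le> Q" unfolding Q_def by (rule g.integral_norm_coulomb_le)
    finally show ?thesis .
  qed
  have v'_le: "\<bar>v' y u\<bar> \<le> log_bound A M d * norm u" for y u
  proof -
    have "\<bar>v' y u\<bar> \<le> (LINT z|g s. 4 / soft_norm d (y - fst z) ^ 3 * norm u)"
      unfolding v'_def
    proof (rule order_trans[OF integral_abs_bound integral_mono])
      show "integrable (g s) (\<lambda>z. \<bar>D' z (coulomb_deriv d (fst z - y) (- u))\<bar>)" using int' by (rule integrable_abs)
      show "integrable (g s) (\<lambda>z. 4 / soft_norm d (y - fst z) ^ 3 * norm u)"
        using g.integrable_coulomb_deriv(1)[OF d(1)] by (rule integrable_mult_left)
      have "soft_norm d (fst z - y) = soft_norm d (y - fst z)" for z :: "R3 \<times> R3"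
        by (simp add: soft_norm_def norm_minus_commute)
      then show "\<bar>D' z (coulomb_deriv d (fst z - y) (- u))\<bar> \<le> 4 / soft_norm d (y - fst z) ^ 3 * norm u" for z
        using order_trans[OF D'1 norm_coulomb_deriv_le[OF d(1), of "fst z - y" "- u"]] by simp
    qed
    also have "\<dots> = (LINT z|g s. 4 / soft_norm d (y - fst z) ^ 3) * norm u"
      by (rule integral_mult_left_zero)
    also have "\<dots> \<le> log_bound A M d * norm u"
      using g.integrable_coulomb_deriv(2)[OF d] by (rule mult_right_mono) simp
    finally show ?thesis .
  qed
  have v'_c: "continuous_on UNIV (\<lambda>y. v' y u)" for u
    unfolding v'_def
  proof (rule continuous_on_integral[where W = "\<lambda>_. 4 / d ^ 3 * norm u"])
    show "continuous_on UNIV (\<lambda>y. D' z (coulomb_deriv d (fst z - y) (- u)))" for z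
      by (rule bounded_linear.continuous_on[OF bl]) (intro continuous_intros d(1))
    show "(\<lambda>z. D' z (coulomb_deriv d (fst z - y) (- u))) \<in> borel_measurable (g s)" for y
      by (rule borel_measurable_integrable[OF int'])
  qed (use bd' in auto)
  have C1v: "C1 (\<lambda>z. v (fst z)) (\<lambda>z (w :: R3 \<times> R3). v' (fst z) (fst w))"
    unfolding C1_def
  proof (intro conjI allI)
    fix z w :: "R3 \<times> R3"
    show "((\<lambda>z. v (fst z)) has_derivative (\<lambda>w. v' (fst z) (fst w))) (at z)"
      by (rule has_derivative_compose[OF has_derivative_fst[OF has_derivative_ident] v_der])
    show "continuous_on UNIV (\<lambda>z::R3 \<times> R3. v' (fst z) (fst w))"
      by (rule continuous_on_compose2[OF v'_c]) (auto intro!: continuous_intros)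
  qed
  \<comment> \<open>The outer measure is \<open>g s\<close> for both choices of
    \<open>\<nu>\<close>, so the same \<open>v\<close> arises for \<open>f s\<close> and
    \<open>g s\<close> and the difference is a single gap.\<close>
  have fubini: "(LINT z|g s. D' z (field d \<nu> (fst z))) = (LINT w|\<nu>. v (fst w))"
    if \<nu>: "bounded_marginal \<nu> A M" for \<nu>
  proof -
    interpret n: bounded_marginal \<nu> A M by fact
    interpret pair_sigma_finite "g s" \<nu> ..
    interpret p: finite_measure "g s \<Otimes>\<^sub>M \<nu>"
      by (rule finite_measure_pair_measure) unfold_locales
    have [measurable_cong]: "sets (g s) = sets borel" "sets \<nu> = sets borel" by simp_all
    have "integrable (g s \<Otimes>\<^sub>M \<nu>) (\<lambda>(z, w). D' z (coulomb d (fst z - fst w)))"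
    proof (rule p.integrable_const_bound[where B = "1 / d\<^sup>2"])
      show "AE x in g s \<Otimes>\<^sub>M \<nu>. norm (case x of (z, w) \<Rightarrow> D' z (coulomb d (fst z - fst w))) \<le> 1 / d\<^sup>2"
        using order_trans[OF D'1 norm_coulomb_le_const[OF d(1)]] by (intro AE_I2) (simp add: case_prod_beta)
      show "(\<lambda>(z, w). D' z (coulomb d (fst z - fst w))) \<in> borel_measurable (g s \<Otimes>\<^sub>M \<nu>)"
        unfolding case_prod_beta by measurable
    qed
    from Fubini_integral[OF this]
    have "(LINT w|\<nu>. v (fst w)) = (LINT z|g s. LINT w|\<nu>. D' z (coulomb d (fst z - fst w)))"
      by (simp add: v_def)
    also have "\<dots> = (LINT z|g s. D' z (field d \<nu> (fst z)))"
      unfolding field_def by (intro Bochner_Integration.integral_cong refl integral_bounded_linear bl n.integrable_coulomb)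
    finally show ?thesis ..
  qed
  have field_le: "norm (field d \<nu> x) \<le> Q" if "bounded_marginal \<nu> A M" for \<nu> x
    using bounded_marginal.norm_field_le[OF that] by (simp add: Q_def)
  have int_field: "integrable (g s) (\<lambda>z. D' z (field d \<nu> (fst z)))" if "bounded_marginal \<nu> A M" for \<nu>
  proof (rule G.integrable_bounded[OF s, where K = Q])
    show "norm (D' z (field d \<nu> (fst z))) \<le> Q" for z
      using order_trans[OF D'1 field_le[OF that]] by simp
    note [measurable] = bounded_marginal.field_measurable[OF that]
    show "(\<lambda>z. D' z (field d \<nu> (fst z))) \<in> borel_measurable borel" by measurable
  qed
  have "(LINT z|g s. D' z (field d (g s) (fst z) - field d (f s) (fst z)))
    = (LINT z|g s. D' z (field d (g s) (fst z))) - (LINT z|g s. D' z (field d (f s) (fst z)))"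
    using int_field[OF g.bounded_marginal_axioms] int_field[OF f.bounded_marginal_axioms] by (simp add: linear_diff[OF lin])
  then have eq: "\<bar>LINT z|g s. D' z (field d (g s) (fst z) - field d (f s) (fst z))\<bar> = \<bar>gap s (\<lambda>z. v (fst z))\<bar>"
    using fubini[OF g.bounded_marginal_axioms] fubini[OF f.bounded_marginal_axioms] by (simp add: gap_def abs_minus_commute)
  define \<phi> where "\<phi> = (\<lambda>z::R3 \<times> R3. (1 / N d) * (cutoff R z * v (fst z)))"
  define D where "D = (\<lambda>(z::R3 \<times> R3) w. (1 / N d) * (cutoff R z * v' (fst z) (fst w) + cutoff_deriv R z w * v (fst z)))"
  have C1: "C1 \<phi> D"
    unfolding \<phi>_def D_def by (rule C1_cmult[OF C1_mult[OF cutoff_C1 C1v]])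
  have D1: "\<bar>D z w\<bar> \<le> 1 * norm w" for z w
  proof -
    have "norm (fst w) \<le> norm w" using norm_fst_le[of "fst w" "snd w"] by simp
    then have "\<bar>v' (fst z) (fst w)\<bar> \<le> log_bound A M d * norm w"
      using Nd by (intro order_trans[OF v'_le] mult_left_mono)
    then have "\<bar>cutoff R z * v' (fst z) (fst w)\<bar> \<le> 1 * (log_bound A M d * norm w)"
      unfolding abs_mult using cutoff_bounds[of R z] by (intro mult_mono) auto
    moreover have "\<bar>cutoff_deriv R z w * v (fst z)\<bar> \<le> norm w * Q"
      unfolding abs_mult using cutoff_deriv_le[OF R(1)] v_le by (intro mult_mono) auto
    ultimately have "\<bar>cutoff R z * v' (fst z) (fst w) + cutoff_deriv R z w * v (fst z)\<bar> \<le> (log_bound A M d + Q) * norm w"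
      by (intro order_trans[OF abs_triangle_ineq]) (simp add: algebra_simps)
    also have "\<dots> \<le> N d * norm w" by (intro mult_right_mono) (auto simp: N_def Q_def)
    finally show ?thesis using Nd(1) by (simp add: D_def abs_mult pos_divide_le_eq mult.commute)
  qed
  have \<phi>0: "\<phi> z = 0" if "2 * R < norm z" for z
    using cutoff_eq_0[OF _ that] R by (simp add: \<phi>_def)
  have "test_class P \<phi> D"
    unfolding test_class_def
  proof (intro conjI allI impI exI)
    show "\<phi> z = 0" if "P < norm (snd z)" for z
      using that R norm_snd_le[of "snd z" "fst z"] by (intro \<phi>0) simp
  qed (use C1 D1 \<phi>0 in auto)
  then have "\<bar>gap a \<phi>\<bar> \<le> \<alpha>" by (rule IH)
  moreover have "\<bar>(LINT z|f s. \<phi> z) - (LINT z|f a. \<phi> z)\<bar> \<le> (s - a) * (1 * (2 * R + F.Cb) * M)"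
    by (rule F.time_lipschitz[OF as C1 D1]) (use \<phi>0 R in auto)
  moreover have "\<bar>(LINT z|g s. \<phi> z) - (LINT z|g a. \<phi> z)\<bar> \<le> (s - a) * (1 * (2 * R + F.Cb) * M)"
    by (rule G.time_lipschitz[OF as C1 D1]) (use \<phi>0 R in auto)
  ultimately have gap\<phi>: "\<bar>gap s \<phi>\<bar> \<le> \<alpha> + (s - a) * (2 * ((2 * R + F.Cb) * M))"
    unfolding gap_def by (simp add: algebra_simps)
  have vc: "continuous_on UNIV (\<lambda>z::R3 \<times> R3. v (fst z))" by (rule C1D(4)[OF C1v])
  have split: "(LINT z|\<mu> s. v (fst z)) = N d * (LINT z|\<mu> s. \<phi> z) + (LINT z|\<mu> s. (1 - cutoff R z) * v (fst z))"
    and tail_le: "\<bar>LINT z|\<mu> s. (1 - cutoff R z) * v (fst z)\<bar> \<le> Q * (LINT z|\<mu> s. 1 - cutoff R z)"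
    if \<mu>: "vp_solution \<epsilon> T S A M f0 \<mu>" for \<mu>
  proof -
    interpret m: vp_solution \<epsilon> T S A M f0 \<mu> by fact
    have [measurable]: "(\<lambda>z::R3 \<times> R3. v (fst z)) \<in> borel_measurable borel"
      by (rule borel_measurable_continuous_onI[OF vc])
    have i1: "integrable (\<mu> s) (\<lambda>z. cutoff R z * v (fst z))"
    proof (rule m.integrable_bounded[OF s, where K = Q])
      show "norm (cutoff R z * v (fst z)) \<le> Q" for z
        using mult_mono[OF cutoff_bounds(2)[of R z] v_le[of "fst z"]] cutoff_bounds[of R z] by (simp add: abs_mult)
    qed measurable
    have b2: "\<bar>(1 - cutoff R z) * v (fst z)\<bar> \<le> Q * (1 - cutoff R z)" for z
      using mult_left_mono[OF v_le[of "fst z"], of "1 - cutoff R z"] cutoff_bounds[of R z] by (simp add: abs_mult mult.commute)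
    have i2: "integrable (\<mu> s) (\<lambda>z. (1 - cutoff R z) * v (fst z))"
    proof (rule m.integrable_bounded[OF s, where K = Q])
      show "norm ((1 - cutoff R z) * v (fst z)) \<le> Q" for z
        using order_trans[OF b2[of z] mult_left_mono[of "1 - cutoff R z" 1 Q]] Q cutoff_bounds[of R z] by simp
    qed measurable
    have i3: "integrable (\<mu> s) (\<lambda>z. 1 - cutoff R z)"
    proof (rule m.integrable_bounded[OF s, where K = 1])
      show "norm (1 - cutoff R z) \<le> 1" for z :: "R3 \<times> R3" using cutoff_bounds[of R z] by simp
    qed measurable
    have "(LINT z|\<mu> s. v (fst z)) = (LINT z|\<mu> s. cutoff R z * v (fst z) + (1 - cutoff R z) * v (fst z))"
      by (simp add: algebra_simps)
    also have "\<dots> = N d * (LINT z|\<mu> s. \<phi> z) + (LINT z|\<mu> s. (1 - cutoff R z) * v (fst z))"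
      using i1 i2 Nd(1) by (simp add: \<phi>_def)
    finally show "(LINT z|\<mu> s. v (fst z)) = N d * (LINT z|\<mu> s. \<phi> z) + (LINT z|\<mu> s. (1 - cutoff R z) * v (fst z))" .
    have "\<bar>LINT z|\<mu> s. (1 - cutoff R z) * v (fst z)\<bar> \<le> (LINT z|\<mu> s. Q * (1 - cutoff R z))"
      by (rule order_trans[OF integral_abs_bound integral_mono[OF integrable_abs[OF i2] _ b2]]) (use i3 in simp)
    then show "\<bar>LINT z|\<mu> s. (1 - cutoff R z) * v (fst z)\<bar> \<le> Q * (LINT z|\<mu> s. 1 - cutoff R z)" by simp
  qed
  have "gap s (\<lambda>z. v (fst z)) = N d * gap s \<phi> + ((LINT z|f s. (1 - cutoff R z) * v (fst z)) - (LINT z|g s. (1 - cutoff R z) * v (fst z)))"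
    unfolding gap_def split[OF F.vp_solution_axioms] split[OF G.vp_solution_axioms] by (simp add: algebra_simps)
  also have "\<bar>\<dots>\<bar> \<le> N d * \<bar>gap s \<phi>\<bar> + (Q * F.tail R s + Q * G.tail R s)"
    using tail_le[OF F.vp_solution_axioms] tail_le[OF G.vp_solution_axioms] Nd(1)
    by (intro order_trans[OF abs_triangle_ineq] add_mono order_trans[OF abs_triangle_ineq4]) (auto simp: abs_mult F.tail_def G.tail_def)
  also have "\<dots> \<le> N d * (\<alpha> + (s - a) * (2 * ((2 * R + F.Cb) * M))) + Q * (F.tail R s + G.tail R s)"
    using mult_left_mono[OF gap\<phi>, of "N d"] Nd(1) by (simp add: algebra_simps)
  finally show ?thesis unfolding eq by (simp add: Q_def)
qed


section \<open>One time step of the duality argument\<close>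

abbreviation c where "c \<equiv> F.c"
abbreviation Cb where "Cb \<equiv> F.Cb"

definition tails :: "real \<Rightarrow> real \<Rightarrow> real" where
  "tails R s = F.tail R s + G.tail R s"

text \<open>Errors that do not shrink with the step length. The 64 is \<open>2 * 16 + 32\<close>:
  the softening error of the force of \<open>f\<close> enters the rates of both solutions, and
  replacing the difference of the two singular fields by the softened one costs another
  \<open>32 * pi * d * A\<close>.\<close>

definition beta :: "real \<Rightarrow> real \<Rightarrow> real \<Rightarrow> real" where
  "beta d R s = 64 * pi * \<bar>c\<bar> * A * M * d + (2 * M * \<bar>c\<bar> / d\<^sup>2 + \<bar>c\<bar> * (A * (4 * pi) + M)) * tails R s"

text \<open>Errors in the rates that are proportional to the step length. The first summand collects
  displacement along the shear and freezing of the force, once for each solution; the last one is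
  the time shift in \<open>kernel_gap\<close>.\<close>

definition kappa :: "real \<Rightarrow> real \<Rightarrow> real \<Rightarrow> real" where
  "kappa d R Pm = 2 * M * ((Cb + \<bar>c\<bar> * N d * (Pm + Cb)) + \<bar>c\<bar> * ((1 / d\<^sup>2 + 4 / d ^ 3) * (2 * R + Cb) * M))
     + \<bar>c\<bar> * N d * (2 * ((2 * R + Cb) * M))"

text \<open>The 1 comes from free transport. One \<open>\<bar>c\<bar> * N d\<close> comes from the
  gradient growth under the shear, the other from the difference of the forces estimated in
  \<open>kernel_gap\<close>.\<close>

definition growth :: "real \<Rightarrow> real" where
  "growth d = 1 + 2 * \<bar>c\<bar> * N d"

lemma beta_integrable:
  assumes X: "X \<in> sets borel" "X \<subseteq> {0..S}"
  shows "integrable lborel (\<lambda>s. indicator X s * beta d R s)"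
proof -
  have alg: "i * (k1 + k2 * (x + y)) = i * k1 + k2 * (i * x + i * y)" for i k1 k2 x y :: real
    by (simp add: algebra_simps)
  have "emeasure lborel X \<le> emeasure lborel {0..S}"
    using X by (intro emeasure_mono) auto
  also have "\<dots> < \<infinity>" using F.S by simp
  finally have "integrable lborel (\<lambda>s. indicator X s * k)" for k :: real
    using X by (intro integrable_mult_left integrable_real_indicator) auto
  then show ?thesis
    unfolding beta_def tails_def alg
    by (intro Bochner_Integration.integrable_add integrable_mult_right F.tail_integrable[OF X] G.tail_integrable[OF X])
qed

text \<open>Undo the shear: a point whose image has norm at most \<open>R\<close> has velocity at
  most \<open>R + \<rho> * K\<close>, hence position at most
  \<open>R + \<rho> * (R + \<rho> * K)\<close>.\<close>

lemma shear_support: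
  assumes \<phi>: "\<And>z. R < norm z \<Longrightarrow> \<phi> z = 0" and F: "\<And>x. norm (H x) \<le> K" and "0 \<le> R" and b: "\<bar>b - s\<bar> \<le> \<rho>"
    and z: "(R + \<rho> * (R + \<rho> * K)) + (R + \<rho> * K) < norm z"
  shows "\<phi> (shear b H (s, z)) = 0"
proof (rule ccontr)
  assume nz: "\<phi> (shear b H (s, z)) \<noteq> 0"
  then have n: "norm (shear b H (s, z)) \<le> R" using \<phi> not_le by blast
  have \<rho>: "0 \<le> \<rho>" using b by linarith
  have "norm (snd (shear b H (s, z))) \<le> R" "norm (fst (shear b H (s, z))) \<le> R"
    using n norm_snd_le[of "snd (shear b H (s, z))" "fst (shear b H (s, z))"]
      norm_fst_le[of "fst (shear b H (s, z))" "snd (shear b H (s, z))"] by simp_all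
  then have n1: "norm (snd z + (b - s) *\<^sub>R H (fst z)) \<le> R" and n2: "norm (fst z + (b - s) *\<^sub>R snd z) \<le> R"
    by (simp_all add: shear_def)
  have "norm (snd z) \<le> norm (snd z + (b - s) *\<^sub>R H (fst z)) + norm ((b - s) *\<^sub>R H (fst z))"
    by (metis add_diff_cancel_right' norm_triangle_ineq4)
  also have "norm ((b - s) *\<^sub>R H (fst z)) \<le> \<rho> * K"
    using b F[of "fst z"] \<rho> by (simp add: mult_mono)
  finally have \<xi>: "norm (snd z) \<le> R + \<rho> * K" using n1 by simp
  have "norm (fst z) \<le> norm (fst z + (b - s) *\<^sub>R snd z) + norm ((b - s) *\<^sub>R snd z)"
    by (metis add_diff_cancel_right' norm_triangle_ineq4)
  also have "norm ((b - s) *\<^sub>R snd z) \<le> \<rho> * (R + \<rho> * K)"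
    using b \<xi> \<rho> by (simp add: mult_mono)
  finally have x: "norm (fst z) \<le> R + \<rho> * (R + \<rho> * K)" using n2 by simp
  have "norm z \<le> norm (fst z) + norm (snd z)" using norm_Pair_le[of "fst z" "snd z"] by simp
  with x \<xi> z show False by simp
qed

lemma step:
  assumes ab: "0 \<le> a" "a < b" "b < S" "b - a \<le> 1" and d: "0 < d" "d \<le> 1" and R: "8 \<le> R" "2 * R \<le> P" "P \<le> Pm"
    and IH: "\<And>\<phi> D. test_class (P + Cb * (b - a)) \<phi> D \<Longrightarrow> \<bar>gap a \<phi>\<bar> \<le> \<alpha>"
    and \<phi>: "test_class P \<phi> D"
  shows "\<bar>gap b \<phi>\<bar> \<le> (1 + (b - a) * growth d) * \<alpha> + (LINT s|lborel. indicator {a<..b} s * beta d R s) + kappa d R Pm * (b - a)\<^sup>2"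
proof -
  define h where "h = b - a"
  have h: "0 < h" "h \<le> 1" using ab by (auto simp: h_def)
  have a: "a \<in> {0..S}" using ab by auto
  have c1: "C1 \<phi> D" and D1: "\<And>z v. \<bar>D z v\<bar> \<le> norm v" and \<phi>P: "\<And>z. P < norm (snd z) \<Longrightarrow> \<phi> z = 0"
    using \<phi> by (auto simp: test_class_def)
  obtain R0 where R0: "\<And>z. R0 < norm z \<Longrightarrow> \<phi> z = 0" "0 \<le> R0"
  proof -
    obtain R1 where "\<forall>z. R1 < norm z \<longrightarrow> \<phi> z = 0" using \<phi> by (auto simp: test_class_def)
    then show ?thesis by (intro that[of "\<bar>R1\<bar>"]) auto
  qed
  note Nd = N_bounds[OF d]
  define Q where "Q = A * (4 * pi) + M"
  have Q: "0 \<le> Q" using F.A_nonneg F.M_nonneg by (simp add: Q_def)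
  have Cb: "0 \<le> Cb" by (rule F.Cb_nonneg)
  have M: "0 \<le> M" by (rule F.M_nonneg)
  have P: "0 \<le> P" using R by simp
  define \<Lambda> where "\<Lambda> = \<bar>c\<bar> * log_bound A M d"
  have \<Lambda>: "0 \<le> \<Lambda>" "\<Lambda> \<le> \<bar>c\<bar> * N d" using Nd by (auto simp: \<Lambda>_def intro!: mult_left_mono)
  define H where "H = F.local_force d R a"
  define H' where "H' = F.local_force_deriv d R a"
  have H_der: "(H has_derivative H' x) (at x)" for x
    unfolding H_def H'_def by (rule F.local_force_has_derivative(1)[OF a d(1)])
  have H_c: "continuous_on UNIV (\<lambda>x. H' x v)" for v
    unfolding H'_def by (rule F.local_force_has_derivative(3)[OF a d(1)])
  have H_le: "norm (H x) \<le> Cb" for x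
    unfolding H_def by (rule F.local_force_le[OF a d(1)])
  have H'_le: "norm (H' x v) \<le> \<Lambda> * norm v" for x v
    unfolding H'_def \<Lambda>_def by (rule F.local_force_has_derivative(2)[OF a d])
  define \<Phi> where "\<Phi> y = \<phi> (shear b H y)" for y
  define E where "E y w = D (shear b H y) (shear_deriv b H H' y w)" for y w
  have C1\<Phi>: "C1 \<Phi> E"
    unfolding \<Phi>_def[abs_def] E_def[abs_def] by (rule shear_C1[OF c1 H_der H_c])
  \<comment> \<open>The radius of \<open>shear_support\<close> for \<open>\<rho> = S + 1\<close>,
    which bounds \<open>\<bar>b - s\<bar>\<close> for all \<open>s\<close> in
    \<open>[-1, S]\<close>.\<close>
  define R1 where "R1 = (R0 + (S + 1) * (R0 + (S + 1) * Cb)) + (R0 + (S + 1) * Cb)"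
  have supp: "\<Phi> (s, z) = 0" if "s \<in> {-1..S}" "R1 < norm z" for s z
    unfolding \<Phi>_def
    by (rule shear_support[OF R0(1) H_le R0(2), where \<rho> = "S + 1"]) (use that ab F.S in \<open>auto simp: R1_def\<close>)
  have "\<Phi> (b, z) = \<phi> z" for z by (simp add: \<Phi>_def shear_def)
  then have gap_eq: "gap b \<phi> = gap a (\<lambda>z. \<Phi> (a, z))
      + ((LINT s|lborel. indicator {a<..b} s * F.rate E s) - (LINT s|lborel. indicator {a<..b} s * G.rate E s))"
    using F.transport_identity[OF ab(1) less_imp_le[OF ab(2)] ab(3) C1\<Phi> supp]
      G.transport_identity[OF ab(1) less_imp_le[OF ab(2)] ab(3) C1\<Phi> supp] by (simp add: gap_def)
  have slice: "\<bar>gap a (\<lambda>z. \<Phi> (a, z))\<bar> \<le> (1 + h * (1 + \<Lambda>)) * \<alpha>"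
  proof -
    define k where "k = 1 + h * (1 + \<Lambda>)"
    have k: "1 \<le> k" using h \<Lambda> by (simp add: k_def)
    have "test_class (P + Cb * (b - a)) (\<lambda>z. (1 / k) * \<Phi> (a, z)) (\<lambda>z v. (1 / k) * E (a, z) (0, v))"
      unfolding test_class_def
    proof (intro conjI allI impI)
      show "C1 (\<lambda>z. (1 / k) * \<Phi> (a, z)) (\<lambda>z v. (1 / k) * E (a, z) (0, v))"
        by (rule C1_cmult[OF C1_slice[OF C1\<Phi>]])
      show "\<bar>(1 / k) * E (a, z) (0, v)\<bar> \<le> norm v" for z v
      proof -
        have "\<bar>E (a, z) (0, v)\<bar> \<le> norm (shear_deriv b H H' (a, fst z, snd z) (0, v))"
          unfolding E_def using D1 by simp
        also have "\<dots> \<le> k * norm v"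
          unfolding k_def by (rule shear_slice_bound) (use H'_le \<Lambda> h in \<open>auto simp: h_def\<close>)
        finally show ?thesis using k by (simp add: abs_mult pos_divide_le_eq mult.commute)
      qed
      show "\<exists>R. \<forall>z. R < norm z \<longrightarrow> (1 / k) * \<Phi> (a, z) = 0"
        using supp[of a] ab by (intro exI[of _ R1]) auto
      show "(1 / k) * \<Phi> (a, z) = 0" if z: "P + Cb * (b - a) < norm (snd z)" for z
      proof -
        have "norm (snd z) \<le> norm (snd z + h *\<^sub>R H (fst z)) + norm (h *\<^sub>R H (fst z))"
          by (metis add_diff_cancel_right' norm_triangle_ineq4)
        moreover have "norm (h *\<^sub>R H (fst z)) \<le> Cb * h"
          using h H_le[of "fst z"] by (simp add: mult.commute mult_left_mono)
        ultimately have "P < norm (snd (shear b H (a, z)))"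
          using z by (simp add: shear_def h_def)
        then show ?thesis using \<phi>P by (simp add: \<Phi>_def)
      qed
    qed
    from IH[OF this] have "\<bar>gap a (\<lambda>z. \<Phi> (a, z))\<bar> / k \<le> \<alpha>"
      using k unfolding gap_cmult by (simp add: abs_mult)
    then show ?thesis using k by (simp add: pos_divide_le_eq k_def mult.commute)
  qed
  have D0: "D w v = 0" if "P < norm (snd w)" for w v
    by (rule C1_support[OF c1, of "\<lambda>w. P < norm (snd w)"]) (use that \<phi>P in \<open>auto intro!: open_Collect_less continuous_intros\<close>)
  define \<kappa>1 where "\<kappa>1 = Cb + \<bar>c\<bar> * N d * (Pm + Cb)"
  define \<kappa>2 where "\<kappa>2 = (1 / d\<^sup>2 + 4 / d ^ 3) * (2 * R + Cb) * M"
  define \<kappa>3 where "\<kappa>3 = 2 * ((2 * R + Cb) * M)"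
  have \<kappa>: "0 \<le> \<kappa>1" "0 \<le> \<kappa>2" "0 \<le> \<kappa>3"
    using Cb Nd R P d M by (auto simp: \<kappa>1_def \<kappa>2_def \<kappa>3_def intro!: add_nonneg_nonneg mult_nonneg_nonneg)
  \<comment> \<open>\<open>V\<close> and \<open>U\<close> are kept apart: for the rate of
    \<open>g\<close> the position component will contain the force of \<open>g\<close>, while the
    velocity component is compared through the force of \<open>f\<close>.\<close>
  have pointwise: "\<bar>D (shear b H (s, z)) ((b - s) *\<^sub>R V, U - H (fst z) + (b - s) *\<^sub>R H' (fst z) (snd z))\<bar> \<le> h * \<kappa>1 + \<delta>"
    if s: "a < s" "s \<le> b" and V: "norm V \<le> Cb" and U: "norm (U - H (fst z)) \<le> \<delta>" for s z V U \<delta>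
  proof (cases "P < norm (snd (shear b H (s, z)))")
    case True
    have "0 \<le> \<delta>" using U norm_ge_zero order_trans by blast
    with True show ?thesis using D0 h \<kappa> by simp
  next
    case False
    have r: "0 \<le> b - s" "b - s \<le> h" using s by (auto simp: h_def)
    have "norm (snd z) \<le> norm (snd z + (b - s) *\<^sub>R H (fst z)) + norm ((b - s) *\<^sub>R H (fst z))"
      by (metis add_diff_cancel_right' norm_triangle_ineq4)
    moreover have "norm ((b - s) *\<^sub>R H (fst z)) \<le> 1 * Cb"
      unfolding norm_scaleR using r h H_le[of "fst z"] by (intro mult_mono) auto
    ultimately have \<xi>: "norm (snd z) \<le> P + Cb" using False by (simp add: shear_def)
    have "norm (H' (fst z) (snd z)) \<le> \<Lambda> * (P + Cb)"
      using H'_le[of "fst z" "snd z"] mult_left_mono[OF \<xi> \<Lambda>(1)] by simp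
    also have "\<dots> \<le> \<bar>c\<bar> * N d * (Pm + Cb)"
      using \<Lambda> R P Cb by (intro mult_mono) auto
    finally have H'b: "norm ((b - s) *\<^sub>R H' (fst z) (snd z)) \<le> h * (\<bar>c\<bar> * N d * (Pm + Cb))"
      unfolding norm_scaleR using r by (intro mult_mono) auto
    have Vb: "norm ((b - s) *\<^sub>R V) \<le> h * Cb"
      unfolding norm_scaleR using r V h by (intro mult_mono) auto
    have "\<bar>D (shear b H (s, z)) ((b - s) *\<^sub>R V, U - H (fst z) + (b - s) *\<^sub>R H' (fst z) (snd z))\<bar>
      \<le> norm ((b - s) *\<^sub>R V) + (norm (U - H (fst z)) + norm ((b - s) *\<^sub>R H' (fst z) (snd z)))"
      by (rule order_trans[OF D1 order_trans[OF norm_Pair_le add_left_mono[OF norm_triangle_ineq]]])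
    also have "\<dots> \<le> h * Cb + (\<delta> + h * (\<bar>c\<bar> * N d * (Pm + Cb)))"
      by (intro add_mono Vb U H'b)
    finally show ?thesis by (simp add: \<kappa>1_def algebra_simps)
  qed
  \<comment> \<open>The time derivative of the shear cancels the free transport and replaces the
    force by its difference from \<open>H\<close>. Every other term keeps a factor
    \<open>b - s\<close>.\<close>
  have E_eq: "E (s, z) (1, snd z, V) = D (shear b H (s, z)) ((b - s) *\<^sub>R V, V - H (fst z) + (b - s) *\<^sub>R H' (fst z) (snd z))" for s z V
    by (simp add: E_def shear_deriv_def algebra_simps)
  have rates: "\<bar>F.rate E s - G.rate E s\<bar> \<le> \<bar>c\<bar> * N d * \<alpha> + beta d R s + kappa d R Pm * h" if s: "a < s" "s \<le> b" for s
  proof -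
    have sS: "s \<in> {0..S}" and as: "a \<le> s" "s < S" using s ab by auto
    interpret f: bounded_marginal "f s" A M using F.bounded_marginal[OF sS] .
    interpret g: bounded_marginal "g s" A M using G.bounded_marginal[OF sS] .
    define \<delta> where "\<delta> = \<bar>c\<bar> * (16 * pi * d * A + F.tail R s / d\<^sup>2 + h * \<kappa>2)"
    have U: "norm (F.force s x - H x) \<le> \<delta>" for x
    proof -
      have "(s - a) * \<kappa>2 \<le> h * \<kappa>2" using s \<kappa> by (intro mult_right_mono) (auto simp: h_def)
      then have "\<bar>c\<bar> * (16 * pi * d * A + F.tail R s / d\<^sup>2 + (s - a) * \<kappa>2) \<le> \<delta>"
        unfolding \<delta>_def by (intro mult_left_mono add_left_mono) auto
      then show ?thesis
        using F.force_local_force_le[OF ab(1) as d(1) R(1), of x] unfolding H_def \<kappa>2_def by (rule order_trans[rotated])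
    qed
    have Ff: "\<bar>F.rate E s\<bar> \<le> (h * \<kappa>1 + \<delta>) * M"
      unfolding F.rate_def E_eq by (rule F.abs_integral_le[OF sS pointwise[OF s F.norm_force_le[OF sS] U]])
    \<comment> \<open>The velocity gradient of \<open>\<phi>\<close> along the shear, which is the
      density paired with the difference of the two forces in \<open>kernel_gap\<close>.\<close>
    define D' where "D' z u = D (shear b H (s, z)) (0, u)" for z u
    have lin': "linear (D' z)" for z
    proof -
      have "linear (\<lambda>u::R3. (0::R3, u))" by (auto intro!: linearI)
      from linear_compose[OF this C1D(3)[OF c1]] show ?thesis by (simp add: D'_def[abs_def] o_def)
    qed
    have D'1: "\<bar>D' z u\<bar> \<le> norm u" for z u
      using D1[of "shear b H (s, z)" "(0, u)"] by (simp add: D'_def)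
    have D'c: "continuous_on UNIV (\<lambda>z. D' z u)" for u
    proof -
      have "continuous_on UNIV (shear b H)"
        by (rule has_derivative_continuous_on[where f' = "shear_deriv b H H'"]) (simp add: shear_has_derivative[OF H_der])
      then have "continuous_on UNIV (\<lambda>z. shear b H (s, z))"
        by (rule continuous_on_compose2) (auto intro!: continuous_intros)
      then show ?thesis unfolding D'_def by (intro C1_continuous_compose[OF c1] continuous_intros)
    qed
    have int_D': "integrable (g s) (\<lambda>z. D' z (V z))" if "V \<in> borel_measurable borel" "\<And>z. norm (V z) \<le> B" for V B
      using order_trans[OF D'1 that(2)] by (intro G.integrable_bounded[OF sS linear_family_measurable[OF lin' D'c measurable_ident_sets[OF refl] that(1)], where K = B]) simp
    define X where "X z = field 0 (g s) (fst z) - field 0 (f s) (fst z)" for z :: "R3 \<times> R3"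
    define Y where "Y z = field d (g s) (fst z) - field d (f s) (fst z)" for z :: "R3 \<times> R3"
    have X: "X \<in> borel_measurable borel" "norm (X z) \<le> Q + Q" for z
    proof -
      show "X \<in> borel_measurable borel" unfolding X_def[abs_def] by (intro borel_measurable_diff f.field_measurable g.field_measurable)
      show "norm (X z) \<le> Q + Q"
        unfolding X_def Q_def by (intro order_trans[OF norm_triangle_ineq4] add_mono f.norm_field_le g.norm_field_le)
    qed
    have Y: "Y \<in> borel_measurable borel" "norm (Y z) \<le> Q + Q" for z
    proof -
      show "Y \<in> borel_measurable borel" unfolding Y_def[abs_def] by (intro borel_measurable_diff f.field_measurable g.field_measurable)
      show "norm (Y z) \<le> Q + Q"
        unfolding Y_def Q_def by (intro order_trans[OF norm_triangle_ineq4] add_mono f.norm_field_le g.norm_field_le)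
    qed
    have XY: "norm (X z - Y z) \<le> 32 * pi * d * A" for z
    proof -
      have "X z - Y z = (field 0 (g s) (fst z) - field d (g s) (fst z)) - (field 0 (f s) (fst z) - field d (f s) (fst z))"
        by (simp add: X_def Y_def)
      also have "norm \<dots> \<le> 16 * pi * d * A + 16 * pi * d * A"
        by (intro order_trans[OF norm_triangle_ineq4] add_mono f.norm_field_diff_le g.norm_field_diff_le d)
      finally show ?thesis by (simp add: mult_ac)
    qed
    have "(LINT z|g s. D' z (X z)) = (LINT z|g s. D' z (X z - Y z)) + (LINT z|g s. D' z (Y z))"
      using int_D'[OF X] int_D'[OF Y] by (simp add: linear_diff[OF lin'])
    moreover have "\<bar>LINT z|g s. D' z (X z - Y z)\<bar> \<le> 32 * pi * d * A * M"
      by (rule G.abs_integral_le[OF sS order_trans[OF D'1 XY]])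
    moreover have "\<bar>LINT z|g s. D' z (Y z)\<bar> \<le> N d * (\<alpha> + (s - a) * \<kappa>3) + Q * tails R s"
    proof -
      have "2 * R \<le> P + Cb * (b - a)" using R Cb ab by (simp add: add_increasing2)
      from kernel_gap[OF ab(1) as d R(1) this lin' D'1 D'c IH] show ?thesis
        unfolding Y_def \<kappa>3_def Q_def tails_def by simp
    qed
    moreover have "N d * (\<alpha> + (s - a) * \<kappa>3) \<le> N d * (\<alpha> + h * \<kappa>3)"
      using s \<kappa> Nd by (intro mult_left_mono add_left_mono mult_right_mono) (auto simp: h_def)
    ultimately have X_le: "\<bar>LINT z|g s. D' z (X z)\<bar> \<le> 32 * pi * d * A * M + (N d * (\<alpha> + h * \<kappa>3) + Q * tails R s)"
      by linarith
    \<comment> \<open>Only the velocity component is changed from the force of \<open>g\<close> to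
      that of \<open>f\<close>; by linearity the change appears as \<open>c * D' z (X z)\<close>,
      the term to be estimated by duality.\<close>
    have split: "E (s, z) (1, snd z, G.force s (fst z))
      = D (shear b H (s, z)) ((b - s) *\<^sub>R G.force s (fst z), F.force s (fst z) - H (fst z) + (b - s) *\<^sub>R H' (fst z) (snd z)) + c * D' z (X z)" for z
    proof -
      have "((b - s) *\<^sub>R G.force s (fst z), G.force s (fst z) - H (fst z) + (b - s) *\<^sub>R H' (fst z) (snd z))
        = ((b - s) *\<^sub>R G.force s (fst z), F.force s (fst z) - H (fst z) + (b - s) *\<^sub>R H' (fst z) (snd z)) + c *\<^sub>R (0, X z)"
        by (simp add: X_def F.force_def G.force_def scaleR_diff_right)
      then show ?thesis
        unfolding E_eq D'_def by (simp only: linear_add[OF C1D(3)[OF c1]] linear_scale[OF C1D(3)[OF c1]] real_scaleR_def)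
    qed
    define Z where "Z z = D (shear b H (s, z)) ((b - s) *\<^sub>R G.force s (fst z), F.force s (fst z) - H (fst z) + (b - s) *\<^sub>R H' (fst z) (snd z))" for z
    have Z_le: "\<bar>Z z\<bar> \<le> h * \<kappa>1 + \<delta>" for z
      unfolding Z_def by (rule pointwise[OF s G.norm_force_le[OF sS] U])
    have iX: "integrable (g s) (\<lambda>z. D' z (X z))" by (rule int_D'[OF X])
    have Z_int: "integrable (g s) Z"
    proof (rule g.integrable_const_bound[where B = "h * \<kappa>1 + \<delta>"])
      have "Z = (\<lambda>z. E (s, z) (1, snd z, G.force s (fst z)) - c * D' z (X z))"
        unfolding split Z_def by simp
      then show "Z \<in> borel_measurable (g s)"
        using G.rate_integrand_measurable[OF C1\<Phi> sS] iX by simp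
    qed (use Z_le in auto)
    have "G.rate E s = (LINT z|g s. Z z) + c * (LINT z|g s. D' z (X z))"
      unfolding G.rate_def split Z_def[symmetric] using Z_int iX by simp
    moreover have "\<bar>LINT z|g s. Z z\<bar> \<le> (h * \<kappa>1 + \<delta>) * M" by (rule G.abs_integral_le[OF sS Z_le])
    moreover have "\<bar>c * (LINT z|g s. D' z (X z))\<bar> \<le> \<bar>c\<bar> * (32 * pi * d * A * M + (N d * (\<alpha> + h * \<kappa>3) + Q * tails R s))"
      unfolding abs_mult using X_le by (rule mult_left_mono) simp
    ultimately have "\<bar>F.rate E s - G.rate E s\<bar> \<le> 2 * ((h * \<kappa>1 + \<delta>) * M)
        + \<bar>c\<bar> * (32 * pi * d * A * M + (N d * (\<alpha> + h * \<kappa>3) + Q * tails R s))"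
      using Ff by linarith
    also have "\<dots> = \<bar>c\<bar> * N d * \<alpha> + (64 * pi * \<bar>c\<bar> * A * M * d + 2 * M * \<bar>c\<bar> / d\<^sup>2 * F.tail R s + \<bar>c\<bar> * Q * tails R s) + kappa d R Pm * h"
      by (simp add: \<delta>_def kappa_def flip: \<kappa>1_def \<kappa>2_def \<kappa>3_def) (simp add: algebra_simps)
    also have "\<dots> \<le> \<bar>c\<bar> * N d * \<alpha> + beta d R s + kappa d R Pm * h"
    proof -
      have "2 * M * \<bar>c\<bar> / d\<^sup>2 * F.tail R s \<le> 2 * M * \<bar>c\<bar> / d\<^sup>2 * tails R s"
        using M G.tail_bounds(1)[OF sS, of R] by (intro mult_left_mono) (auto simp: tails_def)
      then show ?thesis by (simp add: beta_def Q_def algebra_simps)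
    qed
    finally show ?thesis .
  qed
  have Fi: "integrable lborel (\<lambda>s. indicator {a<..b} s * F.rate E s)"
    by (rule F.rate_integrable[OF ab(1,3) C1\<Phi> supp]) auto
  have Gi: "integrable lborel (\<lambda>s. indicator {a<..b} s * G.rate E s)"
    by (rule G.rate_integrable[OF ab(1,3) C1\<Phi> supp]) auto
  have ci: "integrable lborel (\<lambda>s. indicator {a<..b} s * k)" for k :: real
    using ab by (intro integrable_mult_left integrable_real_indicator) auto
  have bi: "integrable lborel (\<lambda>s. indicator {a<..b} s * beta d R s)"
    by (rule beta_integrable) (use ab in auto)
  have "\<bar>(LINT s|lborel. indicator {a<..b} s * F.rate E s) - (LINT s|lborel. indicator {a<..b} s * G.rate E s)\<bar>
    = \<bar>LINT s|lborel. indicator {a<..b} s * F.rate E s - indicator {a<..b} s * G.rate E s\<bar>"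
    using Fi Gi by simp
  also have "\<dots> \<le> (LINT s|lborel. indicator {a<..b} s * (\<bar>c\<bar> * N d * \<alpha> + kappa d R Pm * h) + indicator {a<..b} s * beta d R s)"
  proof (rule order_trans[OF integral_abs_bound integral_mono])
    show "\<bar>indicator {a<..b} s * F.rate E s - indicator {a<..b} s * G.rate E s\<bar>
      \<le> indicator {a<..b} s * (\<bar>c\<bar> * N d * \<alpha> + kappa d R Pm * h) + indicator {a<..b} s * beta d R s" for s
      using rates[of s] by (auto simp: indicator_def)
  qed (use Fi Gi ci bi in auto)
  also have "\<dots> = h * (\<bar>c\<bar> * N d * \<alpha> + kappa d R Pm * h) + (LINT s|lborel. indicator {a<..b} s * beta d R s)"
    using ci bi ab by (simp add: h_def)
  finally have "\<bar>gap b \<phi>\<bar> \<le> (1 + h * (1 + \<Lambda>)) * \<alpha> + (h * (\<bar>c\<bar> * N d * \<alpha> + kappa d R Pm * h) + (LINT s|lborel. indicator {a<..b} s * beta d R s))"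
    unfolding gap_eq using slice by linarith
  moreover have "0 \<le> \<alpha>" using slice h \<Lambda> by (smt (verit) mult_less_0_iff mult_nonneg_nonneg)
  then have "h * \<Lambda> * \<alpha> \<le> h * (\<bar>c\<bar> * N d) * \<alpha>"
    using h \<Lambda> by (intro mult_right_mono mult_left_mono) auto
  ultimately show ?thesis
    by (simp add: growth_def h_def[symmetric] power2_eq_square algebra_simps)
qed

end

section \<open>Uniqueness\<close>

lemma weak_solution_bounded_positive:
  assumes "vlasov_poisson_weak_solution \<epsilon> T f0 f" "t \<in> {0..<T}"
  shows "sets (f t) = sets borel" "finite_measure (f t)"
proof -
  have "f ` {0..<T} \<subseteq> bounded_positive_measures"
    using assms(1) by (simp add: vlasov_poisson_weak_solution_def continuous_map_weak_star_topology_iff)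
  then have "f t \<in> bounded_positive_measures" using assms(2) by blast
  then show "sets (f t) = sets borel" "finite_measure (f t)" by (simp_all add: bounded_positive_measures_def)
qed

context vp_pair
begin

text \<open>No gradient bound and no velocity radius is attached, so that equality reached at the
  end of one interval starts the estimate on the next one for every choice of \<open>R\<close> and
  \<open>d\<close>.\<close>

definition agree :: "real \<Rightarrow> bool" where
  "agree t \<longleftrightarrow> (\<forall>\<phi> D. C1 \<phi> D \<longrightarrow> (\<exists>R. \<forall>z. R < norm z \<longrightarrow> \<phi> z = 0) \<longrightarrow> gap t \<phi> = 0)"

lemma beta_nonneg: "0 < d \<Longrightarrow> s \<in> {0..S} \<Longrightarrow> 0 \<le> beta d R s"
  using F.tail_bounds(1)[of s R] G.tail_bounds(1)[of s R] F.M_nonneg F.A_nonneg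
  by (auto simp: beta_def tails_def intro!: add_nonneg_nonneg mult_nonneg_nonneg)

lemma kappa_nonneg:
  assumes "0 < d" "d \<le> 1" "0 \<le> R" "0 \<le> Pm"
  shows "0 \<le> kappa d R Pm"
  using N_bounds[OF assms(1,2)] assms F.M_nonneg F.Cb_nonneg
  by (auto simp: kappa_def intro!: add_nonneg_nonneg mult_nonneg_nonneg)

lemma growth_pos: "0 < d \<Longrightarrow> d \<le> 1 \<Longrightarrow> 0 \<le> growth d"
  using N_bounds[of d] by (auto simp: growth_def intro!: add_nonneg_nonneg mult_nonneg_nonneg)

text \<open>The estimate at step \<open>k + 1\<close> calls the one at step \<open>k\<close> with a
  velocity radius larger by \<open>Cb * h\<close>, so the admissible radius shrinks with
  \<open>k\<close> and is \<open>2 * R\<close> at \<open>k = n\<close>. The factors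
  \<open>1 + h * growth d\<close> are replaced by exponentials, and each source is multiplied by the
  exponential over the whole elapsed time.\<close>

lemma gronwall:
  assumes t0: "0 \<le> t0" "agree t0" and h: "0 < h" "h \<le> 1" and d: "0 < d" "d \<le> 1" and R: "8 \<le> R"
    and end_le: "t0 + real n * h < S"
  shows "k \<le> n \<Longrightarrow> test_class (2 * R + Cb * h * (real n - real k)) \<phi> D \<Longrightarrow>
    \<bar>gap (t0 + real k * h) \<phi>\<bar> \<le> exp (growth d * (real k * h)) *
      ((LINT s|lborel. indicator {t0<..t0 + real k * h} s * beta d R s) + real k * (kappa d R (2 * R + Cb * h * real n) * h\<^sup>2))"
proof (induction k arbitrary: \<phi> D)
  case 0
  then have "gap t0 \<phi> = 0" using t0 unfolding agree_def test_class_def by blast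
  then show ?case by simp
next
  case (Suc k)
  let ?a = "t0 + real k * h" and ?b = "t0 + real (Suc k) * h"
  let ?I = "\<lambda>a b. LINT s|lborel. indicator {a<..b} s * beta d R s"
  let ?\<kappa> = "kappa d R (2 * R + Cb * h * real n) * h\<^sup>2"
  define \<alpha> where "\<alpha> = exp (growth d * (real k * h)) * (?I t0 ?a + real k * ?\<kappa>)"
  have Cb: "0 \<le> Cb" by (rule F.Cb_nonneg)
  have ba: "?b - ?a = h" "?a < ?b" using h by (simp_all add: algebra_simps)
  have kh: "0 \<le> real k * h" using h by simp
  have "real (Suc k) * h \<le> real n * h" using Suc.prems h by (intro mult_right_mono) auto
  then have bS: "?b < S" using end_le by linarith
  have sub: "{t0<..?a} \<subseteq> {0..S}" "{?a<..?b} \<subseteq> {0..S}" "{t0<..?b} \<subseteq> {0..S}"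
  proof -
    have *: "{x<..y} \<subseteq> {0..S}" if "0 \<le> x" "y \<le> S" for x y using that by auto
    show "{t0<..?a} \<subseteq> {0..S}" "{?a<..?b} \<subseteq> {0..S}" "{t0<..?b} \<subseteq> {0..S}"
      by (rule *; use t0(1) bS ba(2) kh in linarith)+
  qed
  have I_nonneg: "0 \<le> ?I x y" if "{x<..y} \<subseteq> {0..S}" for x y
  proof (rule integral_nonneg_AE, rule AE_I2)
    fix s
    show "0 \<le> indicator {x<..y} s * beta d R s"
    proof (cases "s \<in> {x<..y}")
      case True
      then have "s \<in> {0..S}" using that by blast
      from beta_nonneg[OF d(1) this] show ?thesis by simp
    qed simp
  qed
  let ?P = "2 * R + Cb * h * (real n - real (Suc k))"
  have P: "2 * R \<le> ?P" "?P \<le> 2 * R + Cb * h * real n"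
    using Suc.prems Cb h by (auto intro!: mult_left_mono)
  have "\<bar>gap ?b \<phi>\<bar> \<le> (1 + (?b - ?a) * growth d) * \<alpha> + ?I ?a ?b + kappa d R (2 * R + Cb * h * real n) * (?b - ?a)\<^sup>2"
  proof (rule step[OF _ ba(2) bS _ d R P _ Suc.prems(2)])
    show "\<bar>gap ?a \<psi>\<bar> \<le> \<alpha>" if "test_class (?P + Cb * (?b - ?a)) \<psi> E" for \<psi> E
    proof -
      have "?P + Cb * (?b - ?a) = 2 * R + Cb * h * (real n - real k)"
        unfolding ba by (simp add: algebra_simps)
      with that have "test_class (2 * R + Cb * h * (real n - real k)) \<psi> E" by (simp only:)
      from Suc.IH[OF _ this] Suc.prems(1) show ?thesis by (simp add: \<alpha>_def)
    qed
  qed (use t0 kh ba h in auto)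
  also have "\<dots> = (1 + h * growth d) * \<alpha> + (?I ?a ?b + ?\<kappa>)" unfolding ba by simp
  also have "\<dots> \<le> exp (growth d * h) * \<alpha> + exp (growth d * (real (Suc k) * h)) * (?I ?a ?b + ?\<kappa>)"
  proof (intro add_mono mult_right_mono)
    show "1 + h * growth d \<le> exp (growth d * h)" using exp_ge_add_one_self[of "growth d * h"] by (simp add: mult.commute)
    have "0 \<le> ?I t0 ?a" by (rule I_nonneg[OF sub(1)])
    moreover have \<kappa>: "0 \<le> ?\<kappa>"
      using kappa_nonneg[OF d] R Cb h by (intro mult_nonneg_nonneg) (auto intro!: add_nonneg_nonneg)
    ultimately show "0 \<le> \<alpha>" by (simp add: \<alpha>_def)
    have "0 \<le> ?I ?a ?b" by (rule I_nonneg[OF sub(2)])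
    moreover have "1 \<le> exp (growth d * (real (Suc k) * h))"
      using growth_pos[OF d] h by simp
    ultimately show "?I ?a ?b + ?\<kappa> \<le> exp (growth d * (real (Suc k) * h)) * (?I ?a ?b + ?\<kappa>)"
      using \<kappa> mult_right_mono[of 1 "exp (growth d * (real (Suc k) * h))" "?I ?a ?b + ?\<kappa>"] by simp
  qed
  also have "exp (growth d * h) * \<alpha> = exp (growth d * (real (Suc k) * h)) * (?I t0 ?a + real k * ?\<kappa>)"
  proof -
    have "growth d * (real (Suc k) * h) = growth d * h + growth d * (real k * h)" by (simp add: algebra_simps)
    then show ?thesis by (simp only: \<alpha>_def exp_add mult.assoc)
  qed
  also have "\<dots> + exp (growth d * (real (Suc k) * h)) * (?I ?a ?b + ?\<kappa>)
    = exp (growth d * (real (Suc k) * h)) * ((?I t0 ?a + ?I ?a ?b) + real (Suc k) * ?\<kappa>)"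
    by (simp add: distrib_left distrib_right)
  also have "?I t0 ?a + ?I ?a ?b = ?I t0 ?b"
  proof -
    have "?I t0 ?b = (LINT s|lborel. indicator {t0<..?a} s * beta d R s + indicator {?a<..?b} s * beta d R s)"
    proof -
      have *: "indicator {x<..z} s = (indicator {x<..y} s + indicator {y<..z} s :: real)" if "x \<le> y" "y \<le> z" for x y z s :: real
        using that by (auto simp: indicator_def)
      have "t0 \<le> ?a" "?a \<le> ?b" using kh ba(2) by linarith+
      from *[OF this] show ?thesis by (simp only: distrib_right)
    qed
    also have "\<dots> = ?I t0 ?a + ?I ?a ?b"
      by (rule Bochner_Integration.integral_add) (intro beta_integrable sub, simp)+
    finally show ?thesis ..
  qed
  finally show ?case .
qed

section \<open>Passage to the limit and chaining of short intervals\<close>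

lemma agree_scaled:
  assumes "\<And>(\<phi> :: R3 \<times> R3 \<Rightarrow> real) D R. C1 \<phi> D \<Longrightarrow> (\<And>z v. \<bar>D z v\<bar> \<le> norm v) \<Longrightarrow> (\<And>z. R < norm z \<Longrightarrow> \<phi> z = 0) \<Longrightarrow> gap t \<phi> = 0"
  shows "agree t"
  unfolding agree_def
proof (intro allI impI)
  fix \<phi> :: "R3 \<times> R3 \<Rightarrow> real" and D assume \<phi>: "C1 \<phi> D" "\<exists>R. \<forall>z. R < norm z \<longrightarrow> \<phi> z = 0"
  then obtain R where R: "\<And>z. R < norm z \<Longrightarrow> \<phi> z = 0" by blast
  obtain B where B: "B > 0" "\<And>z v. \<bar>D z v\<bar> \<le> B * norm v" using C1_bounded[OF \<phi>(1) R] by blast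
  have "gap t (\<lambda>z. (1 / B) * \<phi> z) = 0"
  proof (rule assms[OF C1_cmult[OF \<phi>(1)]])
    show "\<bar>1 / B * D z v\<bar> \<le> norm v" for z v
      using B(1) B(2)[of z v] by (simp add: abs_mult pos_divide_le_eq mult.commute)
    show "1 / B * \<phi> z = 0" if "R < norm z" for z using R[OF that] by simp
  qed
  then show "gap t \<phi> = 0" using B(1) unfolding gap_cmult by simp
qed

text \<open>Two limits at fixed \<open>d\<close>. With \<open>n\<close> steps of length
  \<open>\<tau> / n\<close> the \<open>kappa\<close> errors sum to a multiple of
  \<open>1 / n\<close>, which vanishes for fixed \<open>R\<close>. Only then may \<open>R\<close>
  tend to infinity: the coefficient \<open>C2\<close> of the tails depends on \<open>d\<close> but
  not on \<open>R\<close>.\<close>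

lemma short_time_bound:
  assumes t0: "0 \<le> t0" "agree t0" and \<tau>: "0 < \<tau>" "\<tau> \<le> 1" "t0 + \<tau> < S" and d: "0 < d" "d \<le> 1"
    and \<phi>: "C1 \<phi> D" "\<And>z v. \<bar>D z v\<bar> \<le> norm v" and R0: "\<And>z. R0 < norm z \<Longrightarrow> \<phi> z = 0"
  shows "\<bar>gap (t0 + \<tau>) \<phi>\<bar> \<le> exp (growth d * \<tau>) * (64 * pi * \<bar>c\<bar> * A * M * d)"
proof -
  define C2 where "C2 = 2 * M * \<bar>c\<bar> / d\<^sup>2 + \<bar>c\<bar> * (A * (4 * pi) + M)"
  have C2: "0 \<le> C2" using F.M_nonneg F.A_nonneg by (auto simp: C2_def intro!: add_nonneg_nonneg)
  have Cb: "0 \<le> Cb" by (rule F.Cb_nonneg)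
  have 1: "\<bar>gap (t0 + \<tau>) \<phi>\<bar> \<le> exp (growth d * \<tau>) * (LINT s|lborel. indicator {t0<..t0 + \<tau>} s * beta d R s)"
    if R: "8 \<le> R" "R0 \<le> 2 * R" for R
  proof -
    let ?J = "LINT s|lborel. indicator {t0<..t0 + \<tau>} s * beta d R s"
    have "\<bar>gap (t0 + \<tau>) \<phi>\<bar> \<le> exp (growth d * \<tau>) * (?J + kappa d R (2 * R + Cb * \<tau>) * \<tau>\<^sup>2 * (1 / real (Suc n)))" for n
    proof -
      define h where "h = \<tau> / real (Suc n)"
      have h: "0 < h" "h \<le> 1" "real (Suc n) * h = \<tau>"
        using \<tau> by (auto simp: h_def divide_le_eq)
      have "test_class (2 * R + Cb * h * (real (Suc n) - real (Suc n))) \<phi> D"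
        unfolding test_class_def
      proof (intro conjI allI impI exI)
        show "\<phi> z = 0" if "2 * R + Cb * h * (real (Suc n) - real (Suc n)) < norm (snd z)" for z
          using that R norm_snd_le[of "snd z" "fst z"] by (intro R0) simp
      qed (use \<phi> R0 in auto)
      note tc = this
      have "t0 + real (Suc n) * h < S" unfolding h(3) by (rule \<tau>(3))
      note * = gronwall[OF t0 h(1,2) d R(1) this order_refl tc]
      have "Cb * h * real (Suc n) = Cb * \<tau>" by (simp only: h(3)[symmetric] mult_ac)
      with * have "\<bar>gap (t0 + \<tau>) \<phi>\<bar> \<le> exp (growth d * \<tau>) * (?J + real (Suc n) * (kappa d R (2 * R + Cb * \<tau>) * h\<^sup>2))"
        by (simp only: h(3))
      also have "real (Suc n) * (kappa d R (2 * R + Cb * \<tau>) * h\<^sup>2) = kappa d R (2 * R + Cb * \<tau>) * \<tau>\<^sup>2 * (1 / real (Suc n))"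
        by (simp add: h_def power2_eq_square del: of_nat_Suc)
      finally show ?thesis .
    qed
    note bound = this
    have "(\<lambda>n. exp (growth d * \<tau>) * (?J + kappa d R (2 * R + Cb * \<tau>) * \<tau>\<^sup>2 * (1 / real (Suc n))))
      \<longlonglongrightarrow> exp (growth d * \<tau>) * (?J + kappa d R (2 * R + Cb * \<tau>) * \<tau>\<^sup>2 * 0)"
      by (intro tendsto_intros LIMSEQ_Suc[OF lim_1_over_n])
    from LIMSEQ_le_const[OF this] bound show ?thesis by auto
  qed
  have 2: "(LINT s|lborel. indicator {t0<..t0 + \<tau>} s * beta d R s)
    \<le> 64 * pi * \<bar>c\<bar> * A * M * d + C2 * ((LINT s|lborel. indicator {0..S} s * F.tail R s) + (LINT s|lborel. indicator {0..S} s * G.tail R s))" for R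
  proof -
    let ?C1 = "64 * pi * \<bar>c\<bar> * A * M * d"
    have C1: "0 \<le> ?C1" using F.M_nonneg F.A_nonneg d by simp
    have iF: "integrable lborel (\<lambda>s. indicator {0..S} s * F.tail R s)" and iG: "integrable lborel (\<lambda>s. indicator {0..S} s * G.tail R s)"
      by (rule F.tail_integrable G.tail_integrable; simp)+
    have i1: "integrable lborel (\<lambda>s. indicator {t0<..t0 + \<tau>} s * ?C1)"
      using \<tau> by (intro integrable_mult_left integrable_real_indicator) auto
    have "(LINT s|lborel. indicator {t0<..t0 + \<tau>} s * beta d R s)
      \<le> (LINT s|lborel. indicator {t0<..t0 + \<tau>} s * ?C1 + C2 * (indicator {0..S} s * F.tail R s + indicator {0..S} s * G.tail R s))"
    proof (rule integral_mono)
      show "integrable lborel (\<lambda>s. indicator {t0<..t0 + \<tau>} s * beta d R s)"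
        by (rule beta_integrable) (use t0 \<tau> in auto)
      show "integrable lborel (\<lambda>s. indicator {t0<..t0 + \<tau>} s * ?C1 + C2 * (indicator {0..S} s * F.tail R s + indicator {0..S} s * G.tail R s))"
        by (intro Bochner_Integration.integrable_add integrable_mult_right i1 iF iG)
      show "indicator {t0<..t0 + \<tau>} s * beta d R s \<le> indicator {t0<..t0 + \<tau>} s * ?C1 + C2 * (indicator {0..S} s * F.tail R s + indicator {0..S} s * G.tail R s)" for s
        using F.tail_bounds(1)[of s R] G.tail_bounds(1)[of s R] C2 t0 \<tau>
        by (auto simp: indicator_def beta_def tails_def C2_def[symmetric])
    qed
    also have "\<dots> = \<tau> * ?C1 + C2 * ((LINT s|lborel. indicator {0..S} s * F.tail R s) + (LINT s|lborel. indicator {0..S} s * G.tail R s))"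
      using i1 iF iG \<tau> by simp
    also have "\<tau> * ?C1 \<le> ?C1" using C1 \<tau> by (intro mult_left_le_one_le) auto
    finally show ?thesis by simp
  qed
  obtain n0 :: nat where n0: "max 8 \<bar>R0\<bar> \<le> real n0" using real_arch_simple by blast
  have "\<bar>gap (t0 + \<tau>) \<phi>\<bar> \<le> exp (growth d * \<tau>) * (64 * pi * \<bar>c\<bar> * A * M * d
      + C2 * ((LINT s|lborel. indicator {0..S} s * F.tail (real n) s) + (LINT s|lborel. indicator {0..S} s * G.tail (real n) s)))"
    if "n \<ge> n0" for n
  proof -
    have "8 \<le> real n" "R0 \<le> 2 * real n" using that n0 by (auto simp: max_def split: if_splits)
    from order_trans[OF 1[OF this] mult_left_mono[OF 2]] show ?thesis by simp
  qed
  note bound = this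
  have "(\<lambda>n. exp (growth d * \<tau>) * (64 * pi * \<bar>c\<bar> * A * M * d
      + C2 * ((LINT s|lborel. indicator {0..S} s * F.tail (real n) s) + (LINT s|lborel. indicator {0..S} s * G.tail (real n) s))))
      \<longlonglongrightarrow> exp (growth d * \<tau>) * (64 * pi * \<bar>c\<bar> * A * M * d + C2 * (0 + 0))"
    by (intro tendsto_intros F.tail_integral_tendsto_0 G.tail_integral_tendsto_0)
  from LIMSEQ_le_const[OF this] bound show ?thesis by auto
qed

text \<open>The coefficient of \<open>ln (1 / d)\<close> in \<open>growth d\<close> is
  \<open>2 * \<bar>c\<bar> * (16 * pi * A)\<close>. The denominator holds twice this number, so that
  the exponential loses at most the factor \<open>1 / sqrt d\<close>; the summand 1 also covers
  \<open>A = 0\<close>. The length does not depend on the starting time.\<close>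

definition short_time :: real where
  "short_time = 1 / (1 + 64 * pi * \<bar>c\<bar> * A)"

lemma short_time: "0 < short_time" "short_time \<le> 1" "32 * pi * \<bar>c\<bar> * A * short_time \<le> 1 / 2"
proof -
  have "0 \<le> 64 * pi * \<bar>c\<bar> * A" using F.A_nonneg by simp
  then show "0 < short_time" "short_time \<le> 1" "32 * pi * \<bar>c\<bar> * A * short_time \<le> 1 / 2"
    by (auto simp: short_time_def divide_le_eq add_pos_nonneg field_simps)
qed

text \<open>The bound of \<open>short_time_bound\<close> has a source proportional to
  \<open>d\<close> and, on such an interval, an exponential of order at most
  \<open>1 / sqrt d\<close>. The gap is thus at most a constant times \<open>sqrt d\<close>, for
  every \<open>d\<close> in \<open>]0, 1]\<close>.\<close>

lemma agree_short_time:
  assumes t0: "0 \<le> t0" "agree t0" and \<tau>: "0 < \<tau>" "\<tau> \<le> short_time" "t0 + \<tau> < S"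
  shows "agree (t0 + \<tau>)"
proof (rule agree_scaled)
  fix \<phi> :: "R3 \<times> R3 \<Rightarrow> real" and D R assume \<phi>: "C1 \<phi> D" "\<And>z v. \<bar>D z v\<bar> \<le> norm v" "\<And>z. R < norm z \<Longrightarrow> \<phi> z = 0"
  \<comment> \<open>\<open>n0\<close> is \<open>N d\<close> without its logarithm.\<close>
  define n0 where "n0 = 16 * pi * A + 4 * M + (A * (4 * pi) + M) + 1"
  define K where "K = exp ((1 + 2 * \<bar>c\<bar> * n0) * \<tau>) * (64 * pi * \<bar>c\<bar> * A * M)"
  have K: "0 \<le> K" using F.A_nonneg F.M_nonneg by (simp add: K_def)
  have bound: "\<bar>gap (t0 + \<tau>) \<phi>\<bar> \<le> K * sqrt d" if d: "0 < d" "d \<le> 1" for d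
  proof -
    have ln: "0 \<le> ln (1 / d)" using d by simp
    have "growth d * \<tau> = (1 + 2 * \<bar>c\<bar> * n0) * \<tau> + (32 * pi * \<bar>c\<bar> * A * \<tau>) * ln (1 / d)"
      by (simp add: growth_def N_def log_bound_def n0_def algebra_simps)
    also have "(32 * pi * \<bar>c\<bar> * A * \<tau>) * ln (1 / d) \<le> 1 / 2 * ln (1 / d)"
    proof (rule mult_right_mono[OF _ ln])
      have "32 * pi * \<bar>c\<bar> * A * \<tau> \<le> 32 * pi * \<bar>c\<bar> * A * short_time"
        using \<tau> F.A_nonneg by (intro mult_left_mono) auto
      then show "32 * pi * \<bar>c\<bar> * A * \<tau> \<le> 1 / 2" using short_time(3) by (rule order_trans)
    qed
    also have "1 / 2 * ln (1 / d) = ln (1 / sqrt d)"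
      using d by (simp add: ln_div ln_sqrt)
    finally have "exp (growth d * \<tau>) \<le> exp ((1 + 2 * \<bar>c\<bar> * n0) * \<tau> + ln (1 / sqrt d))" by simp
    also have "\<dots> = exp ((1 + 2 * \<bar>c\<bar> * n0) * \<tau>) * (1 / sqrt d)"
      using d by (simp add: exp_add del: ln_div)
    finally have e: "exp (growth d * \<tau>) \<le> exp ((1 + 2 * \<bar>c\<bar> * n0) * \<tau>) * (1 / sqrt d)" .
    have "\<bar>gap (t0 + \<tau>) \<phi>\<bar> \<le> exp (growth d * \<tau>) * (64 * pi * \<bar>c\<bar> * A * M * d)"
      by (rule short_time_bound[OF t0 \<tau>(1) _ \<tau>(3) d \<phi>]) (use \<tau> short_time in auto)
    also have "\<dots> \<le> exp ((1 + 2 * \<bar>c\<bar> * n0) * \<tau>) * (1 / sqrt d) * (64 * pi * \<bar>c\<bar> * A * M * d)"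
      using e F.A_nonneg F.M_nonneg d by (intro mult_right_mono) auto
    also have "\<dots> = K * (d / sqrt d)" by (simp add: K_def)
    also have "d / sqrt d = sqrt d" using d by (simp add: real_div_sqrt)
    finally show ?thesis .
  qed
  have "(\<lambda>n. K * sqrt (1 / real (Suc n))) \<longlonglongrightarrow> K * sqrt 0"
    by (intro tendsto_intros LIMSEQ_Suc[OF lim_1_over_n])
  moreover have "\<bar>gap (t0 + \<tau>) \<phi>\<bar> \<le> K * sqrt (1 / real (Suc n))" for n
    by (rule bound) auto
  ultimately have "\<bar>gap (t0 + \<tau>) \<phi>\<bar> \<le> K * sqrt 0" by (intro LIMSEQ_le_const) auto
  then show "gap (t0 + \<tau>) \<phi> = 0" by simp
qed

text \<open>The initial datum enters only through the right-hand side of the weak formulation.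
  \<open>transport_identity_0\<close> at \<open>t = 0\<close> recovers it, its time integral running
  over a single point.\<close>

lemma agree_0: "agree 0"
proof -
  have *: "(LINT z|\<mu> 0. \<phi> z) = (LINT z|f0. \<phi> z)"
    if \<mu>: "vp_solution \<epsilon> T S A M f0 \<mu>" and \<phi>: "C1 \<phi> D" and R: "\<And>z. R < norm z \<Longrightarrow> \<phi> z = 0" for \<mu> \<phi> D R
  proof -
    interpret m: vp_solution \<epsilon> T S A M f0 \<mu> by fact
    have C1: "C1 (\<lambda>y :: real \<times> R3 \<times> R3. \<phi> (snd y)) (\<lambda>y v. D (snd y) (snd v))"
      unfolding C1_def
    proof (intro conjI allI)
      fix z v :: "real \<times> R3 \<times> R3"
      show "((\<lambda>y. \<phi> (snd y)) has_derivative (\<lambda>v. D (snd z) (snd v))) (at z)"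
        by (rule has_derivative_compose[OF has_derivative_snd[OF has_derivative_ident] C1D(1)[OF \<phi>]])
      show "continuous_on UNIV (\<lambda>z::real \<times> R3 \<times> R3. D (snd z) (snd v))"
        by (rule continuous_on_compose2[OF C1D(2)[OF \<phi>]]) (auto intro!: continuous_intros)
    qed
    have "(LINT s|lborel. indicator {0..0} s * m.rate (\<lambda>y v. D (snd y) (snd v)) s) = 0"
      by (rule integral_eq_zero_AE) (use AE_lborel_singleton[of "0::real"] in \<open>auto elim!: eventually_mono\<close>)
    then show ?thesis
      using m.transport_identity_0[OF order_refl m.S(1) C1, of R] R by simp
  qed
  show ?thesis
    unfolding agree_def gap_def
    using *[OF F.vp_solution_axioms] *[OF G.vp_solution_axioms] by (metis eq_iff_diff_eq_0)
qed

lemma agree_all: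
  assumes t: "0 \<le> t" "t < S"
  shows "agree t"
proof (cases "t = 0")
  case False
  obtain n :: nat where n: "t / short_time \<le> real n" using real_arch_simple by blast
  have "0 < t / short_time" using False t short_time by simp
  with n have n0: "0 < n" by (cases n) auto
  define \<tau> where "\<tau> = t / real n"
  have \<tau>: "0 < \<tau>" "\<tau> \<le> short_time" "real n * \<tau> = t"
    using False t short_time n n0 by (auto simp: \<tau>_def field_simps)
  have "agree (real k * \<tau>)" if "k \<le> n" for k
    using that
  proof (induction k)
    case (Suc k)
    have "real (Suc k) * \<tau> \<le> real n * \<tau>" using Suc.prems \<tau> by (intro mult_right_mono) auto
    then have "real k * \<tau> + \<tau> < S" using \<tau> t by (simp add: algebra_simps)
    then have "agree (real k * \<tau> + \<tau>)"
      using Suc \<tau> by (intro agree_short_time) auto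
    then show ?case by (simp add: algebra_simps)
  qed (use agree_0 in simp)
  from this[of n] \<tau>(3) show ?thesis by simp
qed (use agree_0 in simp)

text \<open>Mollifications are \<open>C1\<close> with support enlarged by at most 1, so
  \<open>agree_all\<close> covers them, and they converge pointwise under a common bound.\<close>

lemma integral_eq_compactly_supported:
  fixes \<phi> :: "R3 \<times> R3 \<Rightarrow> real"
  assumes t: "0 \<le> t" "t < S" and \<phi>: "compactly_supported \<phi>"
  shows "(LINT z|f t. \<phi> z) = (LINT z|g t. \<phi> z)"
proof -
  have tS: "t \<in> {0..S}" using t by simp
  have cont: "continuous_on UNIV \<phi>" using \<phi> by (simp add: compactly_supported_def)
  obtain R where R: "\<And>z. R < norm z \<Longrightarrow> \<phi> z = 0" using \<phi> by (auto simp: compactly_supported_def)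
  obtain B where B: "\<And>z. norm (\<phi> z) \<le> B" using compactly_supported_bounded[OF \<phi>] by metis
  have meas: "\<phi> \<in> borel_measurable borel" by (rule borel_measurable_continuous_onI[OF cont])
  have bd: "\<bar>mollify n \<phi> z\<bar> \<le> B" for n z
    using mollify_near[OF meas, of z n 0 B] B by simp
  have sm: "smooth (mollify n \<phi>)" for n by (rule mollify_smooth[OF \<phi>])
  have eq: "(LINT z|f t. mollify n \<phi> z) = (LINT z|g t. mollify n \<phi> z)" for n
  proof -
    have "Ck 1 (mollify n \<phi>)" using sm by (simp add: smooth_def)
    then have "C1 (mollify n \<phi>) (\<lambda>z. frechet_derivative (mollify n \<phi>) (at z))"
      by (simp add: C1_def frechet_derivative_works)
    moreover have "mollify n \<phi> z = 0" if "R + 1 < norm z" for z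
    proof -
      have "\<bar>mollify n \<phi> z - 0\<bar> \<le> 0"
      proof (rule mollify_near[OF meas])
        fix w assume "dist w z \<le> 1 / real (Suc n)"
        also have "1 / real (Suc n) \<le> 1" by simp
        finally have "R < norm w" using that norm_triangle_sub[of z w] by (simp add: dist_norm norm_minus_commute)
        then show "\<bar>\<phi> w - 0\<bar> \<le> 0" using R by simp
      qed
      then show ?thesis by simp
    qed
    ultimately show ?thesis using agree_all[OF t] unfolding agree_def gap_def by (metis eq_iff_diff_eq_0)
  qed
  have lim: "(\<lambda>n. LINT z|\<mu> t. mollify n \<phi> z) \<longlonglongrightarrow> (LINT z|\<mu> t. \<phi> z)"
    if \<mu>: "vp_solution \<epsilon> T S A M f0 \<mu>" for \<mu>
  proof -
    interpret m: vp_solution \<epsilon> T S A M f0 \<mu> by fact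
    interpret finite_measure "\<mu> t" by (rule m.finite_f[OF tS])
    show ?thesis
    proof (rule integral_dominated_convergence[where w = "\<lambda>_. B"])
      show "\<phi> \<in> borel_measurable (\<mu> t)" "mollify n \<phi> \<in> borel_measurable (\<mu> t)" for n
        by (subst measurable_cong_sets[OF m.sets_f[OF tS] refl];
            rule borel_measurable_continuous_onI; intro cont smooth_continuous sm)+
    qed (use bd mollify_tendsto[OF cont] in auto)
  qed
  show ?thesis
    using lim[OF F.vp_solution_axioms] lim[OF G.vp_solution_axioms] LIMSEQ_unique unfolding eq by blast
qed

lemma solutions_eq:
  assumes t: "0 \<le> t" "t < S"
  shows "f t = g t"
proof -
  have tS: "t \<in> {0..S}" using t by simp
  interpret f: finite_measure "f t" by (rule F.finite_f[OF tS])
  interpret g: finite_measure "g t" by (rule G.finite_f[OF tS])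
  have "measure (f t) (box a b) = measure (g t) (box a b)" for a b
  proof -
    obtain h :: "nat \<Rightarrow> R3 \<times> R3 \<Rightarrow> real" where h: "\<And>n. compactly_supported (h n)"
      "\<And>\<mu>. finite_measure \<mu> \<Longrightarrow> sets \<mu> = sets borel \<Longrightarrow> (\<lambda>n. LINT z|\<mu>. h n z) \<longlonglongrightarrow> measure \<mu> (box a b)"
      using box_approximation[of a b] by blast
    show ?thesis
      using h(2)[OF F.finite_f[OF tS] F.sets_f[OF tS]] h(2)[OF G.finite_f[OF tS] G.sets_f[OF tS]] LIMSEQ_unique
      unfolding integral_eq_compactly_supported[OF t h(1)] by blast
  qed
  then have box: "emeasure (f t) (box a b) = emeasure (g t) (box a b)" for a b
    by (simp add: f.emeasure_eq_measure g.emeasure_eq_measure)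
  show ?thesis
  proof (rule measure_eqI_generator_eq[of "range (\<lambda>(a, b). box a b)" UNIV _ _ "\<lambda>i. box (- (real i *\<^sub>R One)) (real i *\<^sub>R One)"])
    show "Int_stable (range (\<lambda>(a, b). box a b :: (R3 \<times> R3) set))" by (rule Int_stable_boxes)
    show "sets (f t) = sigma_sets UNIV (range (\<lambda>(a, b). box a b))" "sets (g t) = sigma_sets UNIV (range (\<lambda>(a, b). box a b))"
      using F.sets_f[OF tS] G.sets_f[OF tS] by (simp_all add: borel_eq_box)
    show "(\<Union>i. box (- (real i *\<^sub>R One)) (real i *\<^sub>R One :: R3 \<times> R3)) = UNIV" by (rule UN_box_eq_UNIV)
    show "range (\<lambda>i. box (- (real i *\<^sub>R One)) (real i *\<^sub>R One :: R3 \<times> R3)) \<subseteq> range (\<lambda>(a, b). box a b)" by auto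
  qed (use box in auto)
qed

end

section \<open>Common constants and the conclusion\<close>

lemma bounded_density_marginal:
  assumes "bounded_density T f" and "vlasov_poisson_weak_solution \<epsilon> T f0 f"
  obtains A where "0 \<le> A" "\<And>A' t. A \<le> A' \<Longrightarrow> t \<in> {0..<T} \<Longrightarrow> bounded_marginal (f t) A' (measure (f t) UNIV)"
proof -
  let ?s = "SUP t\<in>{0..<T}. Linfty_norm_density (spatial_marginal (f t))"
  define A where "A = enn2real ?s"
  have A: "ennreal A = ?s" using assms(1) by (simp add: bounded_density_def A_def)
  note f = weak_solution_bounded_positive[OF assms(2)]
  have "bounded_marginal (f t) A' (measure (f t) UNIV)" if A': "A \<le> A'" and t: "t \<in> {0..<T}" for A' t
  proof -
    have A0: "0 \<le> A" by (simp add: A_def)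
    interpret finite_measure "f t" by (rule f(2)[OF t])
    have "Linfty_norm_density (spatial_marginal (f t)) \<le> ennreal A'"
      using SUP_upper[OF t, of "\<lambda>t. Linfty_norm_density (spatial_marginal (f t))"] ennreal_leI[OF A'] unfolding A by (rule order_trans)
    from nn_integral_marginal_le_Linfty[OF f(1)[OF t] this] show ?thesis
      by unfold_locales (use f[OF t] A' A0 in auto)
  qed
  then show ?thesis by (intro that[of A]) (auto simp: A_def)
qed

lemma solution_mass_bounded:
  assumes "vlasov_poisson_weak_solution \<epsilon> T f0 f" "S < T"
  obtains M where "\<And>M' t. M \<le> M' \<Longrightarrow> t \<in> {0..S} \<Longrightarrow> measure (f t) UNIV \<le> M'"
proof -
  have f: "sets (f t) = sets borel" "finite_measure (f t)" if "t \<in> {0..S}" for t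
    using weak_solution_bounded_positive[OF assms(1), of t] that assms(2) by auto
  have cont: "continuous_on {0..S} (\<lambda>t. LINT z|f t. h z)" if "h \<in> C0_functions" for h
  proof -
    have "continuous_on {0..<T} (\<lambda>t. LINT z|f t. h z)"
      using assms(1) that by (auto simp: vlasov_poisson_weak_solution_def continuous_map_weak_star_topology_iff)
    then show ?thesis by (rule continuous_on_subset) (use assms(2) in auto)
  qed
  obtain M where "\<And>t. t \<in> {0..S} \<Longrightarrow> measure (f t) UNIV \<le> M"
    using weak_star_mass_bounded[OF cont f] by blast
  then show ?thesis by (intro that[of M]) (auto intro: order_trans)
qed

theorem theorem1p1:
  fixes \<epsilon> T :: real
    and f0 :: "(R3 \<times> R3) measure"
    and f g :: "real \<Rightarrow> (R3 \<times> R3) measure"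
  assumes "\<epsilon> \<noteq> 0"
    and "T > 0"
    and "f0 \<in> bounded_positive_measures"
    and "vlasov_poisson_weak_solution \<epsilon> T f0 f" and "bounded_density T f"
    and "vlasov_poisson_weak_solution \<epsilon> T f0 g" and "bounded_density T g"
  shows "\<forall>t\<in>{0..<T}. f t = g t"
proof
  fix t assume t: "t \<in> {0..<T}"
  \<comment> \<open>A time strictly between \<open>t\<close> and \<open>T\<close>: the masses are
    bounded on the compact interval \<open>[0, S]\<close>, and the comparison reaches all times
    before \<open>S\<close>.\<close>
  define S where "S = (t + T) / 2"
  have S: "0 < S" "S < T" "t < S" using t by (auto simp: S_def)
  obtain A1 where A1: "0 \<le> A1" "\<And>A' t. A1 \<le> A' \<Longrightarrow> t \<in> {0..<T} \<Longrightarrow> bounded_marginal (f t) A' (measure (f t) UNIV)"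
    using bounded_density_marginal[OF assms(5,4)] by blast
  obtain A2 where A2: "0 \<le> A2" "\<And>A' t. A2 \<le> A' \<Longrightarrow> t \<in> {0..<T} \<Longrightarrow> bounded_marginal (g t) A' (measure (g t) UNIV)"
    using bounded_density_marginal[OF assms(7,6)] by blast
  obtain M1 where M1: "\<And>M' t. M1 \<le> M' \<Longrightarrow> t \<in> {0..S} \<Longrightarrow> measure (f t) UNIV \<le> M'"
    using solution_mass_bounded[OF assms(4) S(2)] by blast
  obtain M2 where M2: "\<And>M' t. M2 \<le> M' \<Longrightarrow> t \<in> {0..S} \<Longrightarrow> measure (g t) UNIV \<le> M'"
    using solution_mass_bounded[OF assms(6) S(2)] by blast
  interpret vp_pair \<epsilon> T S "max A1 A2" "max M1 M2" f0 f g
    by (intro vp_pair.intro vp_solution.intro S assms A1 A2 M1 M2) auto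
  show "f t = g t" by (rule solutions_eq) (use t S in auto)
qed

end
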